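(* Suppose that $g$ is a pseudo-Anosov diffeomorphism of a surface $M$ (with orientable stable and unstable foliations) such that the induced action $g^*$ on the cohomology group $H^1(M,\mathbb R)$ has dominant eigenvalue with at least one Galois conjugate (different from it) outside the unit circle. Let $(\phi_t)$ be the translation flow along the stable foliation or along the unstable foliation of $g$, let a symbolic coding of $(\phi_t)$ by a self-similar suspension flow over a primitive aperiodic substitution $\zeta$ on $\mathcal A=\{1,\dots,m\}$ be given, let $\Pi_a\subset M$, $a\in\mathcal A$, be the corresponding sets, and let $\sigma_a$ be the spectral measure of $\mathbf 1_{\Pi_a}$ with respect to $(\phi_t)$. Then there exists $\gamma>0$ such that for any $B>1$ there exist $C_B>0$ and $r_0(B)>0$ such that $$\sigma_a([\omega-r,\omega+r])\le C_B(\log(1/r))^{-\gamma}\quad\text{for all } 0<r\le r_0(B),\ a\in\mathcal A,\ |\omega|\in[B^{-1},B].$$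
   Context: $M$ is a closed oriented surface; $g$ preserves a pair of transverse (orientable) measured foliations, the stable and the unstable one, multiplying the transverse measures by $\lambda^{\pm1}$, where $\lambda>1$ is the dilatation; $\lambda$ is the absolute value of the dominant (largest in modulus) eigenvalue of $g^*$ on $H^1(M,\mathbb R)$. The translation flow along one of the foliations moves points at unit speed (with respect to the length defined by the transverse measure of the other foliation) along its leaves; it preserves the normalized area measure $\nu$ on $M$. For $f\in L^2(M,\nu)$ the spectral measure $\sigma_f$ is the finite positive Borel measure on $\mathbb R$ with $\int_{\mathbb R}e^{2\pi i\omega t}\,d\sigma_f(\omega)=\langle f\circ\phi_t,f\rangle$ for all $t\in\mathbb R$. Substitutions: a substitution is a map $\zeta:\mathcal A\to\mathcal A^+$ from the alphabet to nonempty finite words, extended by concatenation. Its substitution matrix $\mathsf S$ has $\mathsf S(i,j)$ = number of symbols $i$ in $\zeta(j)$; $\zeta$ is primitive if some power of $\mathsf S$ is strictly positive. $X_\zeta\subset\mathcal A^{\mathbb Z}$ consists of the bi-infinite sequences all of whose finite subwords occur in some $\zeta^n(a)$; $T_\zeta$ is the left shift; aperiodic means $X_\zeta$ is infinite. The self-similar suspension flow over $\zeta$ is the unit-speed vertical flow $h_t$ on $\mathfrak X_\zeta=\{(x,t):x\in X_\zeta,\ 0\le t\le s_{x_0}\}$, with $(x,s_{x_0})\sim(T_\zeta x,0)$, where $\vec s=(s_j)$ is a strictly positive Perron-Frobenius eigenvector of $\mathsf S^t$; $\widetilde\mu$ is its unique invariant probability measure, and $\mathfrak X_a=\{(x,t)\in\mathfrak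 X_\zeta:x_0=a\}$. Symbolic coding: translation flows along stable/unstable foliations of pseudo-Anosov maps are coded (by Markov partitions and Vershik automorphisms) by such flows: there are a primitive aperiodic substitution $\zeta$ whose Perron-Frobenius eigenvalue is $\lambda^k$ for some integer $k\ge1$, and a measure-preserving isomorphism $\Psi:(\mathfrak X_\zeta,\widetilde\mu)\to(M,\nu)$ (mod null sets) with $\Psi\circ h_t=\phi_t\circ\Psi$. The corresponding sets are $\Pi_a:=\Psi(\mathfrak X_a)$. *)

theory Defs
  imports
    "HOL-Analysis.Analysis"
    "HOL-Homology.Homology"
    "HOL-Probability.Probability_Measure"
    "HOL-Computational_Algebra.Polynomial_Factorial"
    "HOL-Library.Sublist"
begin

section \<open>Surfaces with a pair of transverse oriented measured foliations\<close>

text \<open>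
  Coordinates of the charts are complex numbers. The horizontal foliation has the leaves
  \<open>Im z = const\<close> and the transverse measure \<open>\<bar>d Im z\<bar>\<close>, the vertical foliation has the leaves
  \<open>Re z = const\<close> and the transverse measure \<open>\<bar>d Re z\<bar>\<close>. Charts in which both foliations and both
  transverse measures are standard differ by maps \<open>x + i y \<mapsto> (\<plusminus> x + a) + i (\<plusminus> y + b)\<close>; orientability
  of both foliations means that the atlas can be chosen with all signs positive. At a singular point
  of \<open>2 n\<close> prongs (\<open>n \<ge> 2\<close>) the pair is the pull-back of the standard one under \<open>w \<mapsto> w ^ n\<close>.
  The orientation of the surface is the one for which the charts are positively oriented.
\<close>

definition transverse_oriented_measured_foliations ::
  "'a topology \<Rightarrow> 'a set \<Rightarrow> ('a set \<times> ('a \<Rightarrow> complex)) set \<Rightarrow> bool" where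
  "transverse_oriented_measured_foliations X Sing At \<longleftrightarrow>
     finite Sing \<and> Sing \<subseteq> topspace X \<and>
     \<Union> (fst ` At) = topspace X - Sing \<and>
     (\<forall>(U, z) \<in> At. openin X U \<and> open (z ` U) \<and>
        homeomorphic_map (subtopology X U) (top_of_set (z ` U)) z) \<and>
     (\<forall>(U, z) \<in> At. \<forall>(V, w) \<in> At. \<forall>p \<in> U \<inter> V.
        \<exists>c. \<forall>\<^sub>F q in nhdsin X p. w q = z q + c) \<and>
     (\<forall>p \<in> Sing. \<exists>U \<psi> n. n \<ge> (2::nat) \<and> openin X U \<and> U \<inter> Sing = {p} \<and>
        open (\<psi> ` U) \<and> homeomorphic_map (subtopology X U) (top_of_set (\<psi> ` U)) \<psi> \<and> \<psi> p = 0 \<and>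
        (\<forall>(V, z) \<in> At. \<forall>q \<in> U \<inter> V. \<exists>c. \<forall>\<^sub>F q' in nhdsin X q. z q' = \<psi> q' ^ n + c))"

definition closed_foliated_surface ::
  "'a topology \<Rightarrow> 'a set \<Rightarrow> ('a set \<times> ('a \<Rightarrow> complex)) set \<Rightarrow> bool" where
  "closed_foliated_surface X Sing At \<longleftrightarrow>
     topspace X \<noteq> {} \<and> compact_space X \<and> connected_space X \<and> Hausdorff_space X \<and>
     transverse_oriented_measured_foliations X Sing At"

text \<open>
  \<open>g\<close> preserves both foliations, multiplying \<open>\<bar>d Re z\<bar>\<close> by \<open>lam\<close> and \<open>\<bar>d Im z\<bar>\<close> by \<open>1 / lam\<close>, so the
  horizontal foliation is the unstable one and the vertical foliation the stable one. The
  orientations of the leaves may be reversed. In the given smooth structure \<open>g\<close> is automatically a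
  diffeomorphism away from the singular points.
\<close>

definition pseudo_anosov ::
  "'a topology \<Rightarrow> 'a set \<Rightarrow> ('a set \<times> ('a \<Rightarrow> complex)) set \<Rightarrow> ('a \<Rightarrow> 'a) \<Rightarrow> real \<Rightarrow> bool" where
  "pseudo_anosov X Sing At g lam \<longleftrightarrow>
     lam > 1 \<and> homeomorphic_map X X g \<and> g ` Sing = Sing \<and>
     (\<forall>(U, z) \<in> At. \<forall>(V, w) \<in> At. \<forall>p \<in> U. g p \<in> V \<longrightarrow>
        (\<exists>e1 \<in> {1, -1}. \<exists>e2 \<in> {1, -1}. \<exists>c. \<forall>\<^sub>F q in nhdsin X p.
           w (g q) = Complex (e1 * lam * Re (z q)) (e2 * (1 / lam) * Im (z q)) + c))"

text \<open>A line of constant velocity \<open>v\<close>, in all charts and for all times, that avoids the singular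
  points; for \<open>v = 1\<close> and \<open>v = \<i>\<close> a unit-speed parametrization of a horizontal, respectively
  vertical, leaf.\<close>

definition leaf_line ::
  "('a set \<times> ('a \<Rightarrow> complex)) set \<Rightarrow> complex \<Rightarrow> (real \<Rightarrow> 'a) \<Rightarrow> bool" where
  "leaf_line At v c \<longleftrightarrow>
     range c \<subseteq> \<Union> (fst ` At) \<and>
     (\<forall>t. \<forall>(U, z) \<in> At. c t \<in> U \<longrightarrow>
        (\<forall>\<^sub>F s in nhds t. c s \<in> U \<and> z (c s) = z (c t) + of_real (s - t) * v))"

text \<open>The line through a point is unique. On the null set of the points whose leaf runs into a
  singular point the flow is set to be the identity.\<close>

definition translation_flow ::
  "('a set \<times> ('a \<Rightarrow> complex)) set \<Rightarrow> complex \<Rightarrow> real \<Rightarrow> 'a \<Rightarrow> 'a" where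
  "translation_flow At v t p =
     (if \<exists>c. leaf_line At v c \<and> c 0 = p then (SOME c. leaf_line At v c \<and> c 0 = p) t else p)"

definition normalized_area ::
  "'a topology \<Rightarrow> 'a set \<Rightarrow> ('a set \<times> ('a \<Rightarrow> complex)) set \<Rightarrow> 'a measure \<Rightarrow> bool" where
  "normalized_area X Sing At \<nu> \<longleftrightarrow>
     sets \<nu> = sets (sigma (topspace X) {U. openin X U}) \<and>
     prob_space \<nu> \<and> emeasure \<nu> Sing = 0 \<and>
     (\<exists>a::real. a > 0 \<and> (\<forall>(U, z) \<in> At. \<forall>E \<in> sets \<nu>. E \<subseteq> U \<longrightarrow>
        emeasure \<nu> E = ennreal a * emeasure lborel (z ` E)))"


section \<open>Real singular cohomology and the induced action\<close>

text \<open>A real \<open>p\<close>-cochain is a function on singular \<open>p\<close>-simplices; its values off the singular simplices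
  are irrelevant.\<close>

type_synonym 'a cochain = "((nat \<Rightarrow> real) \<Rightarrow> 'a) \<Rightarrow> real"

definition cochain_eval :: "'a cochain \<Rightarrow> 'a chain \<Rightarrow> real" where
  "cochain_eval u c = (\<Sum>f \<in> Poly_Mapping.keys c. of_int (Poly_Mapping.lookup c f) * u f)"

definition coboundary :: "nat \<Rightarrow> 'a cochain \<Rightarrow> 'a cochain" where
  "coboundary p u = (\<lambda>f. cochain_eval u (chain_boundary (Suc p) (frag_of f)))"

definition cocycle :: "nat \<Rightarrow> 'a topology \<Rightarrow> 'a cochain \<Rightarrow> bool" where
  "cocycle p X u \<longleftrightarrow> (\<forall>f. singular_simplex (Suc p) X f \<longrightarrow> coboundary p u f = 0)"

text \<open>Equality in \<open>H\<^sup>1(X, \<real>)\<close>.\<close>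

definition cohomologous1 :: "'a topology \<Rightarrow> 'a cochain \<Rightarrow> 'a cochain \<Rightarrow> bool" where
  "cohomologous1 X u v \<longleftrightarrow> (\<exists>b. \<forall>f. singular_simplex 1 X f \<longrightarrow> u f - v f = coboundary 0 b f)"

definition cochain_pullback :: "nat \<Rightarrow> ('a \<Rightarrow> 'a) \<Rightarrow> 'a cochain \<Rightarrow> 'a cochain" where
  "cochain_pullback p g u = (\<lambda>f. u (simplex_map p g f))"

text \<open>Complex eigenvalues of the real linear map \<open>g\<^sup>*\<close> on \<open>H\<^sup>1(X, \<real>)\<close>, that is, eigenvalues of its
  complexification; the eigenvector is \<open>[u] + i [v]\<close>.\<close>

definition H1_eigenvalue :: "'a topology \<Rightarrow> ('a \<Rightarrow> 'a) \<Rightarrow> complex \<Rightarrow> bool" where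
  "H1_eigenvalue X g \<mu> \<longleftrightarrow>
     (\<exists>u v. cocycle 1 X u \<and> cocycle 1 X v \<and>
        \<not> (cohomologous1 X u (\<lambda>_. 0) \<and> cohomologous1 X v (\<lambda>_. 0)) \<and>
        cohomologous1 X (cochain_pullback 1 g u) (\<lambda>f. Re \<mu> * u f - Im \<mu> * v f) \<and>
        cohomologous1 X (cochain_pullback 1 g v) (\<lambda>f. Im \<mu> * u f + Re \<mu> * v f))"

definition H1_dominant_eigenvalue :: "'a topology \<Rightarrow> ('a \<Rightarrow> 'a) \<Rightarrow> complex \<Rightarrow> bool" where
  "H1_dominant_eigenvalue X g \<mu> \<longleftrightarrow>
     H1_eigenvalue X g \<mu> \<and> (\<forall>\<mu>'. H1_eigenvalue X g \<mu>' \<and> \<mu>' \<noteq> \<mu> \<longrightarrow> cmod \<mu>' < cmod \<mu>)"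

text \<open>Being roots of a common irreducible rational polynomial means having the same minimal
  polynomial over the rationals.\<close>

definition galois_conjugate :: "complex \<Rightarrow> complex \<Rightarrow> bool" where
  "galois_conjugate \<mu> \<mu>' \<longleftrightarrow>
     (\<exists>P :: rat poly. irreducible P \<and>
        poly (map_poly of_rat P) \<mu> = 0 \<and> poly (map_poly of_rat P) \<mu>' = 0)"


section \<open>Substitutions and their self-similar suspension flows\<close>

text \<open>The alphabet is the finite type \<open>'b\<close>.\<close>

definition subst_word :: "('b \<Rightarrow> 'b list) \<Rightarrow> 'b list \<Rightarrow> 'b list" where
  "subst_word \<zeta> w = concat (map \<zeta> w)"

definition substitution :: "('b \<Rightarrow> 'b list) \<Rightarrow> bool" where
  "substitution \<zeta> \<longleftrightarrow> (\<forall>a. \<zeta> a \<noteq> [])"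

definition subst_matrix :: "('b::finite \<Rightarrow> 'b list) \<Rightarrow> real ^ 'b ^ 'b" where
  "subst_matrix \<zeta> = (\<chi> i j. real (count_list (\<zeta> j) i))"

definition primitive_subst :: "('b::finite \<Rightarrow> 'b list) \<Rightarrow> bool" where
  "primitive_subst \<zeta> \<longleftrightarrow>
     (\<exists>n \<ge> 1. \<forall>i j. (((**) (subst_matrix \<zeta>)) ^^ n) (mat 1) $ i $ j > 0)"

definition subst_shift_space :: "('b \<Rightarrow> 'b list) \<Rightarrow> (int \<Rightarrow> 'b) set" where
  "subst_shift_space \<zeta> =
     {x. \<forall>i n. \<exists>k a. sublist (map (\<lambda>j. x (i + int j)) [0..<n]) ((subst_word \<zeta> ^^ k) [a])}"

definition aperiodic_subst :: "('b \<Rightarrow> 'b list) \<Rightarrow> bool" where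
  "aperiodic_subst \<zeta> \<longleftrightarrow> infinite (subst_shift_space \<zeta>)"

text \<open>A primitive matrix has exactly one eigenvalue with a strictly positive eigenvector, the
  Perron-Frobenius eigenvalue; a matrix and its transpose have the same one.\<close>

definition perron_frobenius :: "real ^ 'b ^ 'b \<Rightarrow> real \<Rightarrow> real ^ 'b::finite \<Rightarrow> bool" where
  "perron_frobenius A \<theta> s \<longleftrightarrow> (\<forall>i. s $ i > 0) \<and> A *v s = \<theta> *s s"

text \<open>A fundamental domain of the suspension: \<open>t < s\<^bsub>x 0\<^esub>\<close> picks one representative of each class
  of the identification of \<open>(x, s\<^bsub>x 0\<^esub>)\<close> with \<open>(T x, 0)\<close>.\<close>

definition suspension_space ::
  "('b::finite \<Rightarrow> 'b list) \<Rightarrow> real ^ 'b \<Rightarrow> ((int \<Rightarrow> 'b) \<times> real) set" where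
  "suspension_space \<zeta> s = {(x, t). x \<in> subst_shift_space \<zeta> \<and> 0 \<le> t \<and> t < s $ x 0}"

definition suspension_cell ::
  "('b::finite \<Rightarrow> 'b list) \<Rightarrow> real ^ 'b \<Rightarrow> 'b \<Rightarrow> ((int \<Rightarrow> 'b) \<times> real) set" where
  "suspension_cell \<zeta> s a = {(x, t) \<in> suspension_space \<zeta> s. x 0 = a}"

text \<open>Height of the \<open>n\<close>-th return of the orbit of \<open>(x, 0)\<close> to the base, for \<open>n \<in> \<int>\<close>; one of the two
  sums is empty.\<close>

definition roof_sum :: "real ^ 'b::finite \<Rightarrow> (int \<Rightarrow> 'b) \<Rightarrow> int \<Rightarrow> real" where
  "roof_sum s x n = (\<Sum>i \<in> {0..<n}. s $ x i) - (\<Sum>i \<in> {n..<0}. s $ x i)"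

text \<open>Moving \<open>(x, u)\<close> up by \<open>t\<close> and passing to the representative \<open>(T\<^sup>n x, u')\<close> in the fundamental
  domain.\<close>

definition suspension_flow ::
  "real ^ 'b::finite \<Rightarrow> real \<Rightarrow> (int \<Rightarrow> 'b) \<times> real \<Rightarrow> (int \<Rightarrow> 'b) \<times> real" where
  "suspension_flow s t = (\<lambda>(x, u).
     let n = (THE n. roof_sum s x n \<le> u + t \<and> u + t < roof_sum s x (n + 1))
     in (\<lambda>i. x (i + n), u + t - roof_sum s x n))"

definition suspension_invariant_prob ::
  "('b::finite \<Rightarrow> 'b list) \<Rightarrow> real ^ 'b \<Rightarrow> ((int \<Rightarrow> 'b) \<times> real) measure \<Rightarrow> bool" where
  "suspension_invariant_prob \<zeta> s m \<longleftrightarrow>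
     sets m = sets (restrict_space ((\<Pi>\<^sub>M i\<in>UNIV. count_space UNIV) \<Otimes>\<^sub>M borel) (suspension_space \<zeta> s)) \<and>
     prob_space m \<and>
     (\<forall>t. suspension_flow s t \<in> measurable m m \<and> distr m m (suspension_flow s t) = m)"


section \<open>Symbolic codings and spectral measures\<close>

text \<open>\<open>\<Psi>\<close> restricts to an isomorphism from the set \<open>D\<close> of full measure onto the set \<open>\<Psi> ` D\<close> of full
  measure.\<close>

definition mod0_isomorphism :: "'c measure \<Rightarrow> 'd measure \<Rightarrow> 'c set \<Rightarrow> ('c \<Rightarrow> 'd) \<Rightarrow> bool" where
  "mod0_isomorphism m \<nu> D \<Psi> \<longleftrightarrow>
     D \<in> sets m \<and> emeasure m (space m - D) = 0 \<and>
     \<Psi> ` D \<in> sets \<nu> \<and> emeasure \<nu> (space \<nu> - \<Psi> ` D) = 0 \<and>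
     inj_on \<Psi> D \<and>
     \<Psi> \<in> measurable (restrict_space m D) (restrict_space \<nu> (\<Psi> ` D)) \<and>
     the_inv_into D \<Psi> \<in> measurable (restrict_space \<nu> (\<Psi> ` D)) (restrict_space m D) \<and>
     distr (restrict_space m D) (restrict_space \<nu> (\<Psi> ` D)) \<Psi> = restrict_space \<nu> (\<Psi> ` D)"

definition symbolic_coding ::
  "('b::finite \<Rightarrow> 'b list) \<Rightarrow> real ^ 'b \<Rightarrow> real \<Rightarrow> ((int \<Rightarrow> 'b) \<times> real) measure \<Rightarrow>
   'a measure \<Rightarrow> (real \<Rightarrow> 'a \<Rightarrow> 'a) \<Rightarrow>
   ((int \<Rightarrow> 'b) \<times> real) set \<Rightarrow> ((int \<Rightarrow> 'b) \<times> real \<Rightarrow> 'a) \<Rightarrow> bool" where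
  "symbolic_coding \<zeta> s lam m \<nu> \<phi> D \<Psi> \<longleftrightarrow>
     substitution \<zeta> \<and> primitive_subst \<zeta> \<and> aperiodic_subst \<zeta> \<and>
     (\<exists>k \<ge> (1::nat). perron_frobenius (transpose (subst_matrix \<zeta>)) (lam ^ k) s) \<and>
     suspension_invariant_prob \<zeta> s m \<and>
     mod0_isomorphism m \<nu> D \<Psi> \<and>
     (\<forall>t. AE x in m. \<Psi> (suspension_flow s t x) = \<phi> t (\<Psi> x))"

text \<open>The points of the cell outside the set \<open>D\<close> on which \<open>\<Psi>\<close> is an isomorphism are discarded.\<close>

definition coding_cell ::
  "('b::finite \<Rightarrow> 'b list) \<Rightarrow> real ^ 'b \<Rightarrow> ((int \<Rightarrow> 'b) \<times> real) set \<Rightarrow>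
   ((int \<Rightarrow> 'b) \<times> real \<Rightarrow> 'a) \<Rightarrow> 'b \<Rightarrow> 'a set" where
  "coding_cell \<zeta> s D \<Psi> a = \<Psi> ` (suspension_cell \<zeta> s a \<inter> D)"

definition spectral_measure ::
  "'a measure \<Rightarrow> (real \<Rightarrow> 'a \<Rightarrow> 'a) \<Rightarrow> ('a \<Rightarrow> complex) \<Rightarrow> real measure \<Rightarrow> bool" where
  "spectral_measure \<nu> \<phi> f \<sigma> \<longleftrightarrow>
     sets \<sigma> = sets borel \<and> finite_measure \<sigma> \<and>
     (\<forall>t. (\<integral>\<omega>. exp (2 * of_real pi * \<i> * of_real \<omega> * of_real t) \<partial>\<sigma>) =
          (\<integral>p. f (\<phi> t p) * cnj (f p) \<partial>\<nu>))"

end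

theory Submission
  imports
    Defs
    "HOL-Computational_Algebra.Fundamental_Theorem_Algebra"
    "HOL-Computational_Algebra.Field_as_Ring"
begin

text \<open>
  The spectral measure of the interval of radius \<open>r\<close> about \<open>\<omega>\<close> is bounded by the mean square of the
  twisted ergodic sums up to the time \<open>R = 1 / (6 r)\<close>. In a self-similar suspension these sums
  decompose, by cutting words into prefixes and suffixes of substituted letters, into twisted sums
  over the words \<open>\<zeta>\<^sup>n(b)\<close>. By primitivity all words \<open>\<zeta>\<^sup>j(b)\<close>, for some \<open>j\<close>, contain a letter
  \<open>c\<close> twice, with the same word \<open>u\<close> in between. So the step from the level \<open>n\<close> to the level
  \<open>n + j\<close> gains a constant factor over the trivial bound whenever \<open>\<omega> \<theta>\<^sup>n |c u|\<close> is far from the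
  integers. If \<open>\<theta>\<close> has a conjugate \<open>\<noteq> \<theta>\<close> outside the unit circle, this happens in every window
  \<open>[N, L N]\<close> with \<open>N\<close> large, hence about \<open>log log R\<close> times, and the gains multiply to a negative
  power of \<open>log R\<close>.

  The conjugate of \<open>\<theta> = \<lambda>\<^sup>k\<close> is a power of \<open>\<mu>'\<close>. It differs from \<open>\<theta>\<close> because conjugates of
  eigenvalues of \<open>g\<^sup>*\<close> are eigenvalues, so that \<open>|\<mu>'| < |\<mu>|\<close> by dominance; this needs no finite
  dimension of \<open>H\<^sup>1\<close>, since a semilinear map with \<open>\<mu> \<mapsto> \<mu>'\<close> can be applied to the values of a
  cocycle. Ergodic sums over discrete times replace the integrals over \<open>[0, R]\<close>, so no joint
  measurability of the flow is used.
\<close>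

section \<open>Lower bounds for integer polynomials and powers far from the integers\<close>

text \<open>The windows have a fixed ratio instead of a bounded length because the integer
  polynomial behind the escape argument has height of order \<open>\<Theta> ^ N\<close>: a fixed
  power of this height must be beaten by powers of a conjugate whose modulus may be barely above 1,
  and this takes a number of steps proportional to \<open>N\<close>. Hence the levels up to
  \<open>T\<close> contain only about \<open>log T\<close> gains, and \<open>T\<close> is itself of
  order \<open>log R\<close>. The gap \<open>\<delta>\<close> and the ratio \<open>L\<close> do not
  depend on \<open>B\<close>, and therefore neither does the exponent; \<open>B\<close> only decides
  at which level the gains begin. The coding only knows \<open>lam\<close>, the modulus of
  \<open>\<mu>\<close>, and nothing fixes the sign of \<open>\<mu>\<close>. As \<open>\<mu>\<close>
  turns out to be real, its even powers are powers of \<open>lam\<close>; for this reason the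
  returning words are sought in even iterates of the substitution.\<close>

definition l1 :: "int poly \<Rightarrow> real" where
  "l1 p = (\<Sum>i\<le>degree p. \<bar>of_int (coeff p i)\<bar>)"

abbreviation cpoly :: "int poly \<Rightarrow> complex poly" where
  "cpoly \<equiv> map_poly of_int"

lemma l1_eq: "degree p \<le> n \<Longrightarrow> l1 p = (\<Sum>i\<le>n. \<bar>of_int (coeff p i)\<bar>)"
  unfolding l1_def by (rule sum.mono_neutral_left) (auto simp: coeff_eq_0)

lemma coeff_le_l1: "\<bar>of_int (coeff p i)\<bar> \<le> l1 p"
proof (cases "i \<le> degree p")
  case True
  then show ?thesis unfolding l1_def by (intro member_le_sum) auto
next
  case False
  then show ?thesis by (auto simp: coeff_eq_0 l1_def intro: sum_nonneg)
qed

lemma l1_nonneg: "0 \<le> l1 p"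
  by (auto simp: l1_def intro: sum_nonneg)

lemma l1_diff: "l1 (p - q) \<le> l1 p + l1 q"
proof -
  define n where "n = max (degree p) (degree q)"
  have "l1 (p - q) = (\<Sum>i\<le>n. \<bar>of_int (coeff (p - q) i)\<bar>)"
    by (rule l1_eq) (simp add: n_def degree_diff_le_max)
  also have "\<dots> \<le> (\<Sum>i\<le>n. \<bar>of_int (coeff p i)\<bar> + \<bar>of_int (coeff q i)\<bar>)"
    by (intro sum_mono) simp
  also have "\<dots> = l1 p + l1 q"
    by (simp add: sum.distrib l1_eq[of p n] l1_eq[of q n] n_def)
  finally show ?thesis .
qed

lemma l1_smult: "l1 (smult c p) = \<bar>of_int c\<bar> * l1 p"
proof -
  have "l1 (smult c p) = (\<Sum>i\<le>degree p. \<bar>of_int (coeff (smult c p) i)\<bar>)"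
    by (rule l1_eq) (simp add: degree_smult_le)
  also have "\<dots> = \<bar>of_int c\<bar> * l1 p"
    by (simp add: l1_def sum_distrib_left abs_mult)
  finally show ?thesis .
qed

lemma l1_monom_mult: "l1 (monom 1 k * p) = l1 p"
proof (cases "p = 0")
  case False
  have d: "degree (monom 1 k * p) = k + degree p"
    using False by (simp add: degree_mult_eq degree_monom_eq)
  have "l1 (monom 1 k * p) = (\<Sum>i\<le>k + degree p. \<bar>of_int (coeff (monom 1 k * p) i)\<bar>)"
    unfolding l1_def d ..
  also have "\<dots> = (\<Sum>i\<in>{k..k + degree p}. \<bar>of_int (coeff (monom 1 k * p) i)\<bar>)"
    by (rule sum.mono_neutral_right) (auto simp: coeff_monom_mult)
  also have "\<dots> = (\<Sum>i\<in>{0..degree p}. \<bar>of_int (coeff (monom 1 k * p) (i + k))\<bar>)"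
    using sum.shift_bounds_cl_nat_ivl[of "\<lambda>i. \<bar>of_int (coeff (monom 1 k * p) i)\<bar> :: real" 0 k "degree p"]
    by (simp add: add.commute)
  also have "\<dots> = l1 p"
    by (simp add: l1_def coeff_monom_mult atMost_atLeast0)
  finally show ?thesis .
qed (simp add: l1_def)

lemma l1_sum: "l1 (\<Sum>i\<in>I. f i) \<le> (\<Sum>i\<in>I. l1 (f i))"
proof (cases "finite I")
  case True
  then show ?thesis
  proof (induction I)
    case empty
    then show ?case by (simp add: l1_def)
  next
    case (insert x F)
    have "l1 (f x + sum f F) \<le> l1 (f x) + l1 (sum f F)"
      using l1_diff[of "f x" "- sum f F"] l1_smult[of "-1" "sum f F"] by simp
    with insert show ?case by simp
  qed
qed (simp add: l1_def)

text \<open>Multiplying crosswise by the leading coefficients keeps the remainder integral, and a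
  leading coefficient is at most the height; hence the square. The factor 2 counts the two
  products.\<close>

lemma l1_reduce:
  assumes "l1 f \<le> H" "l1 g \<le> H"
  shows "l1 (smult (lead_coeff g) f - smult (lead_coeff f) (monom 1 k * g)) \<le> 2 * H^2"
proof -
  have H: "0 \<le> H" using assms(1) l1_nonneg[of f] by linarith
  have lf: "\<bar>of_int (lead_coeff f)\<bar> \<le> H" and lg: "\<bar>of_int (lead_coeff g)\<bar> \<le> H"
    using coeff_le_l1[of f "degree f"] coeff_le_l1[of g "degree g"] assms by linarith+
  have "l1 (smult (lead_coeff g) f - smult (lead_coeff f) (monom 1 k * g))
     \<le> \<bar>of_int (lead_coeff g)\<bar> * l1 f + \<bar>of_int (lead_coeff f)\<bar> * l1 g"
    using l1_diff[of "smult (lead_coeff g) f" "smult (lead_coeff f) (monom 1 k * g)"]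
    by (simp add: l1_smult l1_monom_mult)
  also have "\<dots> \<le> H * H + H * H"
    by (intro add_mono mult_mono lf lg assms H l1_nonneg)
  finally show ?thesis by (simp add: power2_eq_square)
qed

text \<open>One step of the Euclidean algorithm with integer coefficients at most squares the heights, so
  after a number of steps bounded by the degrees the loss is a fixed power of the height.\<close>

lemma max_cmod_poly_lower_bound:
  fixes Z :: real
  assumes "Z \<ge> 1"
  shows "\<exists>c>0. \<exists>E::nat. \<forall>f g H z. degree f + degree g \<le> n \<and> l1 f \<le> H \<and> l1 g \<le> H \<and> 1 \<le> H \<and>
      cmod z \<le> Z \<and> (\<forall>w. \<not> (poly (cpoly f) w = 0 \<and> poly (cpoly g) w = 0)) \<longrightarrow>
      c \<le> H ^ E * max (cmod (poly (cpoly f) z)) (cmod (poly (cpoly g) z))"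
proof (induction n)
  case 0
  show ?case
  proof (intro exI[of _ "1::real"] exI[of _ "0::nat"] conjI allI impI)
    fix f g H z
    assume a: "degree f + degree g \<le> 0 \<and> l1 f \<le> H \<and> l1 g \<le> H \<and> 1 \<le> H \<and>
      cmod z \<le> Z \<and> (\<forall>w. \<not> (poly (cpoly f) w = 0 \<and> poly (cpoly g) w = 0))"
    then obtain a b where ab: "f = [:a:]" "g = [:b:]" by (metis add_is_0 le_zero_eq degree_eq_zeroE)
    have "a \<noteq> 0 \<or> b \<noteq> 0" using a ab by auto
    then have "1 \<le> \<bar>a\<bar> \<or> 1 \<le> \<bar>b\<bar>" by linarith
    then have "1 \<le> real_of_int \<bar>a\<bar> \<or> 1 \<le> real_of_int \<bar>b\<bar>" by linarith
    then show "1 \<le> H ^ 0 * max (cmod (poly (cpoly f) z)) (cmod (poly (cpoly g) z))"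
      using ab by (auto simp: map_poly_pCons le_max_iff_disj)
  qed simp
next
  case (Suc n)
  then obtain c E where c: "c > 0" and IH: "\<And>f g H z. degree f + degree g \<le> n \<Longrightarrow> l1 f \<le> H \<Longrightarrow> l1 g \<le> H \<Longrightarrow> 1 \<le> H \<Longrightarrow>
      cmod z \<le> Z \<Longrightarrow> (\<And>w. \<not> (poly (cpoly f) w = 0 \<and> poly (cpoly g) w = 0)) \<Longrightarrow>
      c \<le> H ^ E * max (cmod (poly (cpoly f) z)) (cmod (poly (cpoly g) z))"
    by blast
  \<comment> \<open>\<open>2 ^ E\<close> comes from the height \<open>2 * H^2\<close> in the
    induction hypothesis, \<open>2 * Z ^ Suc n\<close> from the value of the remainder at
    \<open>z\<close>; the power of \<open>H\<close> left over is \<open>2 * E + 1\<close>.\<close>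
  define W where "W = 2 ^ E * 2 * Z ^ Suc n"
  have W: "W > 0" using assms by (simp add: W_def)
  define c' where "c' = min 1 (c / W)"
  have c': "c' > 0" "c' \<le> 1" "c' * W \<le> c"
  proof -
    show "c' > 0" "c' \<le> 1" using c W by (auto simp: c'_def)
    have "c' \<le> c / W" by (simp add: c'_def)
    then show "c' * W \<le> c" using W by (simp add: pos_le_divide_eq)
  qed
  have step: "c' \<le> H ^ (2 * E + 1) * max (cmod (poly (cpoly f) z)) (cmod (poly (cpoly g) z))"
    if a: "degree f + degree g \<le> Suc n" "l1 f \<le> H" "l1 g \<le> H" "1 \<le> H" "cmod z \<le> Z"
      "\<And>w. \<not> (poly (cpoly f) w = 0 \<and> poly (cpoly g) w = 0)" "degree g \<le> degree f" for f g H z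
  proof (cases "degree g = 0")
    case True
    then obtain b where b: "g = [:b:]" by (metis degree_eq_zeroE)
    have "1 \<le> max (cmod (poly (cpoly f) z)) (cmod (poly (cpoly g) z))"
    proof (cases "b = 0")
      case False
      then have "1 \<le> \<bar>b\<bar>" by linarith
      then have "1 \<le> real_of_int \<bar>b\<bar>" by linarith
      then show ?thesis using b by (auto simp: map_poly_pCons le_max_iff_disj)
    next
      case True
      \<comment> \<open>As \<open>g = 0\<close>, every zero of \<open>f\<close> would be a common
        zero; so \<open>f\<close> has none and is a nonzero integer constant.\<close>
      have "constant (poly (cpoly f))"
        using fundamental_theorem_of_algebra[of "cpoly f"] a(6) b True by auto
      then have "degree (cpoly f) = 0" by (simp add: constant_degree)
      then have "degree f = 0" by (simp add: degree_map_poly)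
      then obtain a' where a': "f = [:a':]" by (metis degree_eq_zeroE)
      then have "a' \<noteq> 0" using a(6)[of 0] b True by auto
      then have "1 \<le> \<bar>a'\<bar>" by linarith
      then have "1 \<le> real_of_int \<bar>a'\<bar>" by linarith
      then show ?thesis using a' by (auto simp: map_poly_pCons le_max_iff_disj)
    qed
    moreover have "1 \<le> H ^ (2 * E + 1)" by (rule one_le_power[OF a(4)])
    ultimately have "1 * 1 \<le> H ^ (2 * E + 1) * max (cmod (poly (cpoly f) z)) (cmod (poly (cpoly g) z))"
      by (intro mult_mono) auto
    then show ?thesis using c'(2) by linarith
  next
    case False
    define k where "k = degree f - degree g"
    define f' where "f' = smult (lead_coeff g) f - smult (lead_coeff f) (monom 1 k * g)"
    have g0: "g \<noteq> 0" and f0: "f \<noteq> 0" using False a(7) by auto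
    have df: "degree f' < degree f"
    proof -
      have "degree (monom 1 k * g) = degree f"
        using g0 a(7) by (simp add: degree_mult_eq degree_monom_eq k_def)
      moreover have "coeff f' (degree f) = 0"
        using a(7) by (simp add: f'_def coeff_monom_mult k_def)
      ultimately have "degree f' \<le> degree f" "coeff f' (degree f) = 0"
        unfolding f'_def by (auto intro!: degree_diff_le order.trans[OF degree_smult_le])
      moreover have "degree f > 0" using False a(7) by linarith
      ultimately show ?thesis
        by (metis degree_0 le_neq_implies_less leading_coeff_0_iff)
    qed
    have ev: "poly (cpoly f') w = of_int (lead_coeff g) * poly (cpoly f) w
        - of_int (lead_coeff f) * (w ^ k * poly (cpoly g) w)" for w
    proof -
      have "cpoly f' = smult (of_int (lead_coeff g)) (cpoly f) -
         smult (of_int (lead_coeff f)) (monom 1 k * cpoly g)"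
        unfolding f'_def
        by (intro poly_eqI) (simp add: coeff_map_poly coeff_monom_mult)
      then show ?thesis by (simp add: poly_monom)
    qed
    let ?F = "cmod (poly (cpoly f) z)" and ?G = "cmod (poly (cpoly g) z)"
    let ?M = "max ?F ?G"
    have "H * 1 \<le> H * H" using a(4) by (intro mult_left_mono) auto
    then have H2: "1 \<le> 2 * H^2" "H \<le> 2 * H^2"
      using a(4) unfolding power2_eq_square by linarith+
    have "c \<le> (2 * H^2) ^ E * max (cmod (poly (cpoly f') z)) ?G"
    proof (rule IH)
      show "degree f' + degree g \<le> n" using df a(1) by linarith
      show "l1 f' \<le> 2 * H^2" unfolding f'_def by (rule l1_reduce) (use a in auto)
      show "l1 g \<le> 2 * H^2" using a(3) H2 by linarith
      show "1 \<le> 2 * H^2" by (rule H2)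
      show "cmod z \<le> Z" by (rule a)
      \<comment> \<open>A common zero of \<open>f'\<close> and \<open>g\<close> is one of
        \<open>f\<close>, because the leading coefficient of \<open>g\<close> is nonzero.\<close>
      show "\<not> (poly (cpoly f') w = 0 \<and> poly (cpoly g) w = 0)" for w
        using a(6)[of w] ev[of w] g0 by auto
    qed
    also have "max (cmod (poly (cpoly f') z)) ?G \<le> 2 * H * Z ^ Suc n * ?M"
    proof -
      have lf: "\<bar>of_int (lead_coeff f)\<bar> \<le> H" and lg: "\<bar>of_int (lead_coeff g)\<bar> \<le> H"
        using coeff_le_l1[of f "degree f"] coeff_le_l1[of g "degree g"] a by linarith+
      have Z1: "1 \<le> Z ^ Suc n" by (rule one_le_power[OF assms])
      have zk: "cmod z ^ k \<le> Z ^ Suc n"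
      proof -
        have "cmod z ^ k \<le> Z ^ k" by (intro power_mono a) auto
        also have "\<dots> \<le> Z ^ Suc n"
          using assms a(1) by (intro power_increasing) (auto simp: k_def)
        finally show ?thesis .
      qed
      have "cmod (poly (cpoly f') z) \<le> \<bar>of_int (lead_coeff g)\<bar> * ?F
          + \<bar>of_int (lead_coeff f)\<bar> * (cmod z ^ k * ?G)"
        unfolding ev by (rule order.trans[OF norm_triangle_ineq4]) (simp add: norm_mult norm_power)
      also have "\<dots> \<le> H * (Z ^ Suc n * ?M) + H * (Z ^ Suc n * ?M)"
      proof (intro add_mono mult_mono lf lg zk)
        show "?F \<le> Z ^ Suc n * ?M"
          using mult_mono[OF Z1 max.cobounded1[of ?F ?G]] assms by simp
      qed (use a(4) assms in auto)
      also have "\<dots> = 2 * H * Z ^ Suc n * ?M" by simp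
      finally have 1: "cmod (poly (cpoly f') z) \<le> 2 * H * Z ^ Suc n * ?M" .
      have "1 * ?G \<le> (2 * H * Z ^ Suc n) * ?M"
        using Z1 a(4) mult_mono[of 1 "2 * H" 1 "Z ^ Suc n"] by (intro mult_mono) auto
      with 1 show ?thesis by simp
    qed
    finally have "c \<le> (2 * H^2) ^ E * (2 * H * Z ^ Suc n * ?M)"
      using a(4) by (simp add: mult_left_mono)
    also have "\<dots> = W * (H ^ (2 * E + 1) * ?M)"
      by (simp add: W_def power_mult_distrib power_mult power_add algebra_simps flip: power_mult)
    finally have "c' * W \<le> (H ^ (2 * E + 1) * ?M) * W"
      using c'(3) unfolding mult.commute[of W] by (rule order.trans[rotated])
    then show ?thesis using W by (rule mult_right_le_imp_le)
  qed
  show ?case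
  proof (intro exI[of _ c'] exI[of _ "2 * E + 1"] conjI allI impI)
    fix f g H z
    assume a: "degree f + degree g \<le> Suc n \<and> l1 f \<le> H \<and> l1 g \<le> H \<and> 1 \<le> H \<and>
      cmod z \<le> Z \<and> (\<forall>w. \<not> (poly (cpoly f) w = 0 \<and> poly (cpoly g) w = 0))"
    show "c' \<le> H ^ (2 * E + 1) * max (cmod (poly (cpoly f) z)) (cmod (poly (cpoly g) z))"
    proof (cases "degree g \<le> degree f")
      case True
      then show ?thesis using step[of f g H z] a by blast
    next
      case False
      have "c' \<le> H ^ (2 * E + 1) * max (cmod (poly (cpoly g) z)) (cmod (poly (cpoly f) z))"
        by (rule step) (use a False in auto)
      then show ?thesis by (simp only: max.commute)
    qed
  qed (use c' in auto)
qed


section \<open>Rational polynomials, minimal polynomials and Horner quotients\<close>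

abbreviation rpoly :: "rat poly \<Rightarrow> complex poly" where
  "rpoly \<equiv> map_poly of_rat"

lemma rpoly_add: "rpoly (p + q) = rpoly p + rpoly q"
  by (intro poly_eqI) (simp add: coeff_map_poly of_rat_add)

lemma rpoly_mult: "rpoly (p * q) = rpoly p * rpoly q"
  by (intro poly_eqI) (simp add: coeff_map_poly coeff_mult of_rat_sum of_rat_mult)

lemma rpoly_smult: "rpoly (smult c p) = smult (of_rat c) (rpoly p)"
  by (intro poly_eqI) (simp add: coeff_map_poly of_rat_mult)

lemma rpoly_of_int: "rpoly (map_poly of_int p) = cpoly p"
  by (intro poly_eqI) (simp add: coeff_map_poly)

lemma minimal_polynomial:
  assumes "R \<noteq> 0" "poly (rpoly R) z = 0"
  shows "\<exists>m. irreducible m \<and> poly (rpoly m) z = 0 \<and> (\<forall>p. poly (rpoly p) z = 0 \<longrightarrow> m dvd p)"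
proof -
  define m where "m = arg_min degree (\<lambda>p. p \<noteq> 0 \<and> poly (rpoly p) z = 0)"
  have m: "m \<noteq> 0" "poly (rpoly m) z = 0"
    and mmin: "\<And>p. p \<noteq> 0 \<Longrightarrow> poly (rpoly p) z = 0 \<Longrightarrow> degree m \<le> degree p"
    using arg_min_nat_lemma[of "\<lambda>p. p \<noteq> 0 \<and> poly (rpoly p) z = 0" R degree] assms
    unfolding m_def by blast+
  have dvd: "m dvd p" if "poly (rpoly p) z = 0" for p
  proof (rule ccontr)
    assume "\<not> m dvd p"
    then have n0: "p mod m \<noteq> 0" by (simp add: dvd_eq_mod_eq_0)
    have "rpoly p = rpoly (p div m) * rpoly m + rpoly (p mod m)"
      by (metis div_mult_mod_eq rpoly_add rpoly_mult)
    then have "poly (rpoly (p mod m)) z = 0" using that m(2) by simp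
    from mmin[OF n0 this] show False using degree_mod_less[OF m(1), of p] n0 by simp
  qed
  have unit: "b dvd 1" if "m = a * b" "poly (rpoly a) z = 0" for a b
  proof -
    have ab: "a \<noteq> 0" "b \<noteq> 0" using that m(1) by auto
    then have "degree b = 0" using mmin[of a] that by (simp add: degree_mult_eq)
    then show ?thesis using ab by (simp add: is_unit_iff_degree)
  qed
  have "irreducible m"
  proof (rule irreducibleI)
    show "\<not> m dvd 1"
    proof
      assume "m dvd 1"
      then obtain c where "m = [:c:]" "c \<noteq> 0" using m(1) is_unit_polyE by (metis pCons_0_0)
      then show False using m(2) by (simp add: map_poly_pCons)
    qed
    fix a b assume ab: "m = a * b"
    then have "poly (rpoly a) z = 0 \<or> poly (rpoly b) z = 0" using m(2) by (simp add: rpoly_mult)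
    then show "a dvd 1 \<or> b dvd 1" using unit[of a b] unit[of b a] ab by (auto simp: mult.commute)
  qed (rule m)
  with m(2) dvd show ?thesis by blast
qed

text \<open>\<open>P\<close> is an irreducible multiple of the minimal polynomial of
  \<open>z\<close>, so the two are associated.\<close>

lemma irreducible_dvd_of_common_root:
  assumes P: "irreducible P" "poly (rpoly P) z = 0" and h: "poly (rpoly h) z = 0"
  shows "P dvd h"
proof -
  have "P \<noteq> 0" using P(1) by auto
  then obtain m where m: "irreducible m" "\<And>p. poly (rpoly p) z = 0 \<Longrightarrow> m dvd p"
    using minimal_polynomial P(2) by blast
  then have "P dvd m" using irreducibleD'[OF P(1) m(2)[OF P(2)]] irreducible_not_unit[OF m(1)] by blast
  then show ?thesis using m(2)[OF h] by (rule dvd_trans)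
qed

lemma rat_poly_clear_denominators:
  fixes P :: "rat poly"
  shows "\<exists>c Q. c \<noteq> 0 \<and> smult (of_int c) P = map_poly of_int Q"
proof (induction P)
  case 0
  show ?case by (intro exI[of _ "1::int"] exI[of _ "0::int poly"]) simp
next
  case (pCons a P)
  then obtain c Q where cQ: "c \<noteq> 0" "smult (of_int c) P = map_poly of_int Q" by blast
  obtain x y where a: "a = of_int x / of_int y" "y \<noteq> 0"
    by (metis Fract_of_int_quotient Rat_cases less_irrefl)
  have "smult (of_int (c * y)) (pCons a P) = map_poly of_int (pCons (c * x) (smult y Q))"
  proof (rule poly_eqI)
    fix n
    have "of_int c * coeff P i = of_int (coeff Q i)" for i
      using arg_cong[OF cQ(2), of "\<lambda>p. coeff p i"] by (simp add: coeff_map_poly)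
    then show "coeff (smult (of_int (c * y)) (pCons a P)) n =
        coeff (map_poly of_int (pCons (c * x) (smult y Q))) n"
      using a by (auto simp: coeff_map_poly coeff_pCons split: nat.splits)
  qed
  with cQ(1) a(2) show ?case by (intro exI[of _ "c * y"]) auto
qed

text \<open>If \<open>Q z = 0\<close>, the operator \<open>Q(E) / (E - z)\<close>, with \<open>E\<close> the shift of sequences, has the
  coefficients \<open>b (Suc i)\<close> below.\<close>

lemma shift_quotient_step:
  fixes Q :: "int poly" and f :: "nat \<Rightarrow> complex" and z :: complex
  defines "b \<equiv> \<lambda>i. poly (cpoly (poly_shift i Q)) z"
  assumes "poly (cpoly Q) z = 0"
  shows "(\<Sum>i<degree Q. b (Suc i) * f (Suc n + i)) - z * (\<Sum>i<degree Q. b (Suc i) * f (n + i))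
     = (\<Sum>i\<le>degree Q. of_int (coeff Q i) * f (n + i))"
proof -
  let ?d = "degree Q"
  \<comment> \<open>Horner's scheme: \<open>b i\<close> is the value at \<open>z\<close> of
    \<open>Q\<close> without its first \<open>i\<close> coefficients, divided by the
    \<open>i\<close>-th power of the variable. It ends in \<open>b 0 = 0\<close>, which expresses
    that \<open>z\<close> is a root of \<open>Q\<close>.\<close>
  have rec: "b i = of_int (coeff Q i) + z * b (Suc i)" for i
  proof -
    have "poly_shift i Q = pCons (coeff Q i) (poly_shift (Suc i) Q)"
      by (intro poly_eqI) (simp add: coeff_poly_shift coeff_pCons split: nat.splits)
    then show ?thesis by (simp add: b_def map_poly_pCons)
  qed
  have b0: "b 0 = 0" using assms(2) by (simp add: b_def)
  have bd: "b (Suc ?d) = 0"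
  proof -
    have "poly_shift (Suc ?d) Q = 0" by (intro poly_eqI) (simp add: coeff_poly_shift coeff_eq_0)
    then show ?thesis by (simp add: b_def)
  qed
  have "(\<Sum>i\<le>?d. b i * f (n + i)) = (\<Sum>i<?d. b (Suc i) * f (Suc n + i))"
    by (subst lessThan_Suc_atMost[symmetric], subst sum.lessThan_Suc_shift) (simp add: b0)
  moreover have "(\<Sum>i\<le>?d. z * b (Suc i) * f (n + i)) = z * (\<Sum>i<?d. b (Suc i) * f (n + i))"
    by (simp add: lessThan_Suc_atMost[symmetric] bd sum_distrib_left mult.assoc)
  ultimately have "(\<Sum>i<?d. b (Suc i) * f (Suc n + i)) - z * (\<Sum>i<?d. b (Suc i) * f (n + i))
     = (\<Sum>i\<le>?d. b i * f (n + i) - z * b (Suc i) * f (n + i))"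
    by (simp add: sum_subtractf)
  also have "\<dots> = (\<Sum>i\<le>?d. of_int (coeff Q i) * f (n + i))"
  proof (intro sum.cong refl)
    fix i
    show "b i * f (n + i) - z * b (Suc i) * f (n + i) = of_int (coeff Q i) * f (n + i)"
      by (subst (1) rec) (simp add: algebra_simps)
  qed
  finally show ?thesis .
qed

text \<open>\<open>\<delta>\<close> and \<open>L\<close> are chosen before \<open>B\<close>: they
  determine the final exponent, whereas \<open>n1\<close> only enters constants.\<close>

definition escapes_integers :: "real \<Rightarrow> bool" where
  "escapes_integers \<Theta> \<longleftrightarrow> (\<exists>\<delta>>0. \<exists>L::nat. \<forall>B>1. \<exists>n1\<ge>1. \<forall>\<xi> N0.
     1 / B \<le> \<bar>\<xi>\<bar> \<and> \<bar>\<xi>\<bar> \<le> B \<and> n1 \<le> N0 \<longrightarrow>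
     (\<exists>n. N0 \<le> n \<and> n \<le> L * N0 \<and> \<delta> \<le> \<bar>\<xi> * \<Theta> ^ n - of_int (round (\<xi> * \<Theta> ^ n))\<bar>))"

text \<open>As long as all \<open>\<xi> \<Theta>^n\<close> are close to integers \<open>K n\<close>, the \<open>K n\<close> satisfy the recurrence of the
  minimal polynomial of \<open>\<Theta>\<close>. The component of this solution along the conjugate \<open>z\<close> grows like
  \<open>\<bar>z\<bar>^n\<close> and stays bounded, so it is tiny at the start; but it is the value at \<open>z\<close> of a nonzero
  integer polynomial of controlled height.\<close>

lemma escapes_integers_if_conjugate_outside_unit_disc:
  fixes \<Theta> :: real and z :: complex and P :: "rat poly"
  assumes P: "irreducible P" "poly (rpoly P) (of_real \<Theta>) = 0" "poly (rpoly P) z = 0"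
    and \<Theta>: "\<Theta> > 1" and z: "cmod z > 1" "z \<noteq> of_real \<Theta>"
  shows "escapes_integers \<Theta>"
proof -
  obtain q0 Q where q0: "q0 \<noteq> 0" and Q: "smult (of_int q0) P = map_poly of_int Q"
    using rat_poly_clear_denominators by blast
  have P0: "P \<noteq> 0" using P(1) by auto
  have cQ: "cpoly Q = smult (of_int q0) (rpoly P)"
    using arg_cong[OF Q, of rpoly] by (simp add: rpoly_of_int rpoly_smult)
  have Qz: "poly (cpoly Q) z = 0" and Q\<Theta>: "poly (cpoly Q) (of_real \<Theta>) = 0"
    using P cQ by simp_all
  define d where "d = degree Q"
  have "degree (map_poly of_int Q :: rat poly) = degree Q" by (simp add: degree_map_poly)
  then have dP: "d = degree P" using q0 by (simp add: d_def flip: Q)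
  have Q0: "Q \<noteq> 0" using cQ P0 q0 by (metis Q map_poly_0 of_int_eq_0_iff smult_eq_0_iff)
  have d0: "d \<ge> 1"
  proof (rule ccontr)
    assume "\<not> d \<ge> 1"
    then have "degree Q = 0" by (simp add: d_def)
    then obtain a where "Q = [:a:]" by (metis degree_eq_zeroE)
    then show False using Qz Q0 by (simp add: map_poly_pCons)
  qed
  define b where "b = (\<lambda>i. poly (cpoly (poly_shift i Q)) z)"
  define Y where "Y = (\<lambda>(f::nat \<Rightarrow> complex) n. \<Sum>i<d. b (Suc i) * f (n + i))"
  have Ystep: "Y f (Suc n) - z * Y f n = (\<Sum>i\<le>d. of_int (coeff Q i) * f (n + i))" for f n
    using shift_quotient_step[OF Qz, of f n] by (simp add: Y_def b_def d_def)
  define M where "M = (\<Sum>i<d. cmod (b (Suc i)))"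
  have M0: "M \<ge> 0" by (auto simp: M_def intro: sum_nonneg)
  \<comment> \<open>Errors below \<open>\<delta>\<close> leave a defect less than
    \<open>\<delta> * l1 Q < 1\<close> in the recurrence for the integers \<open>K n\<close>, so the
    defect is 0.\<close>
  define \<delta> where "\<delta> = 1 / (2 * (l1 Q + 1))"
  have \<delta>: "\<delta> > 0" "\<delta> \<le> 1" "\<delta> * l1 Q < 1"
    using l1_nonneg[of Q] by (auto simp: \<delta>_def field_simps)
  define Z where "Z = cmod z"
  have Z1: "Z \<ge> 1" using z(1) by (simp add: Z_def)
  obtain c E where c: "c > 0" and cE: "\<And>f g H w. degree f + degree g \<le> d + d \<Longrightarrow> l1 f \<le> H \<Longrightarrow> l1 g \<le> H \<Longrightarrow> 1 \<le> H \<Longrightarrow>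
      cmod w \<le> Z \<Longrightarrow> (\<And>w. \<not> (poly (cpoly f) w = 0 \<and> poly (cpoly g) w = 0)) \<Longrightarrow>
      c \<le> H ^ E * max (cmod (poly (cpoly f) w)) (cmod (poly (cpoly g) w))"
    using max_cmod_poly_lower_bound[OF Z1, of "d + d"] by blast
  \<comment> \<open>In \<open>p * N0\<close> steps the growth by \<open>Z\<close> outweighs
    \<open>(\<Theta> ^ N0) ^ E\<close> and leaves \<open>2 ^ N0\<close> to absorb the constants. The
    ratio \<open>p + 2\<close> has room for these steps and for the \<open>d \<le> N0\<close>
    further terms of the recurrence.\<close>
  obtain p where p: "2 * \<Theta> ^ E < Z ^ p" using real_arch_pow[of Z "2 * \<Theta> ^ E"] z(1) by (auto simp: Z_def)
  define L where "L = p + 2"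
  show ?thesis unfolding escapes_integers_def
  proof (rule exI[of _ \<delta>], intro conjI, rule \<delta>(1), rule exI[of _ L], intro allI impI)
    fix B :: real assume B: "B > 1"
    define R where "R = M * (2 * real d * (l1 Q + 1) * B * \<Theta> ^ d) ^ E"
    obtain n2 where n2: "R / c < 2 ^ n2" using real_arch_pow[of 2 "R / c"] by auto
    obtain n3 where n3: "B < \<Theta> ^ n3" using real_arch_pow[of \<Theta> B] \<Theta> by auto
    \<comment> \<open>\<open>n2\<close> gives the final contradiction \<open>R < c * 2 ^ N0\<close>,
      \<open>n3\<close> makes \<open>\<bar>\<xi>\<bar> * \<Theta> ^ N0 > 1\<close> and hence
      \<open>K N0 \<noteq> 0\<close>, and \<open>d\<close> makes the window long enough.\<close>
    define n1 where "n1 = Max {n2, n3, d, 1}"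
    have n1: "n2 \<le> n1" "n3 \<le> n1" "d \<le> n1" "1 \<le> n1" by (auto simp: n1_def)
    show "\<exists>n1\<ge>1. \<forall>\<xi> N0. 1 / B \<le> \<bar>\<xi>\<bar> \<and> \<bar>\<xi>\<bar> \<le> B \<and> n1 \<le> N0 \<longrightarrow>
     (\<exists>n. N0 \<le> n \<and> n \<le> L * N0 \<and> \<delta> \<le> \<bar>\<xi> * \<Theta> ^ n - of_int (round (\<xi> * \<Theta> ^ n))\<bar>)"
    proof (rule exI[of _ n1], intro conjI allI impI, rule n1(4), rule ccontr)
      fix \<xi> :: real and N0 :: nat
      assume a: "1 / B \<le> \<bar>\<xi>\<bar> \<and> \<bar>\<xi>\<bar> \<le> B \<and> n1 \<le> N0"
      define x where "x = (\<lambda>n. \<xi> * \<Theta> ^ n)"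
      define K where "K = (\<lambda>n. round (x n))"
      define e where "e = (\<lambda>n. x n - of_int (K n))"
      assume "\<not> (\<exists>n. N0 \<le> n \<and> n \<le> L * N0 \<and> \<delta> \<le> \<bar>\<xi> * \<Theta> ^ n - of_int (round (\<xi> * \<Theta> ^ n))\<bar>)"
      then have small: "\<bar>e n\<bar> < \<delta>" if "N0 \<le> n" "n \<le> L * N0" for n
        using that unfolding e_def K_def x_def by (meson not_le)
      have Q\<Theta>': "(\<Sum>i\<le>d. of_int (coeff Q i) * \<Theta> ^ i) = 0"
      proof -
        have "of_real (\<Sum>i\<le>d. of_int (coeff Q i) * \<Theta> ^ i) = poly (cpoly Q) (of_real \<Theta>)"
          by (simp add: poly_altdef degree_map_poly coeff_map_poly d_def)
        then show ?thesis using Q\<Theta> by (metis of_real_eq_0_iff)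
      qed
      have rx: "(\<Sum>i\<le>d. of_int (coeff Q i) * x (n + i)) = 0" for n
      proof -
        have "(\<Sum>i\<le>d. of_int (coeff Q i) * x (n + i)) = \<xi> * \<Theta> ^ n * (\<Sum>i\<le>d. of_int (coeff Q i) * \<Theta> ^ i)"
          by (simp add: x_def power_add sum_distrib_left algebra_simps)
        then show ?thesis using Q\<Theta>' by simp
      qed
      have rK: "(\<Sum>i\<le>d. coeff Q i * K (n + i)) = 0" if n: "N0 \<le> n" "n + d \<le> L * N0" for n
      proof -
        have "real_of_int (\<Sum>i\<le>d. coeff Q i * K (n + i)) = - (\<Sum>i\<le>d. of_int (coeff Q i) * e (n + i))"
          using rx[of n] by (simp add: e_def algebra_simps sum_subtractf)
        then have "\<bar>real_of_int (\<Sum>i\<le>d. coeff Q i * K (n + i))\<bar> \<le> (\<Sum>i\<le>d. \<bar>of_int (coeff Q i)\<bar> * \<bar>e (n + i)\<bar>)"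
          using sum_abs[of "\<lambda>i. of_int (coeff Q i) * e (n + i)" "{..d}"] by (simp add: abs_mult)
        also have "\<dots> \<le> (\<Sum>i\<le>d. \<bar>of_int (coeff Q i)\<bar> * \<delta>)"
          using n by (intro sum_mono mult_left_mono less_imp_le[OF small]) auto
        also have "\<dots> = \<delta> * l1 Q" by (simp add: l1_def d_def sum_distrib_left mult.commute)
        also have "\<dots> < 1" by (rule \<delta>)
        finally show ?thesis by linarith
      qed
      let ?k = "\<lambda>n. of_int (K n) :: complex"
      have yK: "Y ?k (N0 + t) = z ^ t * Y ?k N0" if "N0 + t + d \<le> L * N0 + 1" for t
        using that
      proof (induction t)
        case (Suc t)
        have "Y ?k (Suc (N0 + t)) - z * Y ?k (N0 + t) = of_int (\<Sum>i\<le>d. coeff Q i * K ((N0 + t) + i))"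
          by (simp add: Ystep)
        also have "\<dots> = 0" by (subst rK) (use Suc.prems in auto)
        finally show ?case using Suc by simp
      qed simp
      \<comment> \<open>On the exact geometric sequence the shift multiplies \<open>Y\<close> by
        \<open>\<Theta>\<close>, while the recurrence makes it multiply by
        \<open>z \<noteq> \<Theta>\<close>. So \<open>Y\<close> sees only the rounding errors and
        stays bounded along \<open>K\<close>.\<close>
      have Yx: "Y (\<lambda>n. of_real (x n)) n = 0" for n
      proof -
        have s: "Y (\<lambda>n. of_real (x n)) (Suc n) = of_real \<Theta> * Y (\<lambda>n. of_real (x n)) n"
          by (simp add: Y_def x_def sum_distrib_left algebra_simps)
        have "Y (\<lambda>n. of_real (x n)) (Suc n) - z * Y (\<lambda>n. of_real (x n)) n =
            of_real (\<Sum>i\<le>d. of_int (coeff Q i) * x (n + i))"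
          unfolding Ystep by simp
        also have "\<dots> = 0" unfolding rx by simp
        finally have "(of_real \<Theta> - z) * Y (\<lambda>n. of_real (x n)) n = 0"
          using s by (simp add: algebra_simps)
        then show ?thesis using z(2) by auto
      qed
      have yKb: "cmod (Y ?k n) \<le> M" if n: "N0 \<le> n" "n + d \<le> L * N0 + 1" for n
      proof -
        have "Y ?k n = Y (\<lambda>n. of_real (x n)) n - Y (\<lambda>n. of_real (e n)) n"
          by (simp add: Y_def e_def algebra_simps sum_subtractf)
        then have "cmod (Y ?k n) = cmod (Y (\<lambda>n. of_real (e n)) n)" using Yx by simp
        also have "\<dots> \<le> (\<Sum>i<d. cmod (b (Suc i) * of_real (e (n + i))))"
          unfolding Y_def by (rule norm_sum)
        also have "\<dots> \<le> (\<Sum>i<d. cmod (b (Suc i)) * 1)"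
        proof (intro sum_mono)
          fix i assume "i \<in> {..<d}"
          then have "\<bar>e (n + i)\<bar> \<le> 1" using small[of "n + i"] n \<delta>(2) by force
          then show "cmod (b (Suc i) * of_real (e (n + i))) \<le> cmod (b (Suc i)) * 1"
            unfolding norm_mult by (intro mult_left_mono) auto
        qed
        finally show ?thesis by (simp add: M_def)
      qed
      \<comment> \<open>\<open>Y\<close> at the start of the window, with \<open>z\<close> turned
        into an indeterminate. The coefficient in degree \<open>d - 1\<close> is
        \<open>K N0 * lead_coeff Q\<close>, since the summands with \<open>i > 0\<close> have
        smaller degree.\<close>
      define h where "h = (\<Sum>i<d. smult (K (N0 + i)) (poly_shift (Suc i) Q))"
      have hz: "poly (cpoly h) w = (\<Sum>i<d. of_int (K (N0 + i)) * poly (cpoly (poly_shift (Suc i) Q)) w)" for w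
      proof -
        have "cpoly h = (\<Sum>i<d. smult (of_int (K (N0 + i))) (cpoly (poly_shift (Suc i) Q)))"
          by (intro poly_eqI) (simp add: h_def coeff_map_poly coeff_sum)
        then show ?thesis by (simp add: poly_sum)
      qed
      have hY: "poly (cpoly h) z = Y ?k N0" by (simp add: hz Y_def b_def mult.commute)
      have K0: "K N0 \<noteq> 0"
      proof
        assume "K N0 = 0"
        then have "\<bar>x N0\<bar> \<le> 1 / 2" using of_int_round_abs_le[of "x N0"] by (simp add: K_def)
        moreover have "\<Theta> ^ n3 \<le> \<Theta> ^ N0" using \<Theta> n1 a by (intro power_increasing) auto
        then have "1 / B * B < \<bar>\<xi>\<bar> * \<Theta> ^ N0"
          using a n3 B by (intro mult_le_less_imp_less) auto
        ultimately show False using B \<Theta> by (simp add: x_def abs_mult)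
      qed
      have dh: "degree h < d"
      proof -
        have "coeff h i = 0" if "i \<ge> d" for i
          using that by (auto simp: h_def coeff_sum coeff_poly_shift coeff_eq_0 d_def intro!: sum.neutral)
        then have "degree h \<le> d - 1" using d0 by (intro degree_le) auto
        then show ?thesis using d0 by linarith
      qed
      have h0: "h \<noteq> 0"
      proof
        assume h: "h = 0"
        have "coeff h (d - 1) = (\<Sum>i<d. K (N0 + i) * coeff Q (d + i))"
          using d0 by (simp add: h_def coeff_sum coeff_poly_shift add.commute)
        also have "\<dots> = (\<Sum>i\<in>{0}. K (N0 + i) * coeff Q (d + i))"
          using d0 by (intro sum.mono_neutral_right) (auto simp: coeff_eq_0 d_def)
        also have "\<dots> = K N0 * lead_coeff Q" by (simp add: d_def)
        finally show False using h K0 Q0 by simp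
      qed
      \<comment> \<open>A common zero makes the irreducible \<open>P\<close> divide
        \<open>h \<noteq> 0\<close>, whose degree is less than that of \<open>P\<close>.\<close>
      have nocommon: "\<not> (poly (cpoly Q) w = 0 \<and> poly (cpoly h) w = 0)" for w
      proof
        assume w: "poly (cpoly Q) w = 0 \<and> poly (cpoly h) w = 0"
        have "poly (rpoly P) w = 0" using w cQ q0 by simp
        then have "P dvd map_poly of_int h"
          using irreducible_dvd_of_common_root[OF P(1)] w by (simp add: rpoly_of_int)
        moreover have "(map_poly of_int h :: rat poly) \<noteq> 0"
          using h0 by (metis degree_0 leading_coeff_0_iff coeff_map_poly of_int_0 of_int_eq_0_iff coeff_0)
        ultimately have "degree P \<le> degree (map_poly of_int h :: rat poly)" by (rule dvd_imp_degree_le)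
        then show False using dh dP by (simp add: degree_map_poly)
      qed
      define H where "H = 2 * real d * (l1 Q + 1) * B * \<Theta> ^ d * \<Theta> ^ N0"
      have T1: "1 \<le> \<Theta> ^ n" for n using \<Theta> by (simp add: one_le_power)
      have BT: "1 \<le> B * \<Theta> ^ d * \<Theta> ^ N0"
        using B T1 by (metis less_eq_real_def mult_ge1_I)
      have H1: "2 * (l1 Q + 1) \<le> H"
      proof -
        have "1 * (2 * (l1 Q + 1)) \<le> real d * (2 * (l1 Q + 1))"
          using d0 l1_nonneg[of Q] by (intro mult_right_mono) auto
        also have "\<dots> * 1 \<le> real d * (2 * (l1 Q + 1)) * (B * \<Theta> ^ d * \<Theta> ^ N0)"
          using BT l1_nonneg[of Q] by (intro mult_left_mono) auto
        finally show ?thesis by (simp add: H_def algebra_simps)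
      qed
      have lh: "l1 h \<le> H"
      proof -
        have ls: "l1 (poly_shift i Q) \<le> l1 Q" for i
        proof -
          have "l1 (poly_shift i Q) = (\<Sum>j\<le>d. \<bar>of_int (coeff Q (j + i))\<bar>)"
          proof (subst l1_eq)
            show "degree (poly_shift i Q) \<le> d"
              by (intro degree_le) (auto simp: coeff_poly_shift d_def coeff_eq_0)
          qed (simp add: coeff_poly_shift)
          also have "\<dots> = (\<Sum>j\<in>{0+i..d+i}. \<bar>of_int (coeff Q j)\<bar>)"
            by (subst sum.shift_bounds_cl_nat_ivl) (simp add: atMost_atLeast0)
          also have "\<dots> \<le> (\<Sum>j\<le>d+i. \<bar>of_int (coeff Q j)\<bar>)"
            by (intro sum_mono2) auto
          also have "\<dots> = l1 Q" by (rule l1_eq[symmetric]) (simp add: d_def)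
          finally show ?thesis .
        qed
        have lK: "\<bar>of_int (K (N0 + i))\<bar> \<le> 2 * (B * \<Theta> ^ d * \<Theta> ^ N0)" if "i < d" for i
        proof -
          have "\<bar>of_int (K (N0 + i))\<bar> \<le> \<bar>x (N0 + i)\<bar> + 1"
            using of_int_round_abs_le[of "x (N0 + i)"] unfolding K_def by linarith
          moreover have "\<bar>x (N0 + i)\<bar> \<le> B * \<Theta> ^ d * \<Theta> ^ N0"
          proof -
            have "\<bar>x (N0 + i)\<bar> = \<bar>\<xi>\<bar> * (\<Theta> ^ i * \<Theta> ^ N0)" using \<Theta> by (simp add: x_def abs_mult power_add mult.commute)
            also have "\<dots> \<le> B * (\<Theta> ^ d * \<Theta> ^ N0)"
              using a B \<Theta> that by (intro mult_mono power_increasing) auto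
            finally show ?thesis by simp
          qed
          ultimately show ?thesis using BT by linarith
        qed
        have "l1 h \<le> (\<Sum>i<d. l1 (smult (K (N0 + i)) (poly_shift (Suc i) Q)))"
          unfolding h_def by (rule l1_sum)
        also have "\<dots> \<le> (\<Sum>i<d. 2 * (B * \<Theta> ^ d * \<Theta> ^ N0) * (l1 Q + 1))"
        proof (intro sum_mono)
          fix i assume "i \<in> {..<d}"
          then have "\<bar>of_int (K (N0 + i))\<bar> * l1 (poly_shift (Suc i) Q) \<le> 2 * (B * \<Theta> ^ d * \<Theta> ^ N0) * (l1 Q + 1)"
            using lK[of i] ls[of "Suc i"] l1_nonneg[of Q] BT l1_nonneg[of "poly_shift (Suc i) Q"]
            by (intro mult_mono) auto
          then show "l1 (smult (K (N0 + i)) (poly_shift (Suc i) Q)) \<le> 2 * (B * \<Theta> ^ d * \<Theta> ^ N0) * (l1 Q + 1)"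
            by (simp add: l1_smult)
        qed
        also have "\<dots> = H" by (simp add: H_def algebra_simps)
        finally show ?thesis .
      qed
      have HQ: "l1 Q \<le> H" using H1 l1_nonneg[of Q] by argo
      have HQ1: "1 \<le> H" using H1 l1_nonneg[of Q] by argo
      have "c \<le> H ^ E * max (cmod (poly (cpoly Q) z)) (cmod (poly (cpoly h) z))"
      proof (rule cE)
        show "degree Q + degree h \<le> d + d" using dh by (simp add: d_def)
        show "l1 Q \<le> H" by (rule HQ)
        show "1 \<le> H" by (rule HQ1)
        show "cmod z \<le> Z" by (simp add: Z_def)
      qed (rule lh nocommon)+
      then have c1: "c \<le> H ^ E * cmod (Y ?k N0)" using Qz hY by simp
      define t where "t = p * N0"
      have tb: "N0 + t + d \<le> L * N0" using n1 a by (simp add: t_def L_def algebra_simps)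
      have "Z ^ t * cmod (Y ?k N0) = cmod (Y ?k (N0 + t))"
        using yK[of t] tb by (simp add: Z_def norm_mult norm_power)
      also have "\<dots> \<le> M" using yKb[of "N0 + t"] tb by simp
      finally have zt: "Z ^ t * cmod (Y ?k N0) \<le> M" .
      have Hpos: "0 < H" using HQ1 by argo
      have "(2 * \<Theta> ^ E) ^ N0 \<le> Z ^ t"
        unfolding t_def power_mult using p \<Theta> by (intro power_mono) auto
      then have "c * (2 * \<Theta> ^ E) ^ N0 \<le> c * Z ^ t" using c by simp
      also have "\<dots> \<le> H ^ E * cmod (Y ?k N0) * Z ^ t"
        using c1 z(1) by (intro mult_right_mono) (auto simp: Z_def)
      also have "\<dots> \<le> H ^ E * M"
        unfolding mult.assoc mult.commute[of "cmod (Y ?k N0)" "Z ^ t"]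
        by (intro mult_left_mono zt) (use Hpos in simp)
      also have "\<dots> = R * (\<Theta> ^ E) ^ N0"
      proof -
        have "H ^ E = (2 * real d * (l1 Q + 1) * B * \<Theta> ^ d) ^ E * (\<Theta> ^ N0) ^ E"
          unfolding H_def by (rule power_mult_distrib)
        moreover have "(\<Theta> ^ N0) ^ E = (\<Theta> ^ E) ^ N0"
          by (metis power_mult mult.commute)
        ultimately show ?thesis unfolding R_def by simp
      qed
      finally have "(c * 2 ^ N0) * (\<Theta> ^ E) ^ N0 \<le> R * (\<Theta> ^ E) ^ N0"
        by (simp add: power_mult_distrib mult.assoc)
      then have "c * 2 ^ N0 \<le> R" using \<Theta> by simp
      moreover have "c * 2 ^ n2 \<le> c * 2 ^ N0"
        using c n1 a by (intro mult_left_mono power_increasing) auto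
      moreover have "R < c * 2 ^ n2" using n2 c by (simp add: pos_divide_less_eq mult.commute)
      ultimately show False by argo
    qed
  qed
qed

section \<open>Galois conjugates of eigenvalues on cohomology\<close>

text \<open>By Bezout, the values at \<open>z\<close> of rational polynomials form a field, over
  which the complex numbers become a vector space.\<close>

lemma inverse_mod_irreducible:
  assumes P: "irreducible P" "poly (rpoly P) z = 0" and p: "poly (rpoly p) z \<noteq> 0"
  shows "\<exists>q. poly (rpoly q) z * poly (rpoly p) z = 1"
proof -
  define a where "a = fst (bezout_coefficients P p)"
  define b where "b = snd (bezout_coefficients P p)"
  have bz: "a * P + b * p = gcd P p"
    unfolding a_def b_def by (rule bezout_coefficients_fst_snd)
  have "\<not> P dvd gcd P p"
  proof
    assume "P dvd gcd P p"
    then obtain k where "p = P * k" by auto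
    then show False using P(2) p by (simp add: rpoly_mult)
  qed
  then have "is_unit (gcd P p)"
    using irreducibleD'[OF P(1), of "gcd P p"] by auto
  then obtain k where k: "gcd P p * k = 1" by (metis dvdE)
  have "(a * k) * P + (b * k) * p = 1"
    using arg_cong[OF bz, of "\<lambda>x. x * k"] k by (simp add: algebra_simps)
  then have "poly (rpoly ((a * k) * P + (b * k) * p)) z = 1" by simp
  then have "poly (rpoly (b * k)) z * poly (rpoly p) z = 1"
    using P(2) by (simp add: rpoly_add rpoly_mult)
  then show ?thesis by blast
qed

text \<open>The hyperplane in \<open>\<complex>\<close> over \<open>\<rat>(\<mu>)\<close> that is complementary to \<open>z0\<close> comes from Zorn's lemma;
  \<open>T\<close> is the projection along it, followed by \<open>\<mu> \<mapsto> \<mu>'\<close>.\<close>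

lemma conjugate_semilinear_map:
  assumes P: "irreducible P" "poly (rpoly P) \<mu> = 0" "poly (rpoly P) \<mu>' = 0" and z0: "z0 \<noteq> 0"
  shows "\<exists>T :: complex \<Rightarrow> complex. (\<forall>x y. T (x + y) = T x + T y) \<and> (\<forall>x. T (\<mu> * x) = \<mu>' * T x) \<and> T z0 \<noteq> 0"
proof -
  define ev where "ev = (\<lambda>p. poly (rpoly p) \<mu>)"
  have ev_add: "ev (p + q) = ev p + ev q" and ev_mult: "ev (p * q) = ev p * ev q" for p q
    by (simp_all add: ev_def rpoly_add rpoly_mult)
  have ev_const: "ev [:c:] = of_rat c" for c by (simp add: ev_def map_poly_pCons)
  have ev_X: "ev [:0, 1:] = \<mu>" by (simp add: ev_def map_poly_pCons)
  have ev_inv: "\<exists>q. ev q * ev p = 1" if "ev p \<noteq> 0" for p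
    using inverse_mod_irreducible[OF P(1,2)] that by (simp add: ev_def)
  \<comment> \<open>Subspaces over this field that miss \<open>z0\<close>. A maximal one is a
    hyperplane: adding any further vector \<open>z\<close> captures \<open>z0\<close>, and the
    resulting relation can be solved for \<open>z\<close>.\<close>
  define good where "good = {H :: complex set. 0 \<in> H \<and> (\<forall>x\<in>H. \<forall>y\<in>H. x + y \<in> H) \<and>
     (\<forall>x\<in>H. \<forall>p. ev p * x \<in> H) \<and> z0 \<notin> H}"
  have "\<exists>M\<in>good. \<forall>X\<in>good. M \<subseteq> X \<longrightarrow> X = M"
  proof (rule subset_Zorn_nonempty)
    have "{0} \<in> good" using z0 by (auto simp: good_def)
    then show "good \<noteq> {}" by blast
    fix C assume C: "C \<noteq> {}" "subset.chain good C"
    then have sub: "C \<subseteq> good" and tot: "\<And>X Y. X \<in> C \<Longrightarrow> Y \<in> C \<Longrightarrow> X \<subseteq> Y \<or> Y \<subseteq> X"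
      by (auto simp: subset_chain_def)
    have "x + y \<in> \<Union>C" if xy: "x \<in> \<Union>C" "y \<in> \<Union>C" for x y
    proof -
      obtain X Y where XY: "x \<in> X" "X \<in> C" "y \<in> Y" "Y \<in> C" using xy by blast
      then obtain Z where Z: "x \<in> Z" "y \<in> Z" "Z \<in> C" using tot[of X Y] by blast
      then have "Z \<in> good" using sub by blast
      then have "x + y \<in> Z" using Z by (simp add: good_def)
      then show ?thesis using Z(3) by blast
    qed
    moreover have "0 \<in> \<Union>C" using C(1) sub by (auto simp: good_def)
    moreover have "ev p * x \<in> \<Union>C" if "x \<in> \<Union>C" for x p using that sub by (auto simp: good_def)
    moreover have "z0 \<notin> \<Union>C" using sub by (auto simp: good_def)
    ultimately show "\<Union>C \<in> good" unfolding good_def by blast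
  qed
  then obtain H where H: "H \<in> good" and max: "\<And>X. X \<in> good \<Longrightarrow> H \<subseteq> X \<Longrightarrow> X = H" by blast
  have H0: "0 \<in> H" and Hadd: "\<And>x y. x \<in> H \<Longrightarrow> y \<in> H \<Longrightarrow> x + y \<in> H"
    and Hmult: "\<And>x p. x \<in> H \<Longrightarrow> ev p * x \<in> H" and Hz0: "z0 \<notin> H"
    using H by (auto simp: good_def)
  have Hdiff: "x - y \<in> H" if "x \<in> H" "y \<in> H" for x y
    using Hadd[OF that(1) Hmult[OF that(2), of "[:-1:]"]] by (simp add: ev_const of_rat_minus)
  have spans: "\<exists>p. z - ev p * z0 \<in> H" for z
  proof (cases "z \<in> H")
    case True
    then show ?thesis by (intro exI[of _ 0]) (simp add: ev_def)
  next
    case False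
    define X where "X = {h + ev p * z | h p. h \<in> H}"
    have HX: "H \<subseteq> X"
    proof
      fix h assume "h \<in> H"
      then show "h \<in> X" unfolding X_def
        by (intro CollectI exI[of _ h] exI[of _ 0]) (simp add: ev_def)
    qed
    have zX: "z \<in> X" unfolding X_def
      by (intro CollectI exI[of _ 0] exI[of _ 1]) (simp add: ev_def H0)
    have "X \<notin> good" using max[OF _ HX] zX False by auto
    moreover have "0 \<in> X" using H0 HX by blast
    moreover have "x + y \<in> X" if "x \<in> X" "y \<in> X" for x y
    proof -
      obtain h p where "x = h + ev p * z" "h \<in> H" using \<open>x \<in> X\<close> unfolding X_def by blast
      moreover obtain h' p' where "y = h' + ev p' * z" "h' \<in> H" using \<open>y \<in> X\<close> unfolding X_def by blast
      ultimately have "x + y = (h + h') + ev (p + p') * z" "h + h' \<in> H"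
        by (simp_all add: ev_add algebra_simps Hadd)
      then show ?thesis unfolding X_def by blast
    qed
    moreover have "ev q * x \<in> X" if "x \<in> X" for x q
    proof -
      obtain h p where "x = h + ev p * z" "h \<in> H" using \<open>x \<in> X\<close> unfolding X_def by blast
      then have "ev q * x = ev q * h + ev (q * p) * z" "ev q * h \<in> H"
        by (simp_all add: ev_mult distrib_left mult.assoc Hmult)
      then show ?thesis unfolding X_def by blast
    qed
    ultimately have "z0 \<in> X" unfolding good_def by blast
    then obtain h p where hp: "z0 = h + ev p * z" "h \<in> H" unfolding X_def by blast
    then have "ev p \<noteq> 0" using Hz0 by auto
    then obtain q where q: "ev q * ev p = 1" using ev_inv by blast
    have "ev q * (ev p * z) = z" using q by (simp add: mult.assoc[symmetric])
    then have "z - ev q * z0 = ev [:-1:] * (ev q * h)"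
      unfolding hp(1) by (simp add: ev_const of_rat_minus distrib_left)
    then show ?thesis using Hmult[OF Hmult[OF hp(2)]] by metis
  qed
  \<comment> \<open>The coordinate polynomial \<open>p\<close> is unique modulo \<open>P\<close>,
    which also vanishes at \<open>\<mu>'\<close>; so its value there does not depend on the
    choice.\<close>
  define T where "T = (\<lambda>z. poly (rpoly (SOME p. z - ev p * z0 \<in> H)) \<mu>')"
  have T: "T z = poly (rpoly p) \<mu>'" if "z - ev p * z0 \<in> H" for z p
  proof -
    define q where "q = (SOME p. z - ev p * z0 \<in> H)"
    have q: "z - ev q * z0 \<in> H" unfolding q_def by (rule someI[of _ p]) (rule that)
    have "ev (p - q) * z0 \<in> H"
    proof -
      have "ev (p - q) = ev p - ev q" using ev_add[of "p - q" q] by simp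
      then have "ev (p - q) * z0 = (z - ev q * z0) - (z - ev p * z0)" by (simp add: left_diff_distrib)
      then show ?thesis using Hdiff[OF q that] by simp
    qed
    have "ev (p - q) = 0"
    proof (rule ccontr)
      assume "ev (p - q) \<noteq> 0"
      then obtain r where "ev r * ev (p - q) = 1" using ev_inv by blast
      then show False using Hmult[OF \<open>ev (p - q) * z0 \<in> H\<close>, of r] Hz0 by (simp flip: mult.assoc)
    qed
    then have "P dvd p - q" using irreducible_dvd_of_common_root[OF P(1,2)] by (simp add: ev_def)
    then obtain k where "p - q = P * k" by blast
    then have "p = q + P * k" by (metis add.commute diff_add_cancel)
    then have "poly (rpoly p) \<mu>' = poly (rpoly q) \<mu>'" using P(3) by (simp add: rpoly_add rpoly_mult)
    then show ?thesis by (simp add: T_def q_def)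
  qed
  show ?thesis
  proof (intro exI[of _ T] conjI allI)
    fix x y
    obtain p q where pq: "x - ev p * z0 \<in> H" "y - ev q * z0 \<in> H" using spans by metis
    have "(x + y) - ev (p + q) * z0 = (x - ev p * z0) + (y - ev q * z0)"
      by (simp add: ev_add algebra_simps)
    then have "(x + y) - ev (p + q) * z0 \<in> H" using Hadd[OF pq] by metis
    then show "T (x + y) = T x + T y" using T pq by (simp add: rpoly_add)
  next
    fix x
    obtain p where p: "x - ev p * z0 \<in> H" using spans by metis
    have "\<mu> * x - ev ([:0, 1:] * p) * z0 = ev [:0, 1:] * (x - ev p * z0)"
      unfolding ev_mult ev_X by (simp add: algebra_simps)
    then have "\<mu> * x - ev ([:0, 1:] * p) * z0 \<in> H" using Hmult[OF p] by metis
    then have "T (\<mu> * x) = poly (rpoly ([:0, 1:] * p)) \<mu>'" by (rule T)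
    also have "\<dots> = \<mu>' * T x" unfolding rpoly_mult T[OF p] by (simp add: map_poly_pCons)
    finally show "T (\<mu> * x) = \<mu>' * T x" .
  next
    have "z0 - ev 1 * z0 \<in> H" by (simp add: ev_def H0)
    from T[OF this] show "T z0 \<noteq> 0" by simp
  qed
qed

section \<open>Cochains with complex values\<close>

definition ceval :: "('f \<Rightarrow> complex) \<Rightarrow> ('f \<Rightarrow>\<^sub>0 int) \<Rightarrow> complex" where
  "ceval w c = (\<Sum>f\<in>Poly_Mapping.keys c. of_int (Poly_Mapping.lookup c f) * w f)"

lemma ceval_superset:
  assumes "finite S" "Poly_Mapping.keys c \<subseteq> S"
  shows "ceval w c = (\<Sum>f\<in>S. of_int (Poly_Mapping.lookup c f) * w f)"
  unfolding ceval_def by (rule sum.mono_neutral_left) (use assms in \<open>auto simp: in_keys_iff\<close>)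

lemma ceval_add: "ceval w (c + d) = ceval w c + ceval w d"
proof -
  let ?S = "Poly_Mapping.keys c \<union> Poly_Mapping.keys d"
  have "ceval w (c + d) = (\<Sum>f\<in>?S. of_int (Poly_Mapping.lookup (c + d) f) * w f)"
    by (rule ceval_superset) (use keys_add[of c d] in auto)
  also have "\<dots> = (\<Sum>f\<in>?S. of_int (Poly_Mapping.lookup c f) * w f) + (\<Sum>f\<in>?S. of_int (Poly_Mapping.lookup d f) * w f)"
    by (simp add: lookup_add algebra_simps sum.distrib)
  also have "\<dots> = ceval w c + ceval w d"
    using ceval_superset[of ?S c w] ceval_superset[of ?S d w] by simp
  finally show ?thesis .
qed

lemma ceval_zero [simp]: "ceval w 0 = 0"
  by (simp add: ceval_def)

lemma ceval_diff: "ceval w (c - d) = ceval w c - ceval w d"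
  using ceval_add[of w "c - d" d] by simp

lemma ceval_frag_of [simp]: "ceval w (frag_of f) = w f"
  by (simp add: ceval_def)

lemma ceval_cmul: "ceval w (frag_cmul k c) = of_int k * ceval w c"
proof -
  have "ceval w (frag_cmul k c) = (\<Sum>f\<in>Poly_Mapping.keys c. of_int (Poly_Mapping.lookup (frag_cmul k c) f) * w f)"
    by (rule ceval_superset) (auto simp: keys_cmul)
  then show ?thesis by (simp add: ceval_def sum_distrib_left mult.assoc)
qed

lemma ceval_sum: "ceval w (sum c I) = (\<Sum>i\<in>I. ceval w (c i))"
  by (induction I rule: infinite_finite_induct) (auto simp: ceval_add)

lemma ceval_boundary1:
  "ceval w (chain_boundary (Suc 0) c) = ceval (\<lambda>f. ceval w (chain_boundary (Suc 0) (frag_of f))) c"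
  by (simp add: chain_boundary_def frag_extend_def ceval_sum ceval_cmul ceval_def[of _ c])

lemma additive_ceval:
  assumes "\<And>x y. T (x + y) = T x + (T y :: complex)"
  shows "T (ceval w c) = ceval (\<lambda>f. T (w f)) c"
proof -
  interpret Modules.additive T by unfold_locales (rule assms)
  have n: "T (of_nat n * x) = of_nat n * T x" for n x
    by (induction n) (auto simp: zero assms algebra_simps)
  have i: "T (of_int k * x) = of_int k * T x" for k x
    by (cases k rule: int_cases2) (auto simp: n minus)
  show ?thesis unfolding ceval_def by (simp add: sum i)
qed

lemma cochain_eval_Re: "cochain_eval (\<lambda>f. Re (w f)) c = Re (ceval w c)"
  by (simp add: cochain_eval_def ceval_def)

lemma cochain_eval_Im: "cochain_eval (\<lambda>f. Im (w f)) c = Im (ceval w c)"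
  by (simp add: cochain_eval_def ceval_def)

definition ccohomologous0 :: "'a topology \<Rightarrow> (((nat \<Rightarrow> real) \<Rightarrow> 'a) \<Rightarrow> complex) \<Rightarrow> bool" where
  "ccohomologous0 X w \<longleftrightarrow> (\<exists>b. \<forall>f. singular_simplex (Suc 0) X f \<longrightarrow>
      w f = ceval b (chain_boundary (Suc 0) (frag_of f)))"

lemma ccohomologous0_iff:
  "ccohomologous0 X w \<longleftrightarrow> (\<exists>b. \<forall>f. singular_simplex (Suc 0) X f \<longrightarrow> Re (w f) = coboundary 0 b f) \<and>
     (\<exists>b. \<forall>f. singular_simplex (Suc 0) X f \<longrightarrow> Im (w f) = coboundary 0 b f)" (is "_ = (?R \<and> ?I)")
proof
  assume "ccohomologous0 X w"
  then obtain b where b: "\<And>f. singular_simplex (Suc 0) X f \<Longrightarrow>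
      w f = ceval b (chain_boundary (Suc 0) (frag_of f))" unfolding ccohomologous0_def by blast
  have ?R using b by (intro exI[of _ "\<lambda>f. Re (b f)"]) (auto simp: coboundary_def cochain_eval_Re)
  moreover have ?I using b by (intro exI[of _ "\<lambda>f. Im (b f)"]) (auto simp: coboundary_def cochain_eval_Im)
  ultimately show "?R \<and> ?I" ..
next
  assume "?R \<and> ?I"
  then obtain b1 b2 where b: "\<And>f. singular_simplex (Suc 0) X f \<Longrightarrow> Re (w f) = coboundary 0 b1 f"
    "\<And>f. singular_simplex (Suc 0) X f \<Longrightarrow> Im (w f) = coboundary 0 b2 f" by blast
  define b where "b = (\<lambda>f. Complex (b1 f) (b2 f))"
  have "coboundary 0 b1 f = Re (ceval b (chain_boundary (Suc 0) (frag_of f)))"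
    "coboundary 0 b2 f = Im (ceval b (chain_boundary (Suc 0) (frag_of f)))" for f
    unfolding coboundary_def by (simp_all add: b_def flip: cochain_eval_Re cochain_eval_Im)
  then have "w f = ceval b (chain_boundary (Suc 0) (frag_of f))" if "singular_simplex (Suc 0) X f" for f
    using b[OF that] by (simp add: complex_eq_iff)
  then show "ccohomologous0 X w" unfolding ccohomologous0_def by blast
qed

text \<open>For \<open>w = u + i v\<close> the two real equations are one complex equation between
  values of \<open>w\<close>, the form to which an additive map of the complex numbers can be
  applied.\<close>

lemma H1_eigenvalue_iff:
  "H1_eigenvalue X g \<mu> \<longleftrightarrow> (\<exists>w.
     (\<forall>f. singular_simplex (Suc (Suc 0)) X f \<longrightarrow> ceval w (chain_boundary (Suc (Suc 0)) (frag_of f)) = 0) \<and>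
     \<not> ccohomologous0 X w \<and> ccohomologous0 X (\<lambda>f. w (simplex_map 1 g f) - \<mu> * w f))" (is "_ = ?R")
proof
  assume "H1_eigenvalue X g \<mu>"
  then obtain u v where uv: "cocycle 1 X u" "cocycle 1 X v"
        "\<not> (cohomologous1 X u (\<lambda>_. 0) \<and> cohomologous1 X v (\<lambda>_. 0))"
        "cohomologous1 X (cochain_pullback 1 g u) (\<lambda>f. Re \<mu> * u f - Im \<mu> * v f)"
        "cohomologous1 X (cochain_pullback 1 g v) (\<lambda>f. Im \<mu> * u f + Re \<mu> * v f)"
    unfolding H1_eigenvalue_def by blast
  define w where "w = (\<lambda>f. Complex (u f) (v f))"
  have "u = (\<lambda>f. Re (w f))" "v = (\<lambda>f. Im (w f))" by (auto simp: w_def)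
  with uv show ?R
    by (intro exI[of _ w])
      (auto simp: cocycle_def coboundary_def cochain_eval_Re cochain_eval_Im complex_eq_iff
        ccohomologous0_iff cohomologous1_def cochain_pullback_def algebra_simps)
next
  assume ?R
  then obtain w where w: "\<And>f. singular_simplex (Suc (Suc 0)) X f \<Longrightarrow> ceval w (chain_boundary (Suc (Suc 0)) (frag_of f)) = 0"
     "\<not> ccohomologous0 X w" "ccohomologous0 X (\<lambda>f. w (simplex_map 1 g f) - \<mu> * w f)" by blast
  then show "H1_eigenvalue X g \<mu>" unfolding H1_eigenvalue_def
    by (intro exI[of _ "\<lambda>f. Re (w f)"] exI[of _ "\<lambda>f. Im (w f)"])
      (auto simp: cocycle_def coboundary_def cochain_eval_Re cochain_eval_Im
        ccohomologous0_iff cohomologous1_def cochain_pullback_def algebra_simps)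
qed

text \<open>Integrating \<open>w\<close> along chains to a chosen representative in each class of
  homologous points gives a primitive. Contrapositively, a nonzero class takes a nonzero value on
  some cycle: one complex number by which nontriviality can be tested.\<close>

lemma ccohomologous0_if_vanishes_on_cycles:
  assumes "\<And>c. singular_chain (Suc 0) X c \<Longrightarrow> chain_boundary (Suc 0) c = 0 \<Longrightarrow> ceval w c = 0"
  shows "ccohomologous0 X w"
proof -
  define R where "R = (\<lambda>x y. \<exists>c. singular_chain (Suc 0) X c \<and> chain_boundary (Suc 0) c = frag_of x - frag_of y)"
  have refl: "R x x" for x unfolding R_def by (intro exI[of _ 0]) auto
  have sym: "R y x" if xy: "R x y" for x y
  proof -
    obtain c where "singular_chain (Suc 0) X c" "chain_boundary (Suc 0) c = frag_of x - frag_of y"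
      using xy unfolding R_def by blast
    then show ?thesis unfolding R_def
      by (intro exI[of _ "- c"]) (simp add: singular_chain_minus chain_boundary_minus)
  qed
  have trans: "R x z" if xyz: "R x y" "R y z" for x y z
  proof -
    obtain c d where "singular_chain (Suc 0) X c" "chain_boundary (Suc 0) c = frag_of x - frag_of y"
      "singular_chain (Suc 0) X d" "chain_boundary (Suc 0) d = frag_of y - frag_of z"
      using xyz unfolding R_def by blast
    then show ?thesis unfolding R_def
      by (intro exI[of _ "c + d"]) (simp add: singular_chain_add chain_boundary_add)
  qed
  define r where "r = (\<lambda>x. SOME y. R x y)"
  have Rr: "R x (r x)" for x unfolding r_def by (rule someI[of _ x]) (rule refl)
  have r_eq: "r x = r y" if "R x y" for x y
  proof -
    have "R x = R y" using that sym trans by blast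
    then show ?thesis by (simp add: r_def)
  qed
  obtain k where k: "\<And>x. singular_chain (Suc 0) X (k x)" "\<And>x. chain_boundary (Suc 0) (k x) = frag_of x - frag_of (r x)"
    using Rr unfolding R_def by metis
  show ?thesis unfolding ccohomologous0_def
  proof (intro exI[of _ "\<lambda>x. ceval w (k x)"] allI impI)
    fix f assume f: "singular_simplex (Suc 0) X f"
    define x where "x = singular_face (Suc 0) 0 f"
    define y where "y = singular_face (Suc 0) (Suc 0) f"
    have bf: "chain_boundary (Suc 0) (frag_of f) = frag_of x - frag_of y"
      by (simp add: chain_boundary_def x_def y_def)
    have "R x y" unfolding R_def using f bf by (intro exI[of _ "frag_of f"]) (simp add: singular_chain_of)
    then have rr: "r x = r y" by (rule r_eq)
    have "ceval w (frag_of f + k y - k x) = 0"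
    proof (rule assms)
      show "singular_chain (Suc 0) X (frag_of f + k y - k x)"
        by (intro singular_chain_diff singular_chain_add k) (simp add: singular_chain_of f)
      show "chain_boundary (Suc 0) (frag_of f + k y - k x) = 0"
        unfolding chain_boundary_diff chain_boundary_add k bf rr by simp
    qed
    then have "w f = ceval w (k x) - ceval w (k y)"
      by (simp add: ceval_add ceval_diff algebra_simps)
    then show "w f = ceval (\<lambda>x. ceval w (k x)) (chain_boundary (Suc 0) (frag_of f))"
      by (simp add: bf ceval_diff)
  qed
qed

text \<open>Additivity suffices for \<open>T\<close> to commute with evaluation on integral chains.
  \<open>T\<close> is chosen after a cycle \<open>c\<close> on which \<open>w\<close> is nonzero:
  then \<open>T \<circ> w\<close> is nonzero on \<open>c\<close>, while coboundaries vanish on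
  cycles.\<close>

lemma H1_eigenvalue_transfer:
  assumes ev: "H1_eigenvalue X g \<mu>"
    and T: "\<And>z. z \<noteq> 0 \<Longrightarrow> \<exists>T :: complex \<Rightarrow> complex. (\<forall>x y. T (x + y) = T x + T y) \<and>
      (\<forall>x. T (\<mu> * x) = \<mu>' * T x) \<and> T z \<noteq> 0"
  shows "H1_eigenvalue X g \<mu>'"
proof -
  obtain w where w: "\<And>f. singular_simplex (Suc (Suc 0)) X f \<Longrightarrow> ceval w (chain_boundary (Suc (Suc 0)) (frag_of f)) = 0"
     "\<not> ccohomologous0 X w" "ccohomologous0 X (\<lambda>f. w (simplex_map 1 g f) - \<mu> * w f)"
    using ev unfolding H1_eigenvalue_iff by blast
  obtain c where c: "singular_chain (Suc 0) X c" "chain_boundary (Suc 0) c = 0" "ceval w c \<noteq> 0"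
    using ccohomologous0_if_vanishes_on_cycles w(2) by blast
  obtain T where T: "\<And>x y. T (x + y) = T x + T y" "\<And>x. T (\<mu> * x) = \<mu>' * T x" "T (ceval w c) \<noteq> 0"
    using T[OF c(3)] by blast
  interpret Modules.additive T by unfold_locales (rule T)
  show ?thesis unfolding H1_eigenvalue_iff
  proof (intro exI[of _ "\<lambda>f. T (w f)"] conjI allI impI notI)
    fix f assume "singular_simplex (Suc (Suc 0)) X f"
    then show "ceval (\<lambda>f. T (w f)) (chain_boundary (Suc (Suc 0)) (frag_of f)) = 0"
      using additive_ceval[OF T(1), of w] w(1)[of f] zero by metis
  next
    assume "ccohomologous0 X (\<lambda>f. T (w f))"
    then obtain b where b: "\<And>f. singular_simplex (Suc 0) X f \<Longrightarrow>
      T (w f) = ceval b (chain_boundary (Suc 0) (frag_of f))" unfolding ccohomologous0_def by blast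
    have "T (ceval w c) = ceval (\<lambda>f. T (w f)) c" by (rule additive_ceval[OF T(1)])
    also have "\<dots> = ceval (\<lambda>f. ceval b (chain_boundary (Suc 0) (frag_of f))) c"
      unfolding ceval_def[of _ c] using c(1)
      by (intro sum.cong refl arg_cong2[of _ _ _ _ "(*)"] b) (auto simp: singular_chain_def)
    also have "\<dots> = 0" by (simp add: c(2) flip: ceval_boundary1)
    finally show False using T(3) by simp
  next
    obtain b where b: "\<And>f. singular_simplex (Suc 0) X f \<Longrightarrow>
      w (simplex_map 1 g f) - \<mu> * w f = ceval b (chain_boundary (Suc 0) (frag_of f))"
      using w(3) unfolding ccohomologous0_def by blast
    show "ccohomologous0 X (\<lambda>f. T (w (simplex_map 1 g f)) - \<mu>' * T (w f))"
      unfolding ccohomologous0_def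
    proof (intro exI[of _ "\<lambda>f. T (b f)"] allI impI)
      fix f assume f: "singular_simplex (Suc 0) X f"
      have "T (w (simplex_map 1 g f)) - \<mu>' * T (w f) = T (w (simplex_map 1 g f) - \<mu> * w f)"
        by (simp add: diff T(2))
      also have "\<dots> = ceval (\<lambda>f. T (b f)) (chain_boundary (Suc 0) (frag_of f))"
        unfolding b[OF f] by (rule additive_ceval[OF T(1)])
      finally show "T (w (simplex_map 1 g f)) - \<mu>' * T (w f) = \<dots>" .
    qed
  qed
qed

lemma H1_eigenvalue_galois_conjugate:
  assumes "H1_eigenvalue X g \<mu>" "galois_conjugate \<mu> \<mu>'"
  shows "H1_eigenvalue X g \<mu>'"
  using assms conjugate_semilinear_map unfolding galois_conjugate_def
  by (intro H1_eigenvalue_transfer[OF assms(1)]) blast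

lemma H1_eigenvalue_cnj:
  assumes "H1_eigenvalue X g \<mu>"
  shows "H1_eigenvalue X g (cnj \<mu>)"
  by (intro H1_eigenvalue_transfer[OF assms] exI[of _ cnj]) auto

text \<open>The complex conjugate is an eigenvalue of the same modulus, and dominance is
  strict.\<close>

lemma H1_dominant_eigenvalue_real:
  assumes "H1_dominant_eigenvalue X g \<mu>"
  shows "\<mu> \<in> \<real>"
  using assms H1_eigenvalue_cnj[of X g \<mu>] unfolding H1_dominant_eigenvalue_def
  by (metis complex_mod_cnj less_irrefl Reals_cnj_iff)

section \<open>Powers of Galois conjugates\<close>

lemma rational_relation_powers:
  assumes P: "irreducible P" "poly (rpoly P) \<mu> = 0"
  shows "\<exists>R. R \<noteq> 0 \<and> poly (rpoly R) (\<mu> ^ K) = 0"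
proof -
  interpret V: vector_space "\<lambda>(q::rat) (x::complex). of_rat q * x"
    by unfold_locales (auto simp: algebra_simps of_rat_add of_rat_mult)
  define d where "d = degree P"
  have P0: "P \<noteq> 0" using P(1) by auto
  define S where "S = (\<lambda>i. \<mu> ^ i) ` {..<d}"
  \<comment> \<open>The relation \<open>P\<close> expresses every power of \<open>\<mu>\<close> by
    the first \<open>d\<close> ones, so the \<open>d + 1\<close> numbers \<open>f i\<close> below
    are linearly dependent over the rationals.\<close>
  have span: "\<mu> ^ n \<in> V.span S" for n
  proof (induction n rule: less_induct)
    case (less n)
    show ?case
    proof (cases "n < d")
      case True
      then show ?thesis by (intro V.span_base) (auto simp: S_def)
    next
      case False
      have "0 = \<mu> ^ (n - d) * poly (rpoly P) \<mu>" using P(2) by simp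
      also have "poly (rpoly P) \<mu> = (\<Sum>i\<le>d. of_rat (coeff P i) * \<mu> ^ i)"
        by (simp add: poly_altdef degree_map_poly coeff_map_poly d_def)
      also have "\<mu> ^ (n - d) * \<dots> = (\<Sum>i\<le>d. of_rat (coeff P i) * \<mu> ^ (n - d + i))"
        by (simp add: sum_distrib_left power_add mult_ac)
      also have "\<dots> = of_rat (lead_coeff P) * \<mu> ^ n + (\<Sum>i<d. of_rat (coeff P i) * \<mu> ^ (n - d + i))"
        using False by (simp add: lessThan_Suc_atMost[symmetric] d_def add.commute)
      finally have "of_rat (lead_coeff P) * \<mu> ^ n = - (\<Sum>i<d. of_rat (coeff P i) * \<mu> ^ (n - d + i))"
        by (simp add: eq_neg_iff_add_eq_0)
      moreover have "\<dots> \<in> V.span S"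
        using False by (intro V.span_neg V.span_sum V.span_scale less.IH) auto
      ultimately have "of_rat (lead_coeff P) * \<mu> ^ n \<in> V.span S" by simp
      from V.span_scale[OF this, of "inverse (lead_coeff P)"] show ?thesis
        using P0 by (simp add: of_rat_inverse mult.assoc[symmetric])
    qed
  qed
  define f where "f = (\<lambda>i. (\<mu> ^ K) ^ i)"
  \<comment> \<open>Linear dependence is a property of sets, so a coincidence among the powers is
    treated separately; it gives a relation with two terms.\<close>
  show ?thesis
  proof (cases "inj_on f {..d}")
    case False
    then obtain i j where ij: "i \<noteq> j" "f i = f j" by (auto simp: inj_on_def)
    have "monom 1 i - monom (1::rat) j \<noteq> 0"
    proof
      assume "monom 1 i - monom (1::rat) j = 0"
      then have "coeff (monom 1 i - monom (1::rat) j) i = 0" by simp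
      then show False using ij(1) by (simp split: if_splits)
    qed
    moreover have "rpoly (monom 1 i - monom 1 j) = monom 1 i - monom 1 j"
      by (intro poly_eqI) (simp add: coeff_map_poly of_rat_diff)
    ultimately show ?thesis using ij(2)
      by (intro exI[of _ "monom 1 i - monom 1 j"]) (simp add: poly_monom f_def)
  next
    case True
    have "V.dependent (f ` {..d})"
    proof (rule ccontr)
      assume "V.independent (f ` {..d})"
      then have "card (f ` {..d}) \<le> card S"
        using V.independent_span_bound[of S "f ` {..d}"] span
        by (auto simp: S_def f_def simp flip: power_mult)
      also have "\<dots> \<le> d" unfolding S_def using card_image_le[of "{..<d}"] by simp
      finally show False using card_image[OF True] by simp
    qed
    then obtain u where u: "\<exists>v\<in>f ` {..d}. u v \<noteq> 0" "(\<Sum>v\<in>f ` {..d}. of_rat (u v) * v) = 0"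
      using V.dependent_finite[of "f ` {..d}"] by auto
    define R where "R = (\<Sum>i\<le>d. monom (u (f i)) i)"
    have cR: "coeff R i = (if i \<le> d then u (f i) else 0)" for i
      by (simp add: R_def coeff_sum)
    have "R \<noteq> 0"
    proof -
      obtain i where "i \<le> d" "u (f i) \<noteq> 0" using u(1) by auto
      then show ?thesis using cR[of i] by auto
    qed
    moreover have "rpoly R = (\<Sum>i\<le>d. monom (of_rat (u (f i))) i)"
      by (intro poly_eqI) (simp add: coeff_map_poly cR coeff_sum)
    then have "poly (rpoly R) (\<mu> ^ K) = (\<Sum>i\<le>d. of_rat (u (f i)) * f i)"
      by (simp add: poly_sum poly_monom f_def)
    then have "poly (rpoly R) (\<mu> ^ K) = 0" using u(2) by (simp add: sum.reindex[OF True])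
    ultimately show ?thesis by blast
  qed
qed

text \<open>If \<open>Q\<close> is the minimal polynomial of \<open>\<mu> ^ K\<close>, then
  \<open>Q\<close> composed with the \<open>K\<close>-th power vanishes at \<open>\<mu>\<close>,
  hence is divisible by \<open>P\<close> and vanishes at \<open>\<mu>'\<close> too.\<close>

lemma galois_conjugate_power:
  assumes "galois_conjugate \<mu> \<mu>'"
  shows "galois_conjugate (\<mu> ^ K) (\<mu>' ^ K)"
proof -
  obtain P where P: "irreducible P" "poly (rpoly P) \<mu> = 0" "poly (rpoly P) \<mu>' = 0"
    using assms unfolding galois_conjugate_def by blast
  obtain R where "R \<noteq> 0" "poly (rpoly R) (\<mu> ^ K) = 0" using rational_relation_powers[OF P(1,2)] by blast
  then obtain Q where Q: "irreducible Q" "poly (rpoly Q) (\<mu> ^ K) = 0" using minimal_polynomial by blast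
  have pc: "poly (rpoly (pcompose Q (monom 1 K))) z = poly (rpoly Q) (z ^ K)" for z
  proof (induction Q)
    case (pCons a Q)
    have "rpoly (monom 1 K) = monom 1 K" by (intro poly_eqI) (simp add: coeff_map_poly)
    with pCons show ?case
      by (simp add: pcompose_pCons rpoly_add rpoly_mult map_poly_pCons poly_monom)
  qed simp
  then have "P dvd pcompose Q (monom 1 K)"
    using irreducible_dvd_of_common_root[OF P(1,2)] Q(2) by simp
  then obtain k where "pcompose Q (monom 1 K) = P * k" by blast
  then have "poly (rpoly Q) (\<mu>' ^ K) = 0" using pc[of \<mu>'] P(3) by (simp add: rpoly_mult)
  with Q show ?thesis unfolding galois_conjugate_def by blast
qed

section \<open>Twisted sums over substitution words\<close>

definition e :: "real \<Rightarrow> complex" where "e x = cis (2 * pi * x)"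

lemma e_add: "e (x + y) = e x * e y"
  by (simp add: e_def cis_mult distrib_left)

lemma e_zero [simp]: "e 0 = 1"
  by (simp add: e_def)

lemma cmod_e [simp]: "cmod (e x) = 1"
  by (simp add: e_def)

lemma cnj_e: "cnj (e x) = e (- x)"
  by (simp add: e_def cis_cnj)

lemma cmod_one_plus_e: "cmod (1 + e x) = 2 * \<bar>cos (pi * x)\<bar>"
proof -
  have "(cmod (1 + e x))^2 = (1 + cos (2 * pi * x))^2 + (sin (2 * pi * x))^2"
    by (simp add: cmod_power2 e_def)
  also have "\<dots> = 2 + 2 * cos (2 * (pi * x))"
    using sin_cos_squared_add[of "2 * pi * x"] by (simp add: power2_sum algebra_simps)
  also have "\<dots> = (2 * \<bar>cos (pi * x)\<bar>)^2"
    by (simp add: cos_double_cos power_mult_distrib)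
  finally show ?thesis by (rule power2_eq_imp_eq) auto
qed

text \<open>The modulus is twice the absolute value of \<open>cos (pi * x)\<close>, of period 1 in
  \<open>x\<close>. Subtracting the nearest integer moves \<open>x\<close> to the range where the
  cosine is nonnegative and decreases with the distance from 0.\<close>

lemma cmod_one_plus_e_le:
  assumes \<delta>: "0 \<le> \<delta>" "\<delta> \<le> \<bar>x - of_int (round x)\<bar>"
  shows "cmod (1 + e x) \<le> 2 * cos (pi * \<delta>)"
proof -
  define y where "y = x - of_int (round x)"
  define t where "t = \<bar>y\<bar>"
  have t: "0 \<le> t" "t \<le> 1 / 2" using of_int_round_abs_le[of x] by (simp_all add: t_def y_def abs_minus_commute)
  have "cos (pi * x) = cos (pi * y + pi * of_int (round x))" by (simp add: y_def algebra_simps)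
  moreover have s: "sin (pi * of_int (round x)) = 0"
    by (simp add: sin_times_pi_eq_0 mult.commute)
  ultimately have "\<bar>cos (pi * x)\<bar> = \<bar>cos (pi * y)\<bar> * \<bar>cos (pi * of_int (round x))\<bar>"
    by (simp only: cos_add s) (simp add: abs_mult)
  then have "\<bar>cos (pi * x)\<bar> = \<bar>cos (pi * y)\<bar>" using sin_zero_abs_cos_one[OF s] by simp
  also have "\<dots> = \<bar>cos (pi * t)\<bar>" unfolding t_def by (cases "0 \<le> y") auto
  also have "\<dots> = cos (pi * t)"
  proof (intro abs_of_nonneg cos_ge_zero)
    have "pi * t \<le> pi * (1 / 2)" using t by (intro mult_left_mono) auto
    then show "pi * t \<le> pi / 2" by simp
    have "0 \<le> pi * t" using t by simp
    then show "- (pi / 2) \<le> pi * t" using pi_gt_zero by linarith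
  qed
  also have "\<dots> \<le> cos (pi * \<delta>)"
    using \<delta> t by (intro cos_monotone_0_pi_le) (auto simp: t_def y_def)
  finally show ?thesis unfolding cmod_one_plus_e by simp
qed

section \<open>Words and twisted sums\<close>

lemma sum_list_count_list:
  fixes f :: "'b::finite \<Rightarrow> real"
  shows "sum_list (map f w) = (\<Sum>i\<in>UNIV. real (count_list w i) * f i)"
proof (induction w)
  case (Cons b w)
  have "(\<Sum>i\<in>UNIV. real (count_list (b # w) i) * f i) =
      (\<Sum>i\<in>UNIV. real (count_list w i) * f i + (if b = i then f i else 0))"
    by (intro sum.cong refl) (auto simp: algebra_simps)
  also have "\<dots> = sum_list (map f w) + f b" by (simp add: sum.distrib Cons.IH)
  finally show ?case by simp
qed simp

lemma subst_word_append: "subst_word \<zeta> (u @ v) = subst_word \<zeta> u @ subst_word \<zeta> v"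
  by (simp add: subst_word_def)

lemma subst_word_Cons: "subst_word \<zeta> (b # v) = \<zeta> b @ subst_word \<zeta> v"
  by (simp add: subst_word_def)

lemma subst_word_Nil [simp]: "subst_word \<zeta> [] = []"
  by (simp add: subst_word_def)

lemma subst_power_append: "(subst_word \<zeta> ^^ k) (u @ v) = (subst_word \<zeta> ^^ k) u @ (subst_word \<zeta> ^^ k) v"
  by (induction k) (auto simp: subst_word_append)

lemma subst_power_Nil [simp]: "(subst_word \<zeta> ^^ k) [] = []"
  by (induction k) auto

lemma count_list_subst_word:
  "real (count_list (subst_word \<zeta> w) i) = (\<Sum>k\<in>UNIV. real (count_list (\<zeta> k) i) * real (count_list w (k::'b::finite)))"
proof -
  have "real (count_list (subst_word \<zeta> w) i) = sum_list (map (\<lambda>k. real (count_list (\<zeta> k) i)) w)"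
    by (induction w) (auto simp: subst_word_Cons)
  then show ?thesis by (simp add: sum_list_count_list mult.commute)
qed

lemma subst_matrix_power:
  fixes \<zeta> :: "'b::finite \<Rightarrow> 'b list"
  shows "(((**) (subst_matrix \<zeta>)) ^^ n) (mat 1) $ i $ b = real (count_list ((subst_word \<zeta> ^^ n) [b]) i)"
proof (induction n arbitrary: i)
  case 0
  show ?case by (auto simp: mat_def)
next
  case (Suc n)
  then show ?case by (simp add: matrix_matrix_mult_def subst_matrix_def count_list_subst_word)
qed

text \<open>The sum of \<open>e (- \<omega> * h)\<close> over the occurrences of \<open>a\<close>,
  where \<open>h\<close> is the length of the prefix in front of the occurrence: up to a factor, the
  Fourier integral over the visits of a suspension orbit to the cell of \<open>a\<close>.\<close>

primrec twisted_sum :: "('b \<Rightarrow> real) \<Rightarrow> real \<Rightarrow> 'b \<Rightarrow> 'b list \<Rightarrow> complex" where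
  "twisted_sum s \<omega> a [] = 0"
| "twisted_sum s \<omega> a (b # w) = (if b = a then 1 else 0) + e (- \<omega> * s b) * twisted_sum s \<omega> a w"

lemma twisted_sum_append:
  "twisted_sum s \<omega> a (u @ v) = twisted_sum s \<omega> a u + e (- \<omega> * sum_list (map s u)) * twisted_sum s \<omega> a v"
  by (induction u) (auto simp: algebra_simps simp flip: e_add)

text \<open>With \<open>\<kappa> = sqrt \<theta>\<close>, Bernoulli's inequality bounds the linear
  factor by \<open>\<kappa> ^ (T - i) / (\<kappa> - 1)\<close>, and a geometric series in
  \<open>\<kappa>\<close> remains.\<close>

lemma sum_geometric_times_linear:
  fixes \<theta> :: real
  assumes "\<theta> > 1"
  shows "(\<Sum>i<T. \<theta> ^ i * real (T - i)) \<le> \<theta> ^ T / (sqrt \<theta> - 1)\<^sup>2"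
proof -
  define \<kappa> where "\<kappa> = sqrt \<theta>"
  have \<kappa>: "\<kappa> > 1" "\<theta> = \<kappa>^2" using assms by (auto simp: \<kappa>_def)
  have lin: "real m \<le> \<kappa> ^ m / (\<kappa> - 1)" for m
    using Bernoulli_inequality[of "\<kappa> - 1" m] \<kappa> by (simp add: field_simps)
  have "(\<Sum>i<T. \<theta> ^ i * real (T - i)) \<le> (\<Sum>i<T. \<kappa> ^ T / (\<kappa> - 1) * \<kappa> ^ i)"
  proof (intro sum_mono)
    fix i assume i: "i \<in> {..<T}"
    have "\<theta> ^ i * real (T - i) \<le> \<theta> ^ i * (\<kappa> ^ (T - i) / (\<kappa> - 1))"
      using assms by (intro mult_left_mono lin) auto
    also have "\<theta> ^ i * \<kappa> ^ (T - i) = \<kappa> ^ T * \<kappa> ^ i"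
    proof -
      have "\<theta> ^ i * \<kappa> ^ (T - i) = \<kappa> ^ (2 * i + (T - i))" by (simp add: \<kappa> power_mult power_add)
      also have "2 * i + (T - i) = T + i" using i by simp
      finally show ?thesis by (simp add: power_add)
    qed
    then have "\<theta> ^ i * (\<kappa> ^ (T - i) / (\<kappa> - 1)) = \<kappa> ^ T / (\<kappa> - 1) * \<kappa> ^ i" by simp
    finally show "\<theta> ^ i * real (T - i) \<le> \<kappa> ^ T / (\<kappa> - 1) * \<kappa> ^ i" .
  qed
  also have "\<dots> = \<kappa> ^ T / (\<kappa> - 1) * ((\<kappa> ^ T - 1) / (\<kappa> - 1))"
    using \<kappa> by (subst sum_distrib_left[symmetric]) (simp add: geometric_sum)
  also have "\<dots> \<le> \<kappa> ^ T / (\<kappa> - 1) * (\<kappa> ^ T / (\<kappa> - 1))"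
    using \<kappa> by (intro mult_left_mono divide_right_mono) auto
  also have "\<dots> = \<theta> ^ T / (\<kappa> - 1)\<^sup>2" by (simp add: \<kappa>(2) power2_eq_square power_mult_distrib)
  finally show ?thesis by (simp add: \<kappa>_def)
qed

text \<open>The terms near \<open>i = T\<close> dominate: \<open>T \<le> (i + 1) * (T - i)\<close>
  turns the power of \<open>i + 1\<close> into that of \<open>T\<close> at the cost of a factor
  \<open>T - i\<close>. Bounding \<open>(T - i) powr \<gamma>\<close> by \<open>T - i\<close> uses
  \<open>\<gamma> \<le> 1\<close>; hence the cap on the exponent.\<close>

lemma sum_geometric_times_powr:
  fixes \<theta> \<gamma> :: real
  assumes \<theta>: "\<theta> > 1" and \<gamma>: "0 < \<gamma>" "\<gamma> \<le> 1" and T: "T \<ge> 1"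
  shows "(\<Sum>i<T. \<theta> ^ i * real (Suc i) powr - \<gamma>) \<le> \<theta> ^ T / (sqrt \<theta> - 1)\<^sup>2 * real T powr - \<gamma>"
proof -
  have "(\<Sum>i<T. \<theta> ^ i * real (Suc i) powr - \<gamma>) \<le> (\<Sum>i<T. \<theta> ^ i * (real T powr - \<gamma> * real (T - i)))"
  proof (intro sum_mono mult_left_mono)
    fix i assume "i \<in> {..<T}"
    then have i: "i < T" by simp
    define m where "m = T - i"
    have m: "T = m + i" "1 \<le> m" using i by (auto simp: m_def)
    have "T \<le> Suc i * m"
    proof -
      have "i * 1 \<le> i * m" using m(2) by (intro mult_left_mono) auto
      then show ?thesis using m by simp
    qed
    then have "real T \<le> real (Suc i) * real m" by (metis of_nat_le_iff of_nat_mult)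
    then have "real T powr \<gamma> \<le> (real (Suc i) * real m) powr \<gamma>"
      using \<gamma> by (intro powr_mono2) auto
    also have "\<dots> = real (Suc i) powr \<gamma> * real m powr \<gamma>" by (simp add: powr_mult)
    also have "\<dots> \<le> real (Suc i) powr \<gamma> * real m"
      using powr_mono[of \<gamma> 1 "real m"] \<gamma> m by (intro mult_left_mono) auto
    finally have *: "real T powr \<gamma> \<le> real (Suc i) powr \<gamma> * real m" .
    have "0 < real T powr \<gamma>" "0 < real (Suc i) powr \<gamma>" using T by auto
    then show "real (Suc i) powr - \<gamma> \<le> real T powr - \<gamma> * real (T - i)"
      using * by (simp add: powr_minus m_def[symmetric] field_simps)
  qed (use \<theta> in auto)
  also have "\<dots> = real T powr - \<gamma> * (\<Sum>i<T. \<theta> ^ i * real (T - i))"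
    by (simp add: sum_distrib_left mult_ac)
  also have "\<dots> \<le> real T powr - \<gamma> * (\<theta> ^ T / (sqrt \<theta> - 1)\<^sup>2)"
    by (intro mult_left_mono sum_geometric_times_linear \<theta>) auto
  finally show ?thesis by (simp add: mult.commute)
qed

text \<open>Each block from \<open>n1 * b ^ q\<close> to \<open>n1 * b ^ Suc q\<close>, with
  \<open>b = L + 2\<close>, contains a complete step with a drop. So \<open>q\<close> blocks give
  \<open>(1 - \<rho>) ^ q\<close>, a negative power of \<open>k\<close> when \<open>q\<close> is of
  order \<open>log b k\<close>. Taking \<open>L + 2\<close> instead of \<open>L\<close> makes room
  for the end \<open>n + 1\<close> of the step and keeps \<open>b > 1\<close>.\<close>

lemma windowed_decay:
  fixes D :: "nat \<Rightarrow> real" and \<rho> :: real and L j n1 :: nat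
  defines "\<gamma> \<equiv> min 1 (- ln (1 - \<rho>) / ln (real (L + 2)))"
  assumes anti: "\<And>k. D (Suc k) \<le> D k" and nonneg: "\<And>k. 0 \<le> D k"
    and \<rho>: "0 < \<rho>" "\<rho> < 1" and j: "j \<ge> 1" and n1: "n1 \<ge> 1"
    and drop: "\<And>N. n1 \<le> N \<Longrightarrow> \<exists>n. N \<le> n \<and> n \<le> L * N \<and> D (j * n + j) \<le> (1 - \<rho>) * D (j * n)"
  shows "0 < \<gamma>" "D k \<le> D 0 / (1 - \<rho>) * (2 * real (j * n1)) powr \<gamma> * real (Suc k) powr - \<gamma>"
proof -
  define b where "b = L + 2"
  have b: "b \<ge> 2" by (simp add: b_def)
  have lnb: "0 < ln (real b)" using b by simp
  show \<gamma>: "0 < \<gamma>" using \<rho> lnb by (simp add: \<gamma>_def b_def field_simps)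
  have mono: "D k \<le> D k'" if "k' \<le> k" for k k' by (rule lift_Suc_antimono_le[of D, OF anti that])
  have pow: "D (j * (n1 * b ^ q)) \<le> (1 - \<rho>) ^ q * D 0" for q
  proof (induction q)
    case 0
    show ?case using mono[of 0] by simp
  next
    case (Suc q)
    let ?N = "n1 * b ^ q"
    have N1: "n1 \<le> ?N" using b by simp
    from drop[OF this] obtain n where n: "?N \<le> n" "n \<le> L * ?N" "D (j * n + j) \<le> (1 - \<rho>) * D (j * n)" by blast
    have "n + 1 \<le> L * ?N + ?N + ?N" using n(2) N1 n1 by linarith
    then have "n + 1 \<le> n1 * b ^ Suc q" by (simp add: b_def algebra_simps)
    then have "j * n + j \<le> j * (n1 * b ^ Suc q)"
      using mult_le_mono2[of "n + 1" "n1 * b ^ Suc q" j] by simp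
    then have "D (j * (n1 * b ^ Suc q)) \<le> (1 - \<rho>) * D (j * n)" using mono n(3) by (meson order.trans)
    also have "\<dots> \<le> (1 - \<rho>) * D (j * ?N)"
      using \<rho> n(1) by (intro mult_left_mono mono) auto
    also have "\<dots> \<le> (1 - \<rho>) * ((1 - \<rho>) ^ q * D 0)" using \<rho> Suc by (intro mult_left_mono) auto
    finally show ?case by simp
  qed
  define M where "M = real (j * n1)"
  have M: "M \<ge> 1" using j n1 unfolding M_def by (metis One_nat_def Suc_leI mult_pos_pos of_nat_1 of_nat_le_iff zero_less_one le_zero_eq not_gr_zero)
  have g: "(1 - \<rho>) \<le> real b powr - \<gamma>"
  proof -
    have "\<gamma> * ln (real b) \<le> - ln (1 - \<rho>)" using lnb by (simp add: \<gamma>_def b_def min_def field_simps)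
    then have "exp (ln (1 - \<rho>)) \<le> exp (- \<gamma> * ln (real b))" by simp
    then show ?thesis using \<rho> b by (simp add: powr_def)
  qed
  have fac: "1 \<le> 1 / (1 - \<rho>)" using \<rho> by simp
  show "D k \<le> D 0 / (1 - \<rho>) * (2 * real (j * n1)) powr \<gamma> * real (Suc k) powr - \<gamma>"
  proof (cases "M \<le> real k")
    case False
    have "D k \<le> D 0" by (rule mono) simp
    also have "\<dots> \<le> D 0 / (1 - \<rho>) * 1" using mult_left_mono[OF fac nonneg[of 0]] by simp
    also have "\<dots> \<le> D 0 / (1 - \<rho>) * ((2 * M) powr \<gamma> * real (Suc k) powr - \<gamma>)"
    proof (intro mult_left_mono)
      have "real (Suc k) powr \<gamma> \<le> (2 * M) powr \<gamma>" using False M \<gamma> by (intro powr_mono2) auto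
      then show "1 \<le> (2 * M) powr \<gamma> * real (Suc k) powr - \<gamma>"
        by (simp add: powr_minus field_simps)
    qed (use nonneg[of 0] \<rho> in auto)
    finally show ?thesis by (simp add: M_def mult.assoc)
  next
    case True
    \<comment> \<open>The number of complete blocks below \<open>k\<close>. The factor 2 in
      \<open>2 * M\<close> pays for replacing \<open>k\<close> by \<open>Suc k\<close>.\<close>
    define q where "q = nat \<lfloor>log (real b) (real k / M)\<rfloor>"
    have x1: "1 \<le> real k / M" using True M by simp
    have q1: "real q \<le> log (real b) (real k / M)" "log (real b) (real k / M) < real q + 1"
      using x1 b unfolding q_def by (auto simp: zero_le_log_cancel_iff)
    have l: "real b ^ q \<le> real k / M"
    proof -
      have "real b powr real q \<le> real b powr log (real b) (real k / M)"
        using q1 b by (intro powr_mono) auto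
      also have "\<dots> = real k / M" using x1 b by (intro powr_log_cancel) auto
      finally show ?thesis using b by (simp add: powr_realpow)
    qed
    have u: "real k / M \<le> real b ^ Suc q"
    proof -
      have "real k / M = real b powr log (real b) (real k / M)" using x1 b by (intro powr_log_cancel[symmetric]) auto
      also have "\<dots> \<le> real b powr real (Suc q)" using q1 b by (intro powr_mono) auto
      also have "\<dots> = real b ^ Suc q" using b by (subst powr_realpow) auto
      finally show ?thesis .
    qed
    have "real (j * (n1 * b ^ q)) \<le> real k" using l M by (simp add: M_def field_simps)
    then have "D k \<le> D (j * (n1 * b ^ q))" by (intro mono) linarith
    also have "\<dots> \<le> (1 - \<rho>) ^ q * D 0" by (rule pow)
    also have "\<dots> = D 0 / (1 - \<rho>) * (1 - \<rho>) ^ Suc q" using \<rho> by simp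
    also have "\<dots> \<le> D 0 / (1 - \<rho>) * ((2 * M) powr \<gamma> * real (Suc k) powr - \<gamma>)"
    proof (intro mult_left_mono)
      have "(1 - \<rho>) ^ Suc q \<le> (real b powr - \<gamma>) ^ Suc q" using \<rho> by (intro power_mono g) auto
      also have "\<dots> = (real b ^ Suc q) powr - \<gamma>"
        using b by (simp add: powr_power powr_realpow[symmetric] powr_powr mult.commute del: power_Suc)
      also have "\<dots> \<le> (real (Suc k) / (2 * M)) powr - \<gamma>"
      proof (intro powr_mono2')
        have "real (Suc k) / (2 * M) \<le> real k / M" using M True by (simp add: field_simps)
        then show "real (Suc k) / (2 * M) \<le> real b ^ Suc q" using u by linarith
      qed (use \<gamma> M in auto)
      also have "\<dots> = (2 * M) powr \<gamma> * real (Suc k) powr - \<gamma>"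
        using M by (simp add: powr_divide powr_minus field_simps)
      finally show "(1 - \<rho>) ^ Suc q \<le> (2 * M) powr \<gamma> * real (Suc k) powr - \<gamma>" .
    qed (use nonneg[of 0] \<rho> in auto)
    finally show ?thesis by (simp add: M_def mult.assoc)
  qed
qed

section \<open>Decay of twisted sums over iterated letters\<close>

locale expanding_substitution =
  fixes \<zeta> :: "'b::finite \<Rightarrow> 'b list" and s :: "'b \<Rightarrow> real" and \<theta> :: real
  assumes s_pos: "0 < s b" and theta_gt_1: "1 < \<theta>"
    and sum_subst: "sum_list (map s (\<zeta> b)) = \<theta> * s b"
begin

definition len :: "'b list \<Rightarrow> real" where "len w = sum_list (map s w)"

definition smin :: real where "smin = Min (range s)"

definition smax :: real where "smax = Max (range s)"

abbreviation iter :: "nat \<Rightarrow> 'b list \<Rightarrow> 'b list" where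
  "iter k \<equiv> subst_word \<zeta> ^^ k"

lemma smin_pos: "0 < smin"
  unfolding smin_def using s_pos by (subst Min_gr_iff) auto

lemma smin_le: "smin \<le> s b"
  unfolding smin_def by (intro Min_le) auto

lemma smax_ge: "s b \<le> smax"
  unfolding smax_def by (intro Max_ge) auto

lemma smax_pos: "0 < smax"
  using s_pos smax_ge by (rule order.strict_trans2)

lemma len_Nil [simp]: "len [] = 0" and len_Cons [simp]: "len (b # w) = s b + len w"
  and len_append [simp]: "len (u @ v) = len u + len v"
  by (simp_all add: len_def)

lemma len_nonneg: "0 \<le> len w"
  by (induction w) (auto intro: add_nonneg_nonneg less_imp_le[OF s_pos])

lemma len_ge_length: "smin * real (length w) \<le> len w"
  by (induction w) (auto simp: algebra_simps intro: add_mono smin_le)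

lemma len_le_length: "len w \<le> smax * real (length w)"
  by (induction w) (auto simp: algebra_simps intro: add_mono smax_ge)

lemma len_subst: "len (subst_word \<zeta> w) = \<theta> * len w"
  by (induction w) (auto simp: subst_word_Cons algebra_simps sum_subst len_def[of "\<zeta> _"])

lemma len_iter: "len (iter k w) = \<theta> ^ k * len w"
  by (induction k) (auto simp: len_subst)

lemma iter_Suc_single: "iter (Suc k) [b] = iter k (\<zeta> b)"
  by (simp add: funpow_Suc_right subst_word_def del: funpow.simps)

text \<open>Twisted sums are measured against the length \<open>\<theta> ^ k * s b\<close> of the
  word. In this normalization the triangle inequality makes the quantity nonincreasing in
  \<open>k\<close>, and cancellation shows as a factor below 1.\<close>

definition D :: "real \<Rightarrow> 'b \<Rightarrow> nat \<Rightarrow> real" where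
  "D \<omega> a k = Max (range (\<lambda>b. cmod (twisted_sum s \<omega> a (iter k [b])) / (\<theta> ^ k * s b)))"

lemma cmod_twisted_single: "cmod (twisted_sum s \<omega> a (iter k [b])) \<le> D \<omega> a k * \<theta> ^ k * s b"
proof -
  have "cmod (twisted_sum s \<omega> a (iter k [b])) / (\<theta> ^ k * s b) \<le> D \<omega> a k"
    unfolding D_def by (intro Max_ge) auto
  moreover have "0 < \<theta> ^ k * s b" using theta_gt_1 s_pos by simp
  ultimately show ?thesis by (simp add: pos_divide_le_eq mult.assoc)
qed

lemma D_nonneg: "0 \<le> D \<omega> a k"
proof -
  have "0 \<le> cmod (twisted_sum s \<omega> a (iter k [a])) / (\<theta> ^ k * s a)"
    using theta_gt_1 s_pos[of a] by simp
  also have "\<dots> \<le> D \<omega> a k" unfolding D_def by (intro Max_ge) auto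
  finally show ?thesis .
qed

lemma D_least:
  assumes "\<And>b. cmod (twisted_sum s \<omega> a (iter k [b])) \<le> M * \<theta> ^ k * s b"
  shows "D \<omega> a k \<le> M"
  unfolding D_def
proof (intro Max.boundedI)
  fix x assume "x \<in> range (\<lambda>b. cmod (twisted_sum s \<omega> a (iter k [b])) / (\<theta> ^ k * s b))"
  then obtain b where x: "x = cmod (twisted_sum s \<omega> a (iter k [b])) / (\<theta> ^ k * s b)" by blast
  have "0 < \<theta> ^ k * s b" using theta_gt_1 s_pos by simp
  then show "x \<le> M" unfolding x using assms[of b] by (simp add: pos_divide_le_eq mult.assoc)
qed auto

lemma cmod_twisted_iter: "cmod (twisted_sum s \<omega> a (iter k w)) \<le> D \<omega> a k * \<theta> ^ k * len w"
proof (induction w)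
  case (Cons b w)
  have "iter k (b # w) = iter k [b] @ iter k w" using subst_power_append[of k \<zeta> "[b]" w] by simp
  then have "cmod (twisted_sum s \<omega> a (iter k (b # w)))
     \<le> cmod (twisted_sum s \<omega> a (iter k [b])) + cmod (twisted_sum s \<omega> a (iter k w))"
    by (simp add: twisted_sum_append norm_mult order.trans[OF norm_triangle_ineq])
  then show ?case using Cons.IH cmod_twisted_single[of \<omega> a k b] by (simp add: distrib_left)
qed simp

lemma D_Suc: "D \<omega> a (Suc k) \<le> D \<omega> a k"
proof (rule D_least)
  fix b
  show "cmod (twisted_sum s \<omega> a (iter (Suc k) [b])) \<le> D \<omega> a k * \<theta> ^ Suc k * s b"
    unfolding iter_Suc_single
    using cmod_twisted_iter[of \<omega> a k "\<zeta> b"] by (simp add: len_def sum_subst mult_ac)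
qed

lemma D_0: "D \<omega> a 0 \<le> 1 / smin"
proof (rule D_least)
  fix b
  have "1 / smin * s b \<ge> 1" using smin_pos smin_le[of b] by simp
  then show "cmod (twisted_sum s \<omega> a (iter 0 [b])) \<le> 1 / smin * \<theta> ^ 0 * s b"
    by (simp add: order.trans[of _ 1])
qed

text \<open>The two occurrences of \<open>c\<close> contribute to the twisted sum of the level \<open>k\<close> with the relative
  phase \<open>\<omega> \<theta>\<^sup>k len (c # u)\<close>; cancellation occurs unless this is close to an integer.\<close>

lemma D_drop:
  assumes ret: "\<And>b. \<exists>p q. iter j [b] = p @ [c] @ u @ [c] @ q" and \<delta>: "0 \<le> \<delta>"
    and far: "\<delta> \<le> \<bar>\<omega> * len (c # u) * \<theta> ^ k - of_int (round (\<omega> * len (c # u) * \<theta> ^ k))\<bar>"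
  shows "D \<omega> a (k + j) \<le> (1 - 2 * (1 - cos (pi * \<delta>)) * smin / (\<theta> ^ j * smax)) * D \<omega> a k"
proof (rule D_least)
  fix b
  let ?\<eta> = "2 * (1 - cos (pi * \<delta>))" and ?tw = "twisted_sum s \<omega> a"
  let ?M = "D \<omega> a k * \<theta> ^ k"
  obtain p q where pq: "iter j [b] = p @ [c] @ u @ [c] @ q" using ret by blast
  define X where "X = - \<omega> * (\<theta> ^ k * len (c # u))"
  define mid where "mid = iter k [c] @ iter k u @ iter k [c]"
  have it: "iter (k + j) [b] = iter k p @ mid @ iter k q"
    by (simp only: funpow_add comp_apply pq subst_power_append mid_def append_assoc)
  have M0: "0 \<le> ?M" using D_nonneg[of \<omega> a k] theta_gt_1 by simp
  have pair: "cmod (?tw (iter k [c] @ iter k u @ iter k [c])) \<le> ?M * len u + (2 - ?\<eta>) * (?M * s c)"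
  proof -
    have "?tw (iter k [c] @ iter k u @ iter k [c]) =
        (1 + e X) * ?tw (iter k [c]) + e (- \<omega> * len (iter k [c])) * ?tw (iter k u)"
    proof -
      have "e X = e (- \<omega> * len (iter k [c])) * e (- \<omega> * len (iter k u))"
        unfolding e_add[symmetric] by (simp add: X_def len_iter algebra_simps)
      then show ?thesis
        by (simp only: twisted_sum_append len_def[symmetric]) (simp add: algebra_simps)
    qed
    then have "cmod (?tw (iter k [c] @ iter k u @ iter k [c])) \<le>
        cmod (1 + e X) * cmod (?tw (iter k [c])) + cmod (?tw (iter k u))"
      by (simp add: norm_mult order.trans[OF norm_triangle_ineq])
    moreover have "cmod (1 + e X) \<le> 2 - ?\<eta>"
    proof -
      have "cmod (1 + e X) = cmod (1 + e (\<omega> * len (c # u) * \<theta> ^ k))"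
        unfolding cmod_one_plus_e by (simp add: X_def mult_ac)
      also have "\<dots> \<le> 2 * cos (pi * \<delta>)" by (rule cmod_one_plus_e_le[OF \<delta> far])
      finally show ?thesis by simp
    qed
    moreover have "cmod (?tw (iter k [c])) \<le> ?M * s c" by (rule cmod_twisted_single)
    moreover have "cmod (?tw (iter k u)) \<le> ?M * len u" by (rule cmod_twisted_iter)
    moreover have "cmod (1 + e X) * cmod (?tw (iter k [c])) \<le> (2 - ?\<eta>) * (?M * s c)"
      by (rule mult_mono[OF calculation(2,3) order.trans[OF norm_ge_zero calculation(2)] norm_ge_zero])
    ultimately show ?thesis by linarith
  qed
  have "cmod (?tw (iter (k + j) [b])) \<le> cmod (?tw (iter k p)) + cmod (?tw mid) + cmod (?tw (iter k q))"
  proof -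
    have "cmod (?tw (v @ w)) \<le> cmod (?tw v) + cmod (?tw w)" for v w
      unfolding twisted_sum_append by (rule order.trans[OF norm_triangle_ineq]) (simp add: norm_mult)
    from this[of "iter k p" "mid @ iter k q"] this[of mid "iter k q"] show ?thesis
      unfolding it by linarith
  qed
  also have "\<dots> \<le> ?M * len p + (?M * len u + (2 - ?\<eta>) * (?M * s c)) + ?M * len q"
    unfolding mid_def by (intro add_mono pair cmod_twisted_iter)
  also have "\<dots> = ?M * (len (iter j [b]) - ?\<eta> * s c)"
    unfolding pq by (simp add: algebra_simps)
  also have "\<dots> \<le> ?M * ((1 - ?\<eta> * smin / (\<theta> ^ j * smax)) * (\<theta> ^ j * s b))"
  proof (intro mult_left_mono M0)
    \<comment> \<open>The gain is made on one letter \<open>c\<close> inside a word of length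
      \<open>\<theta> ^ j * s b\<close>; the worst ratio is the one for \<open>s c = smin\<close>
      and \<open>s b = smax\<close>.\<close>
    have "?\<eta> * smin / (\<theta> ^ j * smax) * (\<theta> ^ j * s b) = ?\<eta> * smin * (s b / smax)"
      using theta_gt_1 by simp
    also have "\<dots> \<le> ?\<eta> * smin * 1"
      using smax_ge[of b] smax_pos smin_pos by (intro mult_left_mono) auto
    also have "\<dots> \<le> ?\<eta> * s c" using smin_le[of c] by (simp add: mult_left_mono)
    finally show "len (iter j [b]) - ?\<eta> * s c \<le> (1 - ?\<eta> * smin / (\<theta> ^ j * smax)) * (\<theta> ^ j * s b)"
      by (simp add: len_iter left_diff_distrib)
  qed
  finally show "cmod (?tw (iter (k + j) [b])) \<le>
     (1 - ?\<eta> * smin / (\<theta> ^ j * smax)) * D \<omega> a k * \<theta> ^ (k + j) * s b"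
    by (simp add: power_add mult_ac)
qed

section \<open>Cutting words along substituted letters\<close>

lemma prefix_subst_word:
  assumes "prefix w (subst_word \<zeta> v)"
  shows "\<exists>v' y. w = subst_word \<zeta> v' @ y \<and> prefix v' v \<and> len y \<le> \<theta> * smax"
  using assms
proof (induction v arbitrary: w)
  case Nil
  then show ?case using theta_gt_1 smax_pos by (intro exI[of _ "[]"]) simp
next
  case (Cons b v)
  from Cons.prems have "prefix w (\<zeta> b @ subst_word \<zeta> v)" by (simp add: subst_word_Cons)
  then consider "prefix w (\<zeta> b)" | w' where "w = \<zeta> b @ w'" "prefix w' (subst_word \<zeta> v)"
    by (auto simp: prefix_append)
  then show ?case
  proof cases
    case 1
    then obtain z where "\<zeta> b = w @ z" by (auto simp: prefix_def)
    then have "len w \<le> len (\<zeta> b)" using len_nonneg[of z] by simp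
    also have "\<dots> \<le> \<theta> * smax" using sum_subst[of b] smax_ge[of b] theta_gt_1 by (simp add: len_def)
    finally show ?thesis by (intro exI[of _ "[]"] exI[of _ w]) simp
  next
    case 2
    from Cons.IH[OF 2(2)] obtain v' y where "w' = subst_word \<zeta> v' @ y" "prefix v' v" "len y \<le> \<theta> * smax" by blast
    with 2(1) show ?thesis by (intro exI[of _ "b # v'"] exI[of _ y]) (simp add: subst_word_Cons)
  qed
qed

text \<open>A factor of a substituted word consists of a suffix of one image, complete images of
  letters, and a prefix of another image; the incomplete ends are no longer than one image. A factor
  inside a single image counts as an end altogether.\<close>

lemma sublist_subst_word:
  assumes "sublist w (subst_word \<zeta> v)"
  shows "\<exists>x v' y. w = x @ subst_word \<zeta> v' @ y \<and> sublist v' v \<and> len x \<le> \<theta> * smax \<and> len y \<le> \<theta> * smax"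
  using assms
proof (induction v)
  case Nil
  then show ?case using theta_gt_1 smax_pos by (intro exI[of _ "[]"]) simp
next
  case (Cons b v)
  have lz: "len (\<zeta> b) \<le> \<theta> * smax" using sum_subst[of b] smax_ge[of b] theta_gt_1 by (simp add: len_def)
  from Cons.prems have "sublist w (\<zeta> b @ subst_word \<zeta> v)" by (simp add: subst_word_Cons)
  then consider "sublist w (\<zeta> b)" | "sublist w (subst_word \<zeta> v)"
    | w1 w2 where "w = w1 @ w2" "suffix w1 (\<zeta> b)" "prefix w2 (subst_word \<zeta> v)"
    unfolding sublist_append by blast
  then show ?case
  proof cases
    case 1
    then obtain p q where "\<zeta> b = p @ w @ q" by (auto simp: sublist_def)
    then have "len w \<le> len (\<zeta> b)" using len_nonneg[of p] len_nonneg[of q] by simp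
    with lz show ?thesis using theta_gt_1 smax_pos
      by (intro exI[of _ w] exI[of _ "[]"]) simp
  next
    case 2
    from Cons.IH[OF this] obtain x v' y where "w = x @ subst_word \<zeta> v' @ y" "sublist v' v"
      "len x \<le> \<theta> * smax" "len y \<le> \<theta> * smax" by blast
    then show ?thesis by (intro exI[of _ x] exI[of _ v'] exI[of _ y]) (auto simp: sublist_Cons_right)
  next
    case 3
    from prefix_subst_word[OF 3(3)] obtain v' y where v': "w2 = subst_word \<zeta> v' @ y" "prefix v' v"
      "len y \<le> \<theta> * smax" by blast
    from 3(2) obtain p where "\<zeta> b = p @ w1" by (auto simp: suffix_def)
    then have "len w1 \<le> len (\<zeta> b)" using len_nonneg[of p] by simp
    with lz v' 3(1) show ?thesis
      by (intro exI[of _ w1] exI[of _ v'] exI[of _ y]) (auto simp: sublist_Cons_right)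
  qed
qed

text \<open>Each descent by one level cuts off two ends of bounded length, whose twisted sums after
  \<open>k + i\<close> substitutions are controlled by \<open>D\<close>. The length of
  \<open>w\<close>, and not the level \<open>n\<close> of the word around it, limits the descent: at
  \<open>T = 0\<close> the word is shorter than any letter, so it is empty. The shift
  \<open>k\<close> serves the induction, since the core of \<open>w\<close> is treated one level
  higher.\<close>

lemma cmod_twisted_sublist:
  assumes "sublist w (iter n [b])" "len w < smin * \<theta> ^ T"
  shows "cmod (twisted_sum s \<omega> a (iter k w)) \<le> 2 * \<theta> * smax * (\<Sum>i<T. \<theta> ^ (k + i) * D \<omega> a (k + i))"
  using assms
proof (induction n arbitrary: w T k)
  case 0
  have A: "0 \<le> (\<Sum>i<T. \<theta> ^ (k + i) * D \<omega> a (k + i))" for T k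
    using D_nonneg theta_gt_1 by (intro sum_nonneg) auto
  from 0 consider "w = []" | "w = [b]" by (auto simp: sublist_Cons_right prefix_Cons)
  then show ?case
  proof cases
    case 2
    have "T \<noteq> 0" using 0(2) 2 smin_le[of b] by (cases T) auto
    then obtain T' where T': "T = Suc T'" by (cases T) auto
    have "cmod (twisted_sum s \<omega> a (iter k w)) \<le> D \<omega> a k * \<theta> ^ k * s b"
      unfolding 2 by (rule cmod_twisted_single)
    also have "\<dots> \<le> (\<theta> ^ k * D \<omega> a k) * (2 * \<theta> * smax)"
    proof -
      have "s b \<le> 2 * \<theta> * smax"
        using smax_ge[of b] smax_pos theta_gt_1 mult_right_mono[of 1 "2 * \<theta>" smax] by linarith
      then show ?thesis unfolding mult.commute[of "\<theta> ^ k" "D \<omega> a k"]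
        by (rule mult_left_mono) (use D_nonneg[of \<omega> a k] theta_gt_1 in auto)
    qed
    also have "\<dots> \<le> (\<Sum>i<T. \<theta> ^ (k + i) * D \<omega> a (k + i)) * (2 * \<theta> * smax)"
    proof (intro mult_right_mono)
      have "0 \<le> (\<Sum>i<T'. \<theta> ^ (k + Suc i) * D \<omega> a (k + Suc i))"
        using D_nonneg theta_gt_1 by (intro sum_nonneg) auto
      then show "\<theta> ^ k * D \<omega> a k \<le> (\<Sum>i<T. \<theta> ^ (k + i) * D \<omega> a (k + i))"
        unfolding T' sum.lessThan_Suc_shift by simp
    qed (use theta_gt_1 smax_pos in auto)
    finally show ?thesis by (simp add: mult.commute)
  qed (use A theta_gt_1 smax_pos in simp)
next
  case (Suc n)
  show ?case
  proof (cases T)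
    case 0
    have "w = []"
    proof (rule ccontr)
      assume "w \<noteq> []"
      then have "1 \<le> real (length w)" by (cases w) auto
      then have "smin * 1 \<le> len w" using len_ge_length[of w] smin_pos
        by (meson less_imp_le mult_left_mono order.trans)
      then show False using Suc.prems(2) 0 by simp
    qed
    then show ?thesis using 0 by simp
  next
    case (Suc T')
    from \<open>sublist w (iter (Suc n) [b])\<close> have "sublist w (subst_word \<zeta> (iter n [b]))" by simp
    from sublist_subst_word[OF this] obtain x v y where xvy: "w = x @ subst_word \<zeta> v @ y"
      "sublist v (iter n [b])" "len x \<le> \<theta> * smax" "len y \<le> \<theta> * smax" by blast
    have "\<theta> * len v \<le> len w" unfolding xvy using len_nonneg[of x] len_nonneg[of y] by (simp add: len_subst)
    also have "\<dots> < \<theta> * (smin * \<theta> ^ T')" using Suc.prems(2) Suc by (simp add: mult_ac)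
    finally have lv: "len v < smin * \<theta> ^ T'" using theta_gt_1 by simp
    let ?S = "\<Sum>i<T'. \<theta> ^ (Suc k + i) * D \<omega> a (Suc k + i)"
    have IH: "cmod (twisted_sum s \<omega> a (iter (Suc k) v)) \<le> 2 * \<theta> * smax * ?S"
      by (rule Suc.IH[OF xvy(2) lv])
    have sm: "iter k (subst_word \<zeta> v) = iter (Suc k) v" by (simp add: funpow_swap1)
    have "cmod (twisted_sum s \<omega> a (iter k w)) \<le> cmod (twisted_sum s \<omega> a (iter k x)) +
       (cmod (twisted_sum s \<omega> a (iter (Suc k) v)) + cmod (twisted_sum s \<omega> a (iter k y)))"
      unfolding xvy(1) subst_power_append sm twisted_sum_append
      by (intro order.trans[OF norm_triangle_ineq] add_mono) (auto simp: norm_mult intro: order.trans[OF norm_triangle_ineq])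
    also have "\<dots> \<le> D \<omega> a k * \<theta> ^ k * (\<theta> * smax) + (2 * \<theta> * smax * ?S + D \<omega> a k * \<theta> ^ k * (\<theta> * smax))"
    proof (intro add_mono IH)
      have "0 \<le> D \<omega> a k * \<theta> ^ k" using D_nonneg[of \<omega> a k] theta_gt_1 by simp
      then show "cmod (twisted_sum s \<omega> a (iter k x)) \<le> D \<omega> a k * \<theta> ^ k * (\<theta> * smax)"
        and "cmod (twisted_sum s \<omega> a (iter k y)) \<le> D \<omega> a k * \<theta> ^ k * (\<theta> * smax)"
        using xvy(3,4) by (auto intro: order.trans[OF cmod_twisted_iter] mult_left_mono)
    qed
    also have "\<dots> = 2 * \<theta> * smax * (\<theta> ^ k * D \<omega> a k + ?S)" by (simp add: algebra_simps)
    also have "\<theta> ^ k * D \<omega> a k + ?S = (\<Sum>i<T. \<theta> ^ (k + i) * D \<omega> a (k + i))"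
      unfolding Suc sum.lessThan_Suc_shift by simp
    finally show ?thesis .
  qed
qed

text \<open>Some iterate of a letter \<open>a\<close> has more letters than the alphabet, so a
  letter repeats in it; \<open>n0\<close> iterations before that place \<open>a\<close> into the
  image of every letter. \<open>n\<close> is adjusted to make the total even, for use with an
  eigenvalue of unknown sign.\<close>

lemma return_word:
  assumes prim: "\<And>a b. a \<in> set (iter n0 [b])"
  shows "\<exists>j c u. even j \<and> 1 \<le> j \<and> (\<forall>b. \<exists>p q. iter j [b] = p @ [c] @ u @ [c] @ q)"
proof -
  obtain a :: 'b where True by blast
  obtain n1 where n1: "real CARD('b) * smax / s a < \<theta> ^ n1"
    using real_arch_pow[OF theta_gt_1] by blast
  define n where "n = 2 * (n1 + n0 + 1) - n0"
  have n: "n1 \<le> n" "n + n0 = 2 * (n1 + n0 + 1)" by (auto simp: n_def)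
  have "real CARD('b) * smax / s a < \<theta> ^ n"
    using n1 power_increasing[OF n(1), of \<theta>] theta_gt_1 by linarith
  then have "real CARD('b) * smax < len (iter n [a])"
    using s_pos[of a] by (simp add: len_iter pos_divide_less_eq)
  also have "\<dots> \<le> smax * real (length (iter n [a]))" by (rule len_le_length)
  finally have "CARD('b) < length (iter n [a])" using smax_pos by (simp add: mult.commute)
  then have "\<not> distinct (iter n [a])"
    by (metis card_mono distinct_card finite_class.finite_UNIV not_less subset_UNIV)
  then obtain xs ys zs c where dec: "iter n [a] = xs @ [c] @ ys @ [c] @ zs"
    using not_distinct_decomp by blast
  show ?thesis
  proof (rule exI[of _ "n + n0"], rule exI[of _ c], rule exI[of _ ys], intro conjI allI)
    fix b
    obtain p q where pq: "iter n0 [b] = p @ [a] @ q"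
      using prim[of a b] unfolding in_set_conv_decomp by auto
    have "iter (n + n0) [b] = iter n p @ iter n [a] @ iter n q"
      by (simp only: funpow_add comp_apply pq subst_power_append)
    then have "iter (n + n0) [b] = (iter n p @ xs) @ [c] @ ys @ [c] @ (zs @ iter n q)"
      by (simp add: dec)
    then show "\<exists>p q. iter (n + n0) [b] = p @ [c] @ ys @ [c] @ q" by blast
  qed (simp_all add: n)
qed

theorem twisted_sum_log_saving:
  assumes prim: "\<And>a b. a \<in> set (iter n0 [b])"
    and window: "\<And>j. even j \<Longrightarrow> 1 \<le> j \<Longrightarrow> escapes_integers (\<theta> ^ j)"
  shows "\<exists>\<gamma>>0. \<gamma> \<le> 1 \<and> (\<forall>B>1. \<exists>C>0. \<forall>\<omega> a w n b T. 1 / B \<le> \<bar>\<omega>\<bar> \<and> \<bar>\<omega>\<bar> \<le> B \<and> 1 \<le> T \<and>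
     sublist w (iter n [b]) \<and> len w < smin * \<theta> ^ T \<longrightarrow>
     cmod (twisted_sum s \<omega> a w) \<le> C * \<theta> ^ T * real T powr - \<gamma>)"
proof -
  obtain j c u where j: "even j" "1 \<le> j" and ret: "\<And>b. \<exists>p q. iter j [b] = p @ [c] @ u @ [c] @ q"
    using return_word[OF prim] by blast
  obtain \<delta>' L where \<delta>': "\<delta>' > 0" and win: "\<And>B. B > 1 \<Longrightarrow> \<exists>n1\<ge>1. \<forall>\<xi> N0. 1 / B \<le> \<bar>\<xi>\<bar> \<and> \<bar>\<xi>\<bar> \<le> B \<and> n1 \<le> N0 \<longrightarrow>
       (\<exists>n. N0 \<le> n \<and> n \<le> L * N0 \<and> \<delta>' \<le> \<bar>\<xi> * (\<theta> ^ j) ^ n - of_int (round (\<xi> * (\<theta> ^ j) ^ n))\<bar>)"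
    using window[OF j] unfolding escapes_integers_def by blast
  \<comment> \<open>The cap keeps \<open>pi * \<delta>\<close> in the range where the cosine
    decreases. Likewise, the cap on \<open>\<rho>\<close> below keeps \<open>1 - \<rho>\<close>
    positive, as its logarithm enters the exponent.\<close>
  define \<delta> where "\<delta> = min \<delta>' (1 / 2)"
  have \<delta>: "0 < \<delta>" "\<delta> \<le> 1 / 2" "\<delta> \<le> \<delta>'" using \<delta>' by (auto simp: \<delta>_def)
  have cos1: "cos (pi * \<delta>) < 1"
    using cos_monotone_0_pi[of 0 "pi * \<delta>"] \<delta> by simp
  define \<rho>' where "\<rho>' = 2 * (1 - cos (pi * \<delta>)) * smin / (\<theta> ^ j * smax)"
  define \<rho> where "\<rho> = min \<rho>' (1 / 2)"
  have "\<rho>' > 0" unfolding \<rho>'_def using cos1 smin_pos smax_pos theta_gt_1 by simp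
  then have \<rho>: "0 < \<rho>" "\<rho> < 1" "\<rho> \<le> \<rho>'" by (auto simp: \<rho>_def)
  define \<gamma> where "\<gamma> = min 1 (- ln (1 - \<rho>) / ln (real (L + 2)))"
  define l0 where "l0 = len (c # u)"
  have l0: "l0 > 0" unfolding l0_def using s_pos[of c] len_nonneg[of u] by simp
  have \<gamma>0: "0 < \<gamma>"
  proof -
    have "0 < ln (real (L + 2))" "ln (1 - \<rho>) < 0" using \<rho> by simp_all
    then have "ln (1 - \<rho>) / ln (real (L + 2)) < 0" by (intro divide_neg_pos)
    then show ?thesis by (simp add: \<gamma>_def)
  qed
  show ?thesis
  proof (rule exI[of _ \<gamma>], intro conjI allI impI, rule \<gamma>0)
    show "\<gamma> \<le> 1" by (simp add: \<gamma>_def)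
    fix B :: real assume B: "B > 1"
    \<comment> \<open>The phases of \<open>D_drop\<close> are governed by
      \<open>\<xi> = \<omega> * l0\<close>, whose modulus lies between \<open>1 / B'\<close> and
      \<open>B'\<close>.\<close>
    define B' where "B' = B * max l0 (1 / l0)"
    have mx: "l0 \<le> max l0 (1 / l0)" "1 / l0 \<le> max l0 (1 / l0)" "1 \<le> max l0 (1 / l0)"
      using l0 by (auto simp: le_max_iff_disj)
    have B'1: "B' > 1" using B mx(3) mult_left_mono[OF mx(3), of B] unfolding B'_def by linarith
    obtain n1 where n1: "n1 \<ge> 1" and far: "\<And>\<xi> N0. 1 / B' \<le> \<bar>\<xi>\<bar> \<Longrightarrow> \<bar>\<xi>\<bar> \<le> B' \<Longrightarrow> n1 \<le> N0 \<Longrightarrow>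
       (\<exists>n. N0 \<le> n \<and> n \<le> L * N0 \<and> \<delta>' \<le> \<bar>\<xi> * (\<theta> ^ j) ^ n - of_int (round (\<xi> * (\<theta> ^ j) ^ n))\<bar>)"
      using win[OF B'1] by blast
    \<comment> \<open>\<open>1 / smin\<close> bounds \<open>D\<close> at level 0; \<open>B\<close>
      enters \<open>C1\<close> only through \<open>n1\<close>.\<close>
    define C1 where "C1 = 1 / smin / (1 - \<rho>) * (2 * real (j * n1)) powr \<gamma>"
    have C1: "C1 > 0" unfolding C1_def using smin_pos \<rho> j n1 by simp
    define C where "C = 2 * \<theta> * smax * C1 / (sqrt \<theta> - 1)\<^sup>2"
    have C: "C > 0" unfolding C_def using C1 smax_pos theta_gt_1 by simp
    show "\<exists>C>0. \<forall>\<omega> a w n b T. 1 / B \<le> \<bar>\<omega>\<bar> \<and> \<bar>\<omega>\<bar> \<le> B \<and> 1 \<le> T \<and>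
     sublist w (iter n [b]) \<and> len w < smin * \<theta> ^ T \<longrightarrow>
     cmod (twisted_sum s \<omega> a w) \<le> C * \<theta> ^ T * real T powr - \<gamma>"
    proof (rule exI[of _ C], intro conjI allI impI, rule C)
      fix \<omega> a w n b T
      assume h: "1 / B \<le> \<bar>\<omega>\<bar> \<and> \<bar>\<omega>\<bar> \<le> B \<and> 1 \<le> T \<and>
         sublist w (iter n [b]) \<and> len w < smin * \<theta> ^ T"
      define \<xi> where "\<xi> = \<omega> * l0"
      have \<xi>1: "\<bar>\<xi>\<bar> \<le> B'"
      proof -
        have "\<bar>\<omega>\<bar> * l0 \<le> B * max l0 (1 / l0)" using h B l0 mx by (intro mult_mono) auto
        then show ?thesis using l0 by (simp add: \<xi>_def B'_def abs_mult)
      qed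
      have \<xi>2: "1 / B' \<le> \<bar>\<xi>\<bar>"
      proof -
        have "1 / B' = 1 / B * (1 / max l0 (1 / l0))" by (simp add: B'_def)
        also have "\<dots> \<le> \<bar>\<omega>\<bar> * l0"
        proof (intro mult_mono)
          have "1 / max l0 (1 / l0) \<le> 1 / (1 / l0)" using mx l0 by (intro divide_left_mono) auto
          then show "1 / max l0 (1 / l0) \<le> l0" by simp
        qed (use h B l0 in auto)
        finally show ?thesis using l0 by (simp add: \<xi>_def abs_mult)
      qed
      have drop: "\<exists>n. N \<le> n \<and> n \<le> L * N \<and> D \<omega> a (j * n + j) \<le> (1 - \<rho>) * D \<omega> a (j * n)" if N: "n1 \<le> N" for N
      proof -
        obtain n where n: "N \<le> n" "n \<le> L * N" "\<delta>' \<le> \<bar>\<xi> * (\<theta> ^ j) ^ n - of_int (round (\<xi> * (\<theta> ^ j) ^ n))\<bar>"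
          using far[OF \<xi>2 \<xi>1 N] by blast
        have "D \<omega> a (j * n + j) \<le> (1 - \<rho>') * D \<omega> a (j * n)"
          unfolding \<rho>'_def
        proof (rule D_drop)
          show "\<exists>p q. iter j [b] = p @ [c] @ u @ [c] @ q" for b by (rule ret)
          show "0 \<le> \<delta>" using \<delta> by simp
          show "\<delta> \<le> \<bar>\<omega> * len (c # u) * \<theta> ^ (j * n) - of_int (round (\<omega> * len (c # u) * \<theta> ^ (j * n)))\<bar>"
            using n(3) \<delta>(3) unfolding \<xi>_def l0_def power_mult by linarith
        qed
        also have "\<dots> \<le> (1 - \<rho>) * D \<omega> a (j * n)" using \<rho> D_nonneg by (intro mult_right_mono) auto
        finally show ?thesis using n by blast
      qed
      have Dk: "D \<omega> a k \<le> C1 * real (Suc k) powr - \<gamma>" for k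
      proof -
        have "D \<omega> a k \<le> D \<omega> a 0 / (1 - \<rho>) * (2 * real (j * n1)) powr \<gamma> * real (Suc k) powr - \<gamma>"
          unfolding \<gamma>_def
          by (rule windowed_decay(2)[where L = L]) (use D_Suc D_nonneg \<rho> j n1 drop in auto)
        also have "\<dots> \<le> C1 * real (Suc k) powr - \<gamma>"
          unfolding C1_def using \<rho> D_0[of \<omega> a] by (intro mult_right_mono divide_right_mono) auto
        finally show ?thesis .
      qed
      have "cmod (twisted_sum s \<omega> a (iter 0 w)) \<le> 2 * \<theta> * smax * (\<Sum>i<T. \<theta> ^ (0 + i) * D \<omega> a (0 + i))"
        by (rule cmod_twisted_sublist) (use h in auto)
      also have "\<dots> \<le> 2 * \<theta> * smax * (\<Sum>i<T. \<theta> ^ i * (C1 * real (Suc i) powr - \<gamma>))"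
        using theta_gt_1 smax_pos by (intro mult_left_mono sum_mono) (use Dk in auto)
      also have "\<dots> = 2 * \<theta> * smax * C1 * (\<Sum>i<T. \<theta> ^ i * real (Suc i) powr - \<gamma>)"
        by (simp add: sum_distrib_left mult_ac)
      also have "\<dots> \<le> 2 * \<theta> * smax * C1 * (\<theta> ^ T / (sqrt \<theta> - 1)\<^sup>2 * real T powr - \<gamma>)"
        using theta_gt_1 smax_pos C1 \<gamma>0 h
        by (intro mult_left_mono sum_geometric_times_powr) (auto simp: \<gamma>_def)
      finally show "cmod (twisted_sum s \<omega> a w) \<le> C * \<theta> ^ T * real T powr - \<gamma>"
        by (simp add: C_def)
    qed
  qed
qed

end

section \<open>Measurability of translation flows\<close>

text \<open>Times are restricted to \<open>I\<close>, with one-sided conditions at its end points,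
  because a segment over a compact interval of times survives a small move of its starting point; a
  nearby leaf may still run into a singular point later.\<close>

definition leaf_segment ::
  "('a set \<times> ('a \<Rightarrow> complex)) set \<Rightarrow> complex \<Rightarrow> real set \<Rightarrow> (real \<Rightarrow> 'a) \<Rightarrow> bool" where
  "leaf_segment At v I c \<longleftrightarrow> (\<forall>t\<in>I. c t \<in> \<Union> (fst ` At) \<and> (\<forall>(U, z)\<in>At. c t \<in> U \<longrightarrow>
     (\<exists>d>0. \<forall>s\<in>I. \<bar>s - t\<bar> < d \<longrightarrow> c s \<in> U \<and> z (c s) = z (c t) + of_real (s - t) * v)))"

lemma leaf_line_iff_segment: "leaf_line At v c \<longleftrightarrow> leaf_segment At v UNIV c"
  unfolding leaf_line_def leaf_segment_def eventually_nhds_metric dist_real_def image_subset_iff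
    ball_UNIV all_conj_distrib by simp

lemma leaf_segment_in:
  assumes "leaf_segment At v I c" "t \<in> I"
  shows "\<exists>(U, z)\<in>At. c t \<in> U"
proof -
  have "c t \<in> \<Union> (fst ` At)" using assms unfolding leaf_segment_def by blast
  then show ?thesis by force
qed

lemma leaf_segmentD:
  assumes "leaf_segment At v I c" "t \<in> I" "(U, z) \<in> At" "c t \<in> U"
  obtains d where "d > 0" "\<And>s. s \<in> I \<Longrightarrow> \<bar>s - t\<bar> < d \<Longrightarrow> c s \<in> U"
    "\<And>s. s \<in> I \<Longrightarrow> \<bar>s - t\<bar> < d \<Longrightarrow> z (c s) = z (c t) + of_real (s - t) * v"
proof -
  have "\<forall>(U, z)\<in>At. c t \<in> U \<longrightarrow>
     (\<exists>d>0. \<forall>s\<in>I. \<bar>s - t\<bar> < d \<longrightarrow> c s \<in> U \<and> z (c s) = z (c t) + of_real (s - t) * v)"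
    using assms(1,2) unfolding leaf_segment_def by blast
  then have "\<exists>d>0. \<forall>s\<in>I. \<bar>s - t\<bar> < d \<longrightarrow> c s \<in> U \<and> z (c s) = z (c t) + of_real (s - t) * v"
    using assms(3,4) by fast
  then show ?thesis using that by blast
qed

lemma leaf_segmentI:
  assumes "\<And>t. t \<in> I \<Longrightarrow> c t \<in> \<Union> (fst ` At)"
    and "\<And>t U z. t \<in> I \<Longrightarrow> (U, z) \<in> At \<Longrightarrow> c t \<in> U \<Longrightarrow>
      \<exists>d>0. \<forall>s\<in>I. \<bar>s - t\<bar> < d \<longrightarrow> c s \<in> U \<and> z (c s) = z (c t) + of_real (s - t) * v"
  shows "leaf_segment At v I c"
  unfolding leaf_segment_def using assms by blast

lemma leaf_segment_cong:
  assumes "leaf_segment At v I c" "\<And>t. t \<in> I \<Longrightarrow> c' t = c t"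
  shows "leaf_segment At v I c'"
  using assms unfolding leaf_segment_def by simp

lemma leaf_segment_subset:
  assumes "leaf_segment At v J c" "I \<subseteq> J"
  shows "leaf_segment At v I c"
proof (rule leaf_segmentI)
  fix t assume t: "t \<in> I"
  then show "c t \<in> \<Union> (fst ` At)" using assms by (auto simp: leaf_segment_def)
  fix U z assume "(U, z) \<in> At" "c t \<in> U"
  then show "\<exists>d>0. \<forall>s\<in>I. \<bar>s - t\<bar> < d \<longrightarrow> c s \<in> U \<and> z (c s) = z (c t) + of_real (s - t) * v"
    using leaf_segmentD[OF assms(1), of t U z] t assms(2) by (metis subsetD)
qed

text \<open>Closedness matters at a time in only one of the sets: the other set then avoids a
  neighbourhood of it.\<close>

lemma leaf_segment_Un:
  assumes c: "leaf_segment At v I c" "leaf_segment At v J c" and cl: "closed I" "closed J"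
  shows "leaf_segment At v (I \<union> J) c"
proof (rule leaf_segmentI)
  fix t assume t: "t \<in> I \<union> J"
  then show "c t \<in> \<Union> (fst ` At)" using c by (auto simp: leaf_segment_def)
  fix U z assume Uz: "(U, z) \<in> At" "c t \<in> U"
  have *: "\<exists>d>0. \<forall>s\<in>K. \<bar>s - t\<bar> < d \<longrightarrow> c s \<in> U \<and> z (c s) = z (c t) + of_real (s - t) * v"
    if K: "leaf_segment At v K c" "closed K" for K
  proof (cases "t \<in> K")
    case True
    then show ?thesis using leaf_segmentD[OF K(1) True Uz] by metis
  next
    case False
    then obtain d where "d > 0" "ball t d \<subseteq> - K" using K(2) open_contains_ball[of "- K"] by (auto simp: closed_def)
    then show ?thesis by (intro exI[of _ d]) (auto simp: dist_real_def abs_minus_commute subset_iff)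
  qed
  obtain d1 where d1: "d1 > 0" "\<And>s. s \<in> I \<Longrightarrow> \<bar>s - t\<bar> < d1 \<Longrightarrow> c s \<in> U \<and> z (c s) = z (c t) + of_real (s - t) * v"
    using *[OF c(1) cl(1)] by blast
  obtain d2 where d2: "d2 > 0" "\<And>s. s \<in> J \<Longrightarrow> \<bar>s - t\<bar> < d2 \<Longrightarrow> c s \<in> U \<and> z (c s) = z (c t) + of_real (s - t) * v"
    using *[OF c(2) cl(2)] by blast
  show "\<exists>d>0. \<forall>s\<in>I \<union> J. \<bar>s - t\<bar> < d \<longrightarrow> c s \<in> U \<and> z (c s) = z (c t) + of_real (s - t) * v"
    using d1 d2 by (intro exI[of _ "min d1 d2"]) auto
qed

lemma leaf_segment_shift:
  assumes "leaf_segment At v I c"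
  shows "leaf_segment At v ((\<lambda>t. t + a) ` I) (\<lambda>t. c (t - a))"
proof (rule leaf_segmentI)
  fix t assume t: "t \<in> (\<lambda>t. t + a) ` I"
  then have t': "t - a \<in> I" by auto
  then show "c (t - a) \<in> \<Union> (fst ` At)" using assms by (auto simp: leaf_segment_def)
  fix U z assume Uz: "(U, z) \<in> At" "c (t - a) \<in> U"
  obtain d where "d > 0" "\<And>s. s \<in> I \<Longrightarrow> \<bar>s - (t - a)\<bar> < d \<Longrightarrow> c s \<in> U"
    "\<And>s. s \<in> I \<Longrightarrow> \<bar>s - (t - a)\<bar> < d \<Longrightarrow> z (c s) = z (c (t - a)) + of_real (s - (t - a)) * v"
    using leaf_segmentD[OF assms t' Uz] by metis
  then show "\<exists>d>0. \<forall>s\<in>(\<lambda>t. t + a) ` I. \<bar>s - t\<bar> < d \<longrightarrow>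
      c (s - a) \<in> U \<and> z (c (s - a)) = z (c (t - a)) + of_real (s - t) * v"
    by (intro exI[of _ d]) (auto simp: algebra_simps)
qed

lemma leaf_segment_reflect:
  assumes "leaf_segment At v I c"
  shows "leaf_segment At (- v) (uminus ` I) (\<lambda>t. c (- t))"
proof (rule leaf_segmentI)
  fix t assume "t \<in> uminus ` I"
  then have t': "- t \<in> I" by auto
  then show "c (- t) \<in> \<Union> (fst ` At)" using assms by (auto simp: leaf_segment_def)
  fix U z assume Uz: "(U, z) \<in> At" "c (- t) \<in> U"
  obtain d where "d > 0" "\<And>s. s \<in> I \<Longrightarrow> \<bar>s - - t\<bar> < d \<Longrightarrow> c s \<in> U"
    "\<And>s. s \<in> I \<Longrightarrow> \<bar>s - - t\<bar> < d \<Longrightarrow> z (c s) = z (c (- t)) + of_real (s - - t) * v"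
    using leaf_segmentD[OF assms t' Uz] by metis
  then show "\<exists>d>0. \<forall>s\<in>uminus ` I. \<bar>s - t\<bar> < d \<longrightarrow>
      c (- s) \<in> U \<and> z (c (- s)) = z (c (- t)) + of_real (s - t) * - v"
    by (intro exI[of _ d]) (auto simp: algebra_simps)
qed

section \<open>Uniqueness and stability of leaf segments\<close>

locale foliated_space =
  fixes X :: "'a topology" and Sing :: "'a set" and At :: "('a set \<times> ('a \<Rightarrow> complex)) set"
  assumes hausdorff: "Hausdorff_space X"
    and foliations: "transverse_oriented_measured_foliations X Sing At"
begin

lemma charts: "\<forall>(U, z)\<in>At. openin X U \<and> open (z ` U) \<and> homeomorphic_map (subtopology X U) (top_of_set (z ` U)) z"
  using foliations unfolding transverse_oriented_measured_foliations_def by (elim conjE)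

lemma chart_changes: "\<forall>(U, z)\<in>At. \<forall>(V, w)\<in>At. \<forall>p\<in>U \<inter> V. \<exists>k. \<forall>\<^sub>F q in nhdsin X p. w q = z q + k"
  using foliations unfolding transverse_oriented_measured_foliations_def by (elim conjE)

lemma chart_open: "(U, z) \<in> At \<Longrightarrow> openin X U"
  and chart_image_open: "(U, z) \<in> At \<Longrightarrow> open (z ` U)"
  and chart_homeo: "(U, z) \<in> At \<Longrightarrow> homeomorphic_map (subtopology X U) (top_of_set (z ` U)) z"
  using charts by auto

lemma chart_change:
  "(U, z) \<in> At \<Longrightarrow> (V, w) \<in> At \<Longrightarrow> p \<in> U \<Longrightarrow> p \<in> V \<Longrightarrow> \<exists>k. \<forall>\<^sub>F q in nhdsin X p. w q = z q + k"
  using chart_changes by fast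

lemma chart_subset: "(U, z) \<in> At \<Longrightarrow> U \<subseteq> topspace X"
  using chart_open openin_subset by blast

lemma chart_inj:
  assumes "(U, z) \<in> At"
  shows "inj_on z U"
  using homeomorphic_imp_injective_map[OF chart_homeo[OF assms]] chart_subset[OF assms]
  by (simp add: Int_absorb1)

lemma chart_image_of_open:
  assumes "(U, z) \<in> At" "openin X W"
  shows "open (z ` (W \<inter> U))"
proof -
  have "openin (subtopology X U) (W \<inter> U)" using assms(2) by (rule openin_subtopology_Int)
  then have "openin (top_of_set (z ` U)) (z ` (W \<inter> U))"
    using homeomorphic_imp_open_map[OF chart_homeo[OF assms(1)]] by (simp add: open_map_def)
  then show ?thesis using chart_image_open[OF assms(1)] openin_open_trans by blast
qed

text \<open>Continuity for the topology of \<open>X\<close> comes from the affine form in the chart: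
  chart images of open sets are open, and injectivity of the chart brings the points back.\<close>

lemma chart_curve_stays:
  assumes Uz: "(U, z) \<in> At" and W: "openin X W" "c t \<in> W" "c t \<in> U"
    and d: "d > 0" "\<And>s. s \<in> I \<Longrightarrow> \<bar>s - t\<bar> < d \<Longrightarrow> c s \<in> U"
      "\<And>s. s \<in> I \<Longrightarrow> \<bar>s - t\<bar> < d \<Longrightarrow> z (c s) = z (c t) + of_real (s - t) * v"
  shows "\<exists>d'>0. d' \<le> d \<and> (\<forall>s\<in>I. \<bar>s - t\<bar> < d' \<longrightarrow> c s \<in> W)"
proof -
  have "open (z ` (W \<inter> U))" "z (c t) \<in> z ` (W \<inter> U)"
    using chart_image_of_open[OF Uz W(1)] W by auto
  then obtain r where r: "r > 0" "ball (z (c t)) r \<subseteq> z ` (W \<inter> U)" using open_contains_ball by blast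
  define d' where "d' = min d (r / (1 + cmod v))"
  have d': "d' > 0" using d(1) r(1) by (simp add: d'_def add_pos_nonneg)
  show ?thesis
  proof (intro exI[of _ d'] conjI d' ballI impI)
    fix s assume s: "s \<in> I" "\<bar>s - t\<bar> < d'"
    have "\<bar>s - t\<bar> * cmod v \<le> \<bar>s - t\<bar> * (1 + cmod v)" by (intro mult_left_mono) auto
    also have "\<dots> < r"
      using s(2) by (simp add: d'_def pos_less_divide_eq add_pos_nonneg)
    finally have "dist (z (c t)) (z (c s)) < r"
      using d(3)[OF s(1)] s(2) by (simp add: dist_norm norm_mult d'_def del: of_real_diff)
    then have "z (c s) \<in> z ` (W \<inter> U)" using r(2) by auto
    moreover have "c s \<in> U" using d(2)[OF s(1)] s(2) by (simp add: d'_def)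
    ultimately show "c s \<in> W" using chart_inj[OF Uz] by (auto dest: inj_onD)
  qed (simp add: d'_def)
qed

lemma segment_continuous:
  assumes c: "leaf_segment At v I c" and t: "t \<in> I" and W: "openin X W" "c t \<in> W"
  shows "\<exists>d>0. \<forall>s\<in>I. \<bar>s - t\<bar> < d \<longrightarrow> c s \<in> W"
proof -
  obtain U z where Uz: "(U, z) \<in> At" "c t \<in> U" using leaf_segment_in[OF c t] by blast
  obtain d where "d > 0" "\<And>s. s \<in> I \<Longrightarrow> \<bar>s - t\<bar> < d \<Longrightarrow> c s \<in> U"
    "\<And>s. s \<in> I \<Longrightarrow> \<bar>s - t\<bar> < d \<Longrightarrow> z (c s) = z (c t) + of_real (s - t) * v"
    using leaf_segmentD[OF c t Uz] by metis
  from chart_curve_stays[OF Uz(1) W Uz(2) this] show ?thesis by blast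
qed

text \<open>One chart at each time suffices, since chart changes are locally translations and
  preserve velocities.\<close>

lemma leaf_segment_by_charts:
  assumes "\<And>t. t \<in> I \<Longrightarrow> \<exists>(U, z)\<in>At. \<exists>d>0. c t \<in> U \<and>
     (\<forall>s\<in>I. \<bar>s - t\<bar> < d \<longrightarrow> c s \<in> U \<and> z (c s) = z (c t) + of_real (s - t) * v)"
  shows "leaf_segment At v I c"
proof (rule leaf_segmentI)
  fix t assume t: "t \<in> I"
  obtain U z d where Uz: "(U, z) \<in> At" "c t \<in> U" and d: "d > 0"
    "\<And>s. s \<in> I \<Longrightarrow> \<bar>s - t\<bar> < d \<Longrightarrow> c s \<in> U"
    "\<And>s. s \<in> I \<Longrightarrow> \<bar>s - t\<bar> < d \<Longrightarrow> z (c s) = z (c t) + of_real (s - t) * v"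
    using assms[OF t] by blast
  then show "c t \<in> \<Union> (fst ` At)" by force
  fix V w assume Vw: "(V, w) \<in> At" "c t \<in> V"
  obtain k where "\<forall>\<^sub>F q in nhdsin X (c t). w q = z q + k" using chart_change[OF Uz(1) Vw(1) Uz(2) Vw(2)] by blast
  then obtain G where G: "openin X G" "c t \<in> G" "\<And>q. q \<in> G \<Longrightarrow> w q = z q + k"
    using chart_subset[OF Uz(1)] Uz(2) unfolding eventually_nhdsin by blast
  have "openin X (G \<inter> V)" "c t \<in> G \<inter> V" using G chart_open[OF Vw(1)] Vw(2) by auto
  from chart_curve_stays[OF Uz(1) this Uz(2) d] obtain d' where d': "d' > 0" "d' \<le> d"
    "\<And>s. s \<in> I \<Longrightarrow> \<bar>s - t\<bar> < d' \<Longrightarrow> c s \<in> G \<inter> V" by blast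
  show "\<exists>d>0. \<forall>s\<in>I. \<bar>s - t\<bar> < d \<longrightarrow> c s \<in> V \<and> w (c s) = w (c t) + of_real (s - t) * v"
  proof (intro exI[of _ d'] conjI d' ballI impI)
    fix s assume s: "s \<in> I" "\<bar>s - t\<bar> < d'"
    then have cs: "c s \<in> G" "c s \<in> V" using d'(3)[of s] by auto
    then show "c s \<in> V" by simp
    show "w (c s) = w (c t) + of_real (s - t) * v"
      using G(2,3) cs d(3)[OF s(1)] s(2) d'(2) by simp
  qed
qed

text \<open>The times at which the segments agree form a relatively open set by injectivity of a
  chart, those at which they differ by the Hausdorff property, and \<open>I\<close> is
  connected.\<close>

lemma segment_unique:
  assumes c: "leaf_segment At v I c" "leaf_segment At v I c'" and I: "connected I"
    and t0: "t0 \<in> I" "c t0 = c' t0" and t: "t \<in> I"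
  shows "c t = c' t"
proof (rule connected_induction_simple[OF I t0(1) t, where P = "\<lambda>t. c t = c' t"])
  fix a assume a: "a \<in> I"
  have "\<exists>d>0. \<forall>x\<in>I. \<forall>y\<in>I. \<bar>x - a\<bar> < d \<longrightarrow> \<bar>y - a\<bar> < d \<longrightarrow> c x = c' x \<longrightarrow> c y = c' y"
  proof (cases "c a = c' a")
    case True
    obtain U z where Uz: "(U, z) \<in> At" "c a \<in> U" using leaf_segment_in[OF c(1) a] by blast
    have Uz': "c' a \<in> U" using Uz True by simp
    obtain d where d: "d > 0" "\<And>s. s \<in> I \<Longrightarrow> \<bar>s - a\<bar> < d \<Longrightarrow> c s \<in> U"
      "\<And>s. s \<in> I \<Longrightarrow> \<bar>s - a\<bar> < d \<Longrightarrow> z (c s) = z (c a) + of_real (s - a) * v"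
      using leaf_segmentD[OF c(1) a Uz] by metis
    obtain d' where d': "d' > 0" "\<And>s. s \<in> I \<Longrightarrow> \<bar>s - a\<bar> < d' \<Longrightarrow> c' s \<in> U"
      "\<And>s. s \<in> I \<Longrightarrow> \<bar>s - a\<bar> < d' \<Longrightarrow> z (c' s) = z (c' a) + of_real (s - a) * v"
      using leaf_segmentD[OF c(2) a Uz(1) Uz'] by metis
    have "c y = c' y" if "y \<in> I" "\<bar>y - a\<bar> < min d d'" for y
      using inj_onD[OF chart_inj[OF Uz(1)]] d d' that True by simp
    then show ?thesis using d(1) d'(1) by (intro exI[of _ "min d d'"]) auto
  next
    case False
    have "c a \<in> topspace X" "c' a \<in> topspace X"
      using leaf_segment_in[OF c(1) a] leaf_segment_in[OF c(2) a] chart_subset by blast+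
    then obtain W W' where W: "openin X W" "openin X W'" "c a \<in> W" "c' a \<in> W'" "disjnt W W'"
      using hausdorff False unfolding Hausdorff_space_def by metis
    obtain d where d: "d > 0" "\<forall>s\<in>I. \<bar>s - a\<bar> < d \<longrightarrow> c s \<in> W"
      using segment_continuous[OF c(1) a W(1,3)] by blast
    obtain d' where d': "d' > 0" "\<forall>s\<in>I. \<bar>s - a\<bar> < d' \<longrightarrow> c' s \<in> W'"
      using segment_continuous[OF c(2) a W(2,4)] by blast
    have "c x \<noteq> c' x" if "x \<in> I" "\<bar>x - a\<bar> < min d d'" for x
      using d(2) d'(2) W(5) that by (fastforce simp: disjnt_iff)
    then show ?thesis using d(1) d'(1) by (intro exI[of _ "min d d'"]) auto
  qed
  then obtain d where d: "d > 0"
    "\<And>x y. x \<in> I \<Longrightarrow> y \<in> I \<Longrightarrow> \<bar>x - a\<bar> < d \<Longrightarrow> \<bar>y - a\<bar> < d \<Longrightarrow> c x = c' x \<Longrightarrow> c y = c' y" by blast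
  show "\<exists>T. openin (top_of_set I) T \<and> a \<in> T \<and> (\<forall>x\<in>T. \<forall>y\<in>T. c x = c' x \<longrightarrow> c y = c' y)"
  proof (intro exI[of _ "I \<inter> ball a d"] conjI ballI impI)
    show "openin (top_of_set I) (I \<inter> ball a d)" by (rule openin_open_Int) simp
    show "a \<in> I \<inter> ball a d" using a d(1) by simp
    fix x y assume "x \<in> I \<inter> ball a d" "y \<in> I \<inter> ball a d" "c x = c' x"
    then show "c y = c' y" using d(2)[of x y] by (simp add: dist_real_def abs_minus_commute)
  qed
qed (use t0 in auto)

text \<open>A leaf segment from \<open>c a\<close> to \<open>c b\<close> moves along with its starting point. Short segments move
  inside a chart, and the property is transitive, so the bisection principle applies.\<close>

lemma segment_stable:
  assumes c: "leaf_segment At v {0..T} c" and T: "0 \<le> T" and v: "cmod v = 1"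
  shows "\<exists>W F. openin X W \<and> c 0 \<in> W \<and> continuous_map (subtopology X W) X F \<and>
    (\<forall>q\<in>W. \<exists>c'. leaf_segment At v {0..T} c' \<and> c' 0 = q \<and> c' T = F q)"
proof -
  \<comment> \<open>The bisection principle also tests intervals that leave \<open>{0..T}\<close>,
    so the bounds are premises inside \<open>P\<close>. The condition \<open>F (c a) = c b\<close>
    makes the maps of adjacent intervals composable near \<open>c a\<close>.\<close>
  define P where "P = (\<lambda>a b. 0 \<le> a \<longrightarrow> b \<le> T \<longrightarrow> (\<exists>W F. openin X W \<and> c a \<in> W \<and>
    continuous_map (subtopology X W) X F \<and> F (c a) = c b \<and>
    (\<forall>q\<in>W. \<exists>c'. leaf_segment At v {0..b - a} c' \<and> c' 0 = q \<and> c' (b - a) = F q)))"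
  have "P 0 T"
  proof (rule Bolzano[OF T])
    fix a b b' assume ab: "P a b" "P b b'" "a \<le> b" "b \<le> b'"
    show "P a b'" unfolding P_def
    proof (intro impI)
      assume bd: "0 \<le> a" "b' \<le> T"
      have bT: "b \<le> T" "0 \<le> b" using ab bd by auto
      obtain W1 F1 where 1: "openin X W1" "c a \<in> W1" "continuous_map (subtopology X W1) X F1" "F1 (c a) = c b"
        "\<And>q. q \<in> W1 \<Longrightarrow> \<exists>c'. leaf_segment At v {0..b - a} c' \<and> c' 0 = q \<and> c' (b - a) = F1 q"
        using mp[OF mp[OF ab(1)[unfolded P_def] bd(1)] bT(1)] by blast
      obtain W2 F2 where 2: "openin X W2" "c b \<in> W2" "continuous_map (subtopology X W2) X F2" "F2 (c b) = c b'"
        "\<And>q. q \<in> W2 \<Longrightarrow> \<exists>c'. leaf_segment At v {0..b' - b} c' \<and> c' 0 = q \<and> c' (b' - b) = F2 q"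
        using mp[OF mp[OF ab(2)[unfolded P_def] bT(2)] bd(2)] by blast
      define W where "W = {q \<in> topspace (subtopology X W1). F1 q \<in> W2}"
      have WW1: "W \<subseteq> W1" by (auto simp: W_def)
      have "openin (subtopology X W1) W"
        unfolding W_def using 1(3) 2(1) by (rule openin_continuous_map_preimage)
      then have oW: "openin X W" using 1(1) by (rule openin_trans_full)
      have aW: "c a \<in> W" using 1 2 openin_subset by (fastforce simp: W_def)
      have "continuous_map (subtopology X W) X (F2 \<circ> F1)"
      proof (rule continuous_map_compose[OF _ 2(3)])
        have "continuous_map (subtopology X W) X F1"
          using continuous_map_from_subtopology_mono[OF 1(3) WW1] .
        then show "continuous_map (subtopology X W) (subtopology X W2) F1"
          by (auto simp: continuous_map_in_subtopology W_def)
      qed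
      moreover have "\<exists>c'. leaf_segment At v {0..b' - a} c' \<and> c' 0 = q \<and> c' (b' - a) = (F2 \<circ> F1) q" if q: "q \<in> W" for q
      proof -
        have q1: "q \<in> W1" "F1 q \<in> W2" using q by (auto simp: W_def)
        obtain c1 where c1: "leaf_segment At v {0..b - a} c1" "c1 0 = q" "c1 (b - a) = F1 q"
          using 1(5)[OF q1(1)] by blast
        obtain c2 where c2: "leaf_segment At v {0..b' - b} c2" "c2 0 = F1 q" "c2 (b' - b) = F2 (F1 q)"
          using 2(5)[OF q1(2)] by blast
        define c' where "c' = (\<lambda>t. if t \<le> b - a then c1 t else c2 (t - (b - a)))"
        have "leaf_segment At v {0..b - a} c'"
          using c1(1) by (rule leaf_segment_cong) (simp add: c'_def)
        moreover have "leaf_segment At v {b - a..b' - a} c'"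
        proof (rule leaf_segment_cong)
          show "leaf_segment At v {b - a..b' - a} (\<lambda>t. c2 (t - (b - a)))"
            using leaf_segment_shift[OF c2(1), of "b - a"] by simp
          show "c' t = c2 (t - (b - a))" if "t \<in> {b - a..b' - a}" for t
            using that c1(3) c2(2) by (auto simp: c'_def)
        qed
        ultimately have "leaf_segment At v ({0..b - a} \<union> {b - a..b' - a}) c'"
          by (intro leaf_segment_Un) auto
        moreover have "{0..b - a} \<union> {b - a..b' - a} = {0..b' - a}" using ab by auto
        moreover have "c' 0 = q" using ab c1 by (simp add: c'_def)
        moreover have "c' (b' - a) = F2 (F1 q)"
          using ab c1 c2 by (cases "b' = b") (auto simp: c'_def)
        ultimately show ?thesis by auto
      qed
      ultimately show "\<exists>W F. openin X W \<and> c a \<in> W \<and>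
        continuous_map (subtopology X W) X F \<and> F (c a) = c b' \<and>
        (\<forall>q\<in>W. \<exists>c'. leaf_segment At v {0..b' - a} c' \<and> c' 0 = q \<and> c' (b' - a) = F q)"
        using oW aW 1(4) 2(4) by (intro exI[of _ W] exI[of _ "F2 \<circ> F1"]) auto
    qed
  next
    fix x assume "0 \<le> x" "x \<le> T"
    then have x: "x \<in> {0..T}" by simp
    obtain U z where Uz: "(U, z) \<in> At" "c x \<in> U" using leaf_segment_in[OF c x] by blast
    obtain d where d: "d > 0" "\<And>s. s \<in> {0..T} \<Longrightarrow> \<bar>s - x\<bar> < d \<Longrightarrow> c s \<in> U"
      "\<And>s. s \<in> {0..T} \<Longrightarrow> \<bar>s - x\<bar> < d \<Longrightarrow> z (c s) = z (c x) + of_real (s - x) * v"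
      using leaf_segmentD[OF c x Uz] by metis
    obtain R where R: "R > 0" "ball (z (c x)) R \<subseteq> z ` U"
      using chart_image_open[OF Uz(1)] Uz(2) open_contains_ball by blast
    obtain g where g: "homeomorphic_maps (subtopology X U) (top_of_set (z ` U)) z g"
      using chart_homeo[OF Uz(1)] homeomorphic_map_maps by blast
    have tU: "topspace (subtopology X U) = U" using chart_subset[OF Uz(1)] by (simp add: Int_absorb1)
    have gz: "g (z q) = q" if "q \<in> U" for q using g that tU by (simp add: homeomorphic_maps_def)
    have zg: "z (g y) = y" "g y \<in> U" if "y \<in> z ` U" for y using that gz by auto
    have zcont: "continuous_map (subtopology X U) euclidean z"
      using g unfolding homeomorphic_maps_def continuous_map_in_subtopology by blast
    have gcont: "continuous_map (top_of_set (z ` U)) X g"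
      using g unfolding homeomorphic_maps_def continuous_map_in_subtopology by blast
    \<comment> \<open>A point that starts within \<open>R / 2\<close> of the centre and moves at
      unit speed for a time less than \<open>R / 2\<close> stays in the disc of radius
      \<open>R\<close> inside the chart.\<close>
    define d' where "d' = min d (R / 2)"
    have "\<forall>a b. a \<le> x \<and> x \<le> b \<and> b - a < d' \<longrightarrow> P a b"
    proof (intro allI impI)
      fix a b assume ab: "a \<le> x \<and> x \<le> b \<and> b - a < d'"
      show "P a b" unfolding P_def
      proof (intro impI)
        assume bd: "0 \<le> a" "b \<le> T"
        have ca: "c a \<in> U" "z (c a) = z (c x) + of_real (a - x) * v"
          using d(2,3)[of a] ab bd by (auto simp: d'_def)
        have cb: "c b \<in> U" "z (c b) = z (c x) + of_real (b - x) * v"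
          using d(2,3)[of b] ab bd by (auto simp: d'_def)
        define W where "W = {q \<in> topspace (subtopology X U). z q \<in> ball (z (c x)) (R / 2)}"
        have WU: "W \<subseteq> U" by (auto simp: W_def)
        have "openin (subtopology X U) W"
          unfolding W_def using zcont by (rule openin_continuous_map_preimage) simp
        then have oW: "openin X W" using chart_open[OF Uz(1)] by (rule openin_trans_full)
        have aW: "c a \<in> W"
          using ca ab v unfolding W_def tU by (auto simp: dist_norm norm_mult d'_def simp del: of_real_diff)
        have move: "z q + of_real s * v \<in> z ` U" if "q \<in> W" "0 \<le> s" "s \<le> b - a" for q s
        proof -
          have "dist (z (c x)) (z q + of_real s * v) \<le> dist (z (c x)) (z q) + cmod (of_real s * v)"
            using dist_triangle[of "z (c x)" "z q + of_real s * v" "z q"] by (simp add: dist_norm)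
          also have "\<dots> < R / 2 + R / 2"
            using that ab v by (intro add_less_le_mono) (auto simp: W_def norm_mult d'_def)
          finally show ?thesis using R(2) by auto
        qed
        define F where "F = (\<lambda>q. g (z q + of_real (b - a) * v))"
        have "continuous_map (subtopology X W) X F"
        proof -
          have "continuous_map (subtopology X W) euclidean z"
            using continuous_map_from_subtopology_mono[OF zcont WU] .
          then have "continuous_map (subtopology X W) euclidean (\<lambda>q. z q + of_real (b - a) * v)"
            by (intro continuous_map_add) auto
          then have "continuous_map (subtopology X W) (top_of_set (z ` U)) (\<lambda>q. z q + of_real (b - a) * v)"
            using move[of _ "b - a"] ab by (auto simp: continuous_map_in_subtopology simp del: of_real_diff)
          from continuous_map_compose[OF this gcont] show ?thesis by (simp add: F_def o_def)
        qed
        moreover have "F (c a) = c b"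
        proof -
          have "z (c a) + of_real (b - a) * v = z (c b)" unfolding ca(2) cb(2) by (simp add: algebra_simps)
          then show ?thesis using gz[OF cb(1)] by (simp add: F_def)
        qed
        moreover have "\<exists>c'. leaf_segment At v {0..b - a} c' \<and> c' 0 = q \<and> c' (b - a) = F q" if q: "q \<in> W" for q
        proof (intro exI[of _ "\<lambda>s. g (z q + of_real s * v)"] conjI)
          show "leaf_segment At v {0..b - a} (\<lambda>s. g (z q + of_real s * v))"
          proof (rule leaf_segment_by_charts, rule bexI[OF _ Uz(1)], clarify)
            fix t assume "t \<in> {0..b - a}"
            then show "\<exists>d>0. g (z q + of_real t * v) \<in> U \<and> (\<forall>s\<in>{0..b - a}. \<bar>s - t\<bar> < d \<longrightarrow>
                g (z q + of_real s * v) \<in> U \<and>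
                z (g (z q + of_real s * v)) = z (g (z q + of_real t * v)) + of_real (s - t) * v)"
              using zg move[OF q] by (intro exI[of _ 1]) (auto simp: algebra_simps)
          qed
          show "g (z q + of_real 0 * v) = q" using gz q WU by auto
        qed (simp add: F_def)
        ultimately show "\<exists>W F. openin X W \<and> c a \<in> W \<and>
          continuous_map (subtopology X W) X F \<and> F (c a) = c b \<and>
          (\<forall>q\<in>W. \<exists>c'. leaf_segment At v {0..b - a} c' \<and> c' 0 = q \<and> c' (b - a) = F q)"
          using oW aW by blast
      qed
    qed
    then show "\<exists>d>0. \<forall>a b. a \<le> x \<and> x \<le> b \<and> b - a < d \<longrightarrow> P a b"
      using d(1) R(1) by (intro exI[of _ d']) (auto simp: d'_def)
  qed
  then show ?thesis unfolding P_def using T by auto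
qed

definition reach :: "complex \<Rightarrow> real \<Rightarrow> 'a set" where
  "reach v T = {q. \<exists>c. leaf_segment At v {0..T} c \<and> c 0 = q}"

lemma openin_reach:
  assumes "0 \<le> T" "cmod v = 1"
  shows "openin X (reach v T)"
proof (subst openin_subopen, intro ballI)
  fix p assume "p \<in> reach v T"
  then obtain c where c: "leaf_segment At v {0..T} c" "c 0 = p" by (auto simp: reach_def)
  from segment_stable[OF c(1) assms] c(2) show "\<exists>W. openin X W \<and> p \<in> W \<and> W \<subseteq> reach v T"
    unfolding reach_def by blast
qed

definition full_leaf :: "complex \<Rightarrow> 'a set" where
  "full_leaf v = {p. \<exists>c. leaf_line At v c \<and> c 0 = p}"

text \<open>A countable intersection of open sets, hence Borel. A complete leaf is glued from
  segments over \<open>{- n..n}\<close>, which agree by uniqueness; backward times are forward times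
  for \<open>- v\<close>.\<close>

lemma full_leaf_eq: "full_leaf v = (\<Inter>n. reach v (real n) \<inter> reach (- v) (real n))"
proof (intro equalityI subsetI)
  fix p assume "p \<in> full_leaf v"
  then obtain c where c: "leaf_segment At v UNIV c" "c 0 = p" by (auto simp: full_leaf_def leaf_line_iff_segment)
  have c': "leaf_segment At (- v) UNIV (\<lambda>t. c (- t))"
    using leaf_segment_reflect[OF c(1)] by (simp add: surj_uminus)
  show "p \<in> (\<Inter>n. reach v (real n) \<inter> reach (- v) (real n))"
    using leaf_segment_subset[OF c(1)] leaf_segment_subset[OF c'] c(2) unfolding reach_def by fastforce
next
  fix p assume p: "p \<in> (\<Inter>n. reach v (real n) \<inter> reach (- v) (real n))"
  have "\<exists>c. leaf_segment At v {- real n..real n} c \<and> c 0 = p" for n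
  proof -
    obtain c1 where c1: "leaf_segment At v {0..real n} c1" "c1 0 = p" using p by (auto simp: reach_def)
    obtain c2 where c2: "leaf_segment At (- v) {0..real n} c2" "c2 0 = p" using p by (auto simp: reach_def)
    define c where "c = (\<lambda>t. if 0 \<le> t then c1 t else c2 (- t))"
    have "leaf_segment At v {0..real n} c"
      using c1(1) by (rule leaf_segment_cong) (simp add: c_def)
    moreover have "leaf_segment At v {- real n..0} c"
    proof (rule leaf_segment_cong)
      show "leaf_segment At v {- real n..0} (\<lambda>t. c2 (- t))" using leaf_segment_reflect[OF c2(1)] by simp
      show "c t = c2 (- t)" if "t \<in> {- real n..0}" for t
        using that c1(2) c2(2) by (auto simp: c_def)
    qed
    ultimately have "leaf_segment At v ({0..real n} \<union> {- real n..0}) c" by (intro leaf_segment_Un) auto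
    moreover have "{0..real n} \<union> {- real n..0} = {- real n..real n}" by auto
    ultimately show ?thesis using c1(2) by (intro exI[of _ c]) (simp add: c_def)
  qed
  then obtain C where C: "\<And>n. leaf_segment At v {- real n..real n} (C n)" "\<And>n. C n 0 = p" by metis
  have agree: "C n t = C m t" if "n \<le> m" "\<bar>t\<bar> \<le> real n" for n m t
  proof (rule segment_unique[of v "{- real n..real n}" "C n" "C m" 0 t])
    show "leaf_segment At v {- real n..real n} (C m)"
      using that(1) by (intro leaf_segment_subset[OF C(1)[of m]]) auto
  qed (use C that in auto)
  define K where "K = (\<lambda>t::real. nat \<lceil>\<bar>t\<bar>\<rceil>)"
  have K: "\<bar>t\<bar> \<le> real (K t)" for t unfolding K_def by linarith
  define c where "c = (\<lambda>t. C (K t) t)"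
  have c: "c t = C m t" if "\<bar>t\<bar> \<le> real m" for m t
    using agree[of "K t" m t] agree[of m "K t" t] K[of t] that unfolding c_def by (metis nat_le_linear)
  have "leaf_segment At v UNIV c"
  proof (rule leaf_segmentI)
    fix t :: real
    \<comment> \<open>The additional unit keeps all times near \<open>t\<close> within the range of
      the same segment \<open>C m\<close>.\<close>
    define m where "m = K t + 1"
    have t: "t \<in> {- real m..real m}" using K[of t] by (auto simp: m_def)
    have ct: "c t = C m t" using K[of t] by (intro c) (simp add: m_def)
    show "c t \<in> \<Union> (fst ` At)" using C(1)[of m] t unfolding ct leaf_segment_def by blast
    fix U z assume Uz: "(U, z) \<in> At" "c t \<in> U"
    obtain d where d: "d > 0" "\<And>s. s \<in> {- real m..real m} \<Longrightarrow> \<bar>s - t\<bar> < d \<Longrightarrow> C m s \<in> U"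
      "\<And>s. s \<in> {- real m..real m} \<Longrightarrow> \<bar>s - t\<bar> < d \<Longrightarrow> z (C m s) = z (C m t) + of_real (s - t) * v"
      using leaf_segmentD[OF C(1) t Uz(1)] Uz(2) unfolding ct by metis
    show "\<exists>d>0. \<forall>s\<in>UNIV. \<bar>s - t\<bar> < d \<longrightarrow> c s \<in> U \<and> z (c s) = z (c t) + of_real (s - t) * v"
    proof (intro exI[of _ "min d 1"] conjI ballI impI)
      fix s assume s: "\<bar>s - t\<bar> < min d 1"
      have sm: "\<bar>s\<bar> \<le> real m" using K[of t] s by (auto simp: m_def)
      then have "s \<in> {- real m..real m}" by auto
      then show "c s \<in> U" "z (c s) = z (c t) + of_real (s - t) * v"
        using d(2,3)[of s] s unfolding ct c[OF sm] by auto
    qed (use d in auto)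
  qed
  moreover have "c 0 = p" using c[of 0 0] C(2) by simp
  ultimately show "p \<in> full_leaf v" unfolding full_leaf_def leaf_line_iff_segment by blast
qed

lemma leaf_line_unique:
  assumes "leaf_line At v c" "leaf_line At v c'" "c 0 = c' 0"
  shows "c = c'"
  using segment_unique[of v UNIV c c' 0] assms unfolding leaf_line_iff_segment by auto

lemma translation_flow_eq:
  assumes "leaf_line At v c" "c 0 = p"
  shows "translation_flow At v t p = c t"
proof -
  have "(SOME c. leaf_line At v c \<and> c 0 = p) = c"
    using assms leaf_line_unique by (intro some_equality) auto
  then show ?thesis using assms unfolding translation_flow_def by auto
qed

lemma translation_flow_off_leaf:
  assumes "p \<notin> full_leaf v"
  shows "translation_flow At v t p = p"
proof -
  have "\<not> (\<exists>c. leaf_line At v c \<and> c 0 = p)" using assms unfolding full_leaf_def by blast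
  then show ?thesis unfolding translation_flow_def by (rule if_not_P)
qed

lemma full_leaf_uminus: "full_leaf (- v) = full_leaf v"
  unfolding full_leaf_eq by auto

lemma translation_flow_uminus: "translation_flow At (- v) (- t) p = translation_flow At v t p"
proof (cases "p \<in> full_leaf v")
  case True
  then obtain c where c: "leaf_line At v c" "c 0 = p" by (auto simp: full_leaf_def)
  then have "leaf_line At (- v) (\<lambda>t. c (- t))"
    using leaf_segment_reflect[of At v UNIV c] by (simp add: leaf_line_iff_segment surj_uminus)
  from translation_flow_eq[OF this] translation_flow_eq[OF c] c(2) show ?thesis by simp
next
  case False
  then have "p \<notin> full_leaf (- v)" by (simp add: full_leaf_uminus)
  with False show ?thesis by (simp add: translation_flow_off_leaf)
qed

section \<open>Borel measurability of the flow maps\<close>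

abbreviation borel_of_X :: "'a measure" where
  "borel_of_X \<equiv> sigma (topspace X) {U. openin X U}"

lemma opens_Pow: "{U. openin X U} \<subseteq> Pow (topspace X)"
  using openin_subset by blast

lemma space_borel_of_X [simp]: "space borel_of_X = topspace X"
  by (rule space_measure_of[OF opens_Pow])

lemma open_in_borel_of_X: "openin X U \<Longrightarrow> U \<in> sets borel_of_X"
  unfolding sets_measure_of[OF opens_Pow] by (rule sigma_sets.Basic) simp

lemma full_leaf_sets:
  assumes "cmod v = 1"
  shows "full_leaf v \<in> sets borel_of_X"
proof -
  have "reach v (real n) \<inter> reach (- v) (real n) \<in> sets borel_of_X" for n
    by (intro sets.Int open_in_borel_of_X openin_reach) (use assms in auto)
  then show ?thesis unfolding full_leaf_eq by (intro sets.countable_INT) auto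
qed

lemma translation_flow_in_topspace:
  assumes "p \<in> topspace X"
  shows "translation_flow At v t p \<in> topspace X"
proof (cases "p \<in> full_leaf v")
  case True
  then obtain c where c: "leaf_line At v c" "c 0 = p" by (auto simp: full_leaf_def)
  have "c t \<in> \<Union> (fst ` At)" using c(1) unfolding leaf_line_def by blast
  then have "c t \<in> topspace X" using chart_subset by fastforce
  then show ?thesis using translation_flow_eq[OF c] by simp
qed (use assms in \<open>simp add: translation_flow_off_leaf\<close>)

text \<open>Near a point with a complete leaf, the map coincides on complete leaves with the
  continuous map of \<open>segment_stable\<close>, so preimages of open sets are relatively open
  there. On the complement, also a Borel set, it is the identity.\<close>

lemma measurable_translation_flow_nonneg:
  assumes v: "cmod v = 1" and t: "0 \<le> t"
  shows "translation_flow At v t \<in> measurable borel_of_X borel_of_X"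
proof (rule measurable_measure_of[OF opens_Pow])
  show "translation_flow At v t \<in> space borel_of_X \<rightarrow> topspace X"
    using translation_flow_in_topspace by auto
  fix W assume "W \<in> {U. openin X U}"
  then have W: "openin X W" by simp
  let ?\<phi> = "translation_flow At v t" and ?L = "full_leaf v"
  define V where "V = \<Union> {G. openin X G \<and> (\<forall>q\<in>G \<inter> ?L. ?\<phi> q \<in> W)}"
  have V: "openin X V" unfolding V_def by (rule openin_Union) auto
  have L: "?L \<subseteq> topspace X" using sets.sets_into_space[OF full_leaf_sets[OF v]] by simp
  have inV: "p \<in> V" if p: "p \<in> ?L" "?\<phi> p \<in> W" for p
  proof -
    obtain c where c: "leaf_line At v c" "c 0 = p" using p by (auto simp: full_leaf_def)
    have "leaf_segment At v {0..t} c" using c(1) leaf_segment_subset unfolding leaf_line_iff_segment by blast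
    from segment_stable[OF this t v] obtain G F where G: "openin X G" "p \<in> G" "continuous_map (subtopology X G) X F"
      "\<And>q. q \<in> G \<Longrightarrow> \<exists>c'. leaf_segment At v {0..t} c' \<and> c' 0 = q \<and> c' t = F q"
      unfolding c(2) by blast
    have F: "?\<phi> q = F q" if q: "q \<in> G" "q \<in> ?L" for q
    proof -
      obtain c1 where c1: "leaf_line At v c1" "c1 0 = q" using q by (auto simp: full_leaf_def)
      obtain c2 where c2: "leaf_segment At v {0..t} c2" "c2 0 = q" "c2 t = F q" using G(4)[OF q(1)] by blast
      have "leaf_segment At v {0..t} c1" using c1(1) leaf_segment_subset unfolding leaf_line_iff_segment by blast
      from segment_unique[OF this c2(1), of 0 t] have "c1 t = c2 t" using t c1 c2 by simp
      then show ?thesis using translation_flow_eq[OF c1] c2 by simp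
    qed
    define G' where "G' = {q \<in> topspace (subtopology X G). F q \<in> W}"
    have "openin (subtopology X G) G'" unfolding G'_def using G(3) W by (rule openin_continuous_map_preimage)
    then have "openin X G'" using G(1) by (rule openin_trans_full)
    moreover have "p \<in> G'" using p F G(1,2) L by (auto simp: G'_def)
    moreover have "\<forall>q\<in>G' \<inter> ?L. ?\<phi> q \<in> W" using F by (auto simp: G'_def)
    ultimately show ?thesis unfolding V_def by blast
  qed
  have "?\<phi> -` W \<inter> space borel_of_X = (?L \<inter> V) \<union> (W - ?L)"
  proof (intro equalityI subsetI)
    fix p assume "p \<in> ?\<phi> -` W \<inter> space borel_of_X"
    then have "p \<in> topspace X" "?\<phi> p \<in> W" by auto
    then show "p \<in> (?L \<inter> V) \<union> (W - ?L)"
      using inV[of p] translation_flow_off_leaf[of p v t] by (cases "p \<in> ?L") auto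
  next
    fix p assume "p \<in> (?L \<inter> V) \<union> (W - ?L)"
    then show "p \<in> ?\<phi> -` W \<inter> space borel_of_X"
    proof
      assume "p \<in> ?L \<inter> V"
      then show ?thesis using L unfolding V_def by auto
    next
      assume p: "p \<in> W - ?L"
      then have "?\<phi> p = p" using translation_flow_off_leaf by blast
      then show ?thesis using p openin_subset[OF W] by auto
    qed
  qed
  moreover have "V \<in> sets borel_of_X" "W \<in> sets borel_of_X" using V W by (auto intro: open_in_borel_of_X)
  ultimately show "?\<phi> -` W \<inter> space borel_of_X \<in> sets borel_of_X" using full_leaf_sets[OF v] by auto
qed

text \<open>This cannot be replaced by measurability up to null sets: the correlations in
  \<open>spectral_measure\<close> are Bochner integrals, which are \<open>0\<close> for non-measurable integrands.\<close>

lemma measurable_translation_flow: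
  assumes v: "cmod v = 1"
  shows "translation_flow At v t \<in> measurable borel_of_X borel_of_X"
proof (cases "0 \<le> t")
  case False
  have "translation_flow At v t = translation_flow At (- v) (- t)"
    by (intro ext) (rule translation_flow_uminus[symmetric])
  then show ?thesis using measurable_translation_flow_nonneg[of "- v" "- t"] v False by simp
qed (use measurable_translation_flow_nonneg[OF v] in simp)

end

section \<open>Suspension flows and spectral measures\<close>

lemma cmod_one_minus_e: "cmod (1 - e x) = 2 * \<bar>sin (pi * x)\<bar>"
proof -
  have "(cmod (1 - e x))^2 = (1 - cos (2 * pi * x))^2 + (sin (2 * pi * x))^2"
    by (simp add: cmod_power2 e_def)
  also have "\<dots> = 2 - 2 * cos (2 * (pi * x))"
    using sin_cos_squared_add[of "2 * pi * x"] by (simp add: power2_diff algebra_simps)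
  also have "\<dots> = (2 * \<bar>sin (pi * x)\<bar>)^2"
    by (simp add: cos_double_sin power_mult_distrib)
  finally show ?thesis by (rule power2_eq_imp_eq) auto
qed

lemma cmod_e_diff_le: "cmod (e x - e y) \<le> 2 * pi * \<bar>x - y\<bar>"
proof -
  have "e x * e (y - x) = e y" by (simp flip: e_add)
  then have "e x - e y = e x * (1 - e (y - x))" by (simp add: right_diff_distrib)
  then have "cmod (e x - e y) = 2 * \<bar>sin (pi * (y - x))\<bar>" by (simp add: norm_mult cmod_one_minus_e)
  also have "\<dots> \<le> 2 * \<bar>pi * (y - x)\<bar>" using abs_sin_x_le_abs_x[of "pi * (y - x)"] by simp
  finally show ?thesis by (simp add: abs_mult abs_minus_commute)
qed

text \<open>By the mean value theorem \<open>sin y \<ge> y / 2\<close> up to \<open>pi / 3\<close>,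
  where the cosine is at least \<open>1 / 2\<close>. This will bound the denominators of geometric
  sums from below.\<close>

lemma cmod_one_minus_e_ge:
  assumes "\<bar>x\<bar> \<le> 1 / 3"
  shows "2 * \<bar>x\<bar> \<le> cmod (1 - e x)"
proof -
  have *: "y / 2 \<le> sin y" if y: "0 \<le> y" "y \<le> pi / 3" for y :: real
  proof (cases "y = 0")
    case False
    with y have "0 < y" by simp
    from MVT2[OF this, of sin cos] obtain z where z: "0 < z" "z < y" "sin y - sin 0 = (y - 0) * cos z"
      by (auto intro: DERIV_sin)
    have "cos (pi / 3) \<le> cos z" using z y by (intro cos_monotone_0_pi_le) auto
    then have "y * (1 / 2) \<le> y * cos z" using y by (intro mult_left_mono) (auto simp: cos_60)
    then show ?thesis using z by simp
  qed simp
  have "pi * \<bar>x\<bar> / 2 \<le> sin (pi * \<bar>x\<bar>)" using assms by (intro *) auto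
  also have "\<dots> \<le> \<bar>sin (pi * x)\<bar>" by (cases "0 \<le> x") auto
  finally have "pi * \<bar>x\<bar> \<le> cmod (1 - e x)" unfolding cmod_one_minus_e by simp
  moreover have "2 * \<bar>x\<bar> \<le> pi * \<bar>x\<bar>" using pi_ge_two by (intro mult_right_mono) auto
  ultimately show ?thesis by linarith
qed

section \<open>Return heights and the suspension flow\<close>

lemma roof_sum_0 [simp]: "roof_sum s x 0 = 0"
  by (simp add: roof_sum_def)

lemma roof_sum_step: "roof_sum s x (n + 1) = roof_sum s x n + s $ x n"
proof (cases "0 \<le> n")
  case True
  then have "{0..<n + 1} = insert n {0..<n}" "{n + 1..<0} = {}" "{n..<0} = {}" by auto
  then show ?thesis by (simp add: roof_sum_def)
next
  case False
  then have "{n..<0} = insert n {n + 1..<0}" "{0..<n + 1} = {}" "{0..<n} = {}" by auto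
  then show ?thesis by (simp add: roof_sum_def)
qed

lemma roof_sum_add: "roof_sum s x (n + int k) = roof_sum s x n + (\<Sum>i<k. s $ x (n + int i))"
proof (induction k)
  case (Suc k)
  have "roof_sum s x (n + int (Suc k)) = roof_sum s x ((n + int k) + 1)" by (simp add: algebra_simps)
  then show ?case unfolding roof_sum_step Suc.IH by simp
qed simp

lemma roof_sum_shift: "roof_sum s (\<lambda>i. x (i + n)) k = roof_sum s x (n + k) - roof_sum s x n"
proof (induction k rule: int_induct[of _ 0])
  case (step1 k)
  have "roof_sum s x (n + (k + 1)) = roof_sum s x ((n + k) + 1)" by (simp add: algebra_simps)
  then show ?case unfolding roof_sum_step using step1 by (simp add: add.commute)
next
  case (step2 k)
  have 1: "roof_sum s x (n + k) = roof_sum s x (n + (k - 1)) + s $ x (n + (k - 1))"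
    using roof_sum_step[of s x "n + (k - 1)"] by (simp add: algebra_simps)
  have 2: "roof_sum s (\<lambda>i. x (i + n)) k = roof_sum s (\<lambda>i. x (i + n)) (k - 1) + s $ x (n + (k - 1))"
    using roof_sum_step[of s "\<lambda>i. x (i + n)" "k - 1"] by (simp add: add.commute)
  from 1 2 step2 show ?case by linarith
qed simp

lemma roof_sum_word: "roof_sum s x (int n) = sum_list (map (($) s) (map (\<lambda>j. x (int j)) [0..<n]))"
  using roof_sum_add[of s x 0 n] by (simp add: interv_sum_list_conv_sum_set_nat atLeast0LessThan o_def)

lemma twisted_sum_word:
  "twisted_sum (($) s) \<omega> a (map (\<lambda>j. x (int j)) [0..<n]) =
    (\<Sum>i<n. if x (int i) = a then e (- \<omega> * roof_sum s x (int i)) else 0)"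
proof (induction n)
  case (Suc n)
  have eq: "map (\<lambda>j. x (int j)) [0..<Suc n] = map (\<lambda>j. x (int j)) [0..<n] @ [x (int n)]" by simp
  show ?case by (simp only: eq twisted_sum_append Suc.IH roof_sum_word[symmetric]) simp
qed simp

context
  fixes s :: "real ^ 'b::finite"
  assumes s_pos: "\<And>b. 0 < s $ b"
begin

lemma roof_min_pos: "0 < Min (range (($) s))"
  using s_pos by (subst Min_gr_iff) auto

lemma roof_sum_ge: "roof_sum s x n + real k * Min (range (($) s)) \<le> roof_sum s x (n + int k)"
proof -
  have "(\<Sum>i<k. Min (range (($) s))) \<le> (\<Sum>i<k. s $ x (n + int i))"
    by (intro sum_mono Min_le) auto
  then show ?thesis by (simp add: roof_sum_add)
qed

lemma roof_sum_mono:
  assumes "n \<le> m"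
  shows "roof_sum s x n \<le> roof_sum s x m"
proof -
  obtain k where k: "m = n + int k" using zle_iff_zadd assms by blast
  have "0 \<le> real k * Min (range (($) s))"
    by (intro mult_nonneg_nonneg less_imp_le[OF roof_min_pos]) simp
  with roof_sum_ge[of x n k] show ?thesis unfolding k by linarith
qed

lemma roof_interval_unique:
  assumes "roof_sum s x n \<le> y" "y < roof_sum s x (n + 1)" "roof_sum s x m \<le> y" "y < roof_sum s x (m + 1)"
  shows "n = m"
proof (rule ccontr)
  assume "n \<noteq> m"
  then consider "n + 1 \<le> m" | "m + 1 \<le> n" by linarith
  then show False
    using assms roof_sum_mono[of "n + 1" m x] roof_sum_mono[of "m + 1" n x] by cases linarith+
qed

lemma roof_interval_exists: "\<exists>n. roof_sum s x n \<le> y \<and> y < roof_sum s x (n + 1)"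
proof -
  let ?c = "Min (range (($) s))"
  obtain K :: nat where K: "\<bar>y\<bar> / ?c < real K" using reals_Archimedean2 by blast
  then have yK: "\<bar>y\<bar> < real K * ?c" using roof_min_pos by (simp add: pos_divide_less_eq)
  have lo: "roof_sum s x (- int K) \<le> y" using roof_sum_ge[of x "- int K" K] yK by simp
  have "y < roof_sum s x (- int K + int (2 * K))"
    using roof_sum_ge[of x 0 K] yK by simp
  then have ex: "\<exists>k. y < roof_sum s x (- int K + int k)" by blast
  define k where "k = (LEAST k. y < roof_sum s x (- int K + int k))"
  have k: "y < roof_sum s x (- int K + int k)" unfolding k_def using ex by (rule LeastI_ex)
  have "k \<noteq> 0"
  proof
    assume "k = 0"
    then show False using lo k by simp
  qed
  then obtain k' where k': "k = Suc k'" by (cases k) auto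
  have "\<not> y < roof_sum s x (- int K + int k')"
    using not_less_Least[of k' "\<lambda>k. y < roof_sum s x (- int K + int k)"] k' by (simp add: k_def)
  with k k' show ?thesis by (intro exI[of _ "- int K + int k'"]) (auto simp: algebra_simps)
qed

lemma suspension_flow_eq:
  assumes "roof_sum s x n \<le> u + t" "u + t < roof_sum s x (n + 1)"
  shows "suspension_flow s t (x, u) = (\<lambda>i. x (i + n), u + t - roof_sum s x n)"
proof -
  have "(THE n. roof_sum s x n \<le> u + t \<and> u + t < roof_sum s x (n + 1)) = n"
    using assms roof_interval_unique by (intro the_equality) auto
  then show ?thesis by (simp add: suspension_flow_def)
qed

lemma suspension_flow_add: "suspension_flow s t (suspension_flow s t' p) = suspension_flow s (t' + t) p"
proof -
  obtain x u where p: "p = (x, u)" by (cases p)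
  obtain n where n: "roof_sum s x n \<le> u + t'" "u + t' < roof_sum s x (n + 1)"
    using roof_interval_exists by blast
  obtain k where k: "roof_sum s x k \<le> u + (t' + t)" "u + (t' + t) < roof_sum s x (k + 1)"
    using roof_interval_exists by blast
  have "suspension_flow s t (\<lambda>i. x (i + n), u + t' - roof_sum s x n) =
      (\<lambda>i. x (i + (k - n) + n), u + t' - roof_sum s x n + t - roof_sum s (\<lambda>i. x (i + n)) (k - n))"
    by (rule suspension_flow_eq) (use k in \<open>auto simp: roof_sum_shift algebra_simps\<close>)
  then show ?thesis unfolding p suspension_flow_eq[OF n] suspension_flow_eq[OF k]
    by (simp add: roof_sum_shift algebra_simps)
qed

lemma suspension_flow_in_space:
  assumes "p \<in> suspension_space \<zeta> s"
  shows "suspension_flow s t p \<in> suspension_space \<zeta> s"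
proof -
  obtain x u where p: "p = (x, u)" by (cases p)
  obtain n where n: "roof_sum s x n \<le> u + t" "u + t < roof_sum s x (n + 1)"
    using roof_interval_exists by blast
  have "(\<lambda>i. x (i + n)) \<in> subst_shift_space \<zeta>"
  proof -
    have x: "x \<in> subst_shift_space \<zeta>" using assms by (simp add: p suspension_space_def)
    show ?thesis unfolding subst_shift_space_def mem_Collect_eq
    proof (intro allI)
      fix i and k :: nat
      have eq: "map (\<lambda>j. x (i + int j + n)) [0..<k] = map (\<lambda>j. x ((i + n) + int j)) [0..<k]"
        by (simp add: algebra_simps)
      have "\<exists>l a. sublist (map (\<lambda>j. x ((i + n) + int j)) [0..<k]) ((subst_word \<zeta> ^^ l) [a])"
        using x unfolding subst_shift_space_def by blast
      then show "\<exists>l a. sublist (map (\<lambda>j. x (i + int j + n)) [0..<k]) ((subst_word \<zeta> ^^ l) [a])"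
        unfolding eq .
    qed
  qed
  then show ?thesis using n unfolding p suspension_flow_eq[OF n]
    by (simp add: suspension_space_def roof_sum_step)
qed

text \<open>The times \<open>j \<tau>\<close> that fall into one visit to the letter \<open>a\<close> contribute a geometric sum,
  which agrees with the corresponding integral up to \<open>O(\<tau>)\<close>.\<close>

lemma discrete_twisted_sum_le:
  fixes \<omega> \<tau> u :: real and N :: nat
  assumes u: "0 \<le> u" "u < s $ x 0" and \<tau>: "0 < \<tau>" "\<bar>\<omega>\<bar> * \<tau> \<le> 1 / 3" and \<omega>: "\<omega> \<noteq> 0"
  shows "\<exists>n::nat. roof_sum s x (int n) \<le> u + real N * \<tau> \<and>
    \<tau> * cmod (\<Sum>j<N. e (- \<omega> * (real j * \<tau>)) * of_bool (fst (suspension_flow s (real j * \<tau>) (x, u)) 0 = a))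
      \<le> cmod (twisted_sum (($) s) \<omega> a (map (\<lambda>j. x (int j)) [0..<n])) / \<bar>\<omega>\<bar>
        + 2 * pi * \<tau> * real n + 2 * Max (range (($) s))"
proof -
  let ?smax = "Max (range (($) s))"
  have smax: "s $ b \<le> ?smax" for b by (intro Max_ge) auto
  obtain n' where n': "roof_sum s x n' \<le> u + real N * \<tau>" "u + real N * \<tau> < roof_sum s x (n' + 1)"
    using roof_interval_exists by blast
  have "0 \<le> n'"
  proof (rule ccontr)
    assume "\<not> 0 \<le> n'"
    then have "roof_sum s x (n' + 1) \<le> roof_sum s x 0" by (intro roof_sum_mono) simp
    moreover have "0 \<le> u + real N * \<tau>" using u \<tau> by simp
    ultimately show False using n' by simp
  qed
  then obtain n where n: "n' = int n" by (metis nonneg_int_cases)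
  define r where "r = (\<lambda>i::nat. roof_sum s x (int i))"
  have r_Suc: "r (Suc i) = r i + s $ x (int i)" for i
    using roof_sum_step[of s x "int i"] by (simp add: r_def add.commute)
  have r0: "r 0 = 0" by (simp add: r_def)
  have rn: "r n \<le> u + real N * \<tau>" "u + real N * \<tau> < r (Suc n)"
    using n' by (simp_all add: r_def n add.commute)
  \<comment> \<open>The first sampling index at which the orbit has reached the base of the
    \<open>i\<close>-th letter; the indices from \<open>lo i\<close> until before
    \<open>lo (Suc i)\<close> see the letter \<open>x i\<close>. \<open>lo 0\<close> may be
    negative, as the orbit starts at height \<open>u\<close>.\<close>
  define lo where "lo = (\<lambda>i. \<lceil>(r i - u) / \<tau>\<rceil>)"
  have lo: "lo i \<le> j \<longleftrightarrow> r i \<le> u + of_int j * \<tau>" for i j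
    unfolding lo_def ceiling_le_iff using \<tau>(1) by (simp add: pos_divide_le_eq algebra_simps)
  have lo_mono: "lo i \<le> lo (Suc i)" for i
    unfolding lo_def using r_Suc[of i] s_pos[of "x (int i)"] \<tau>(1)
    by (intro ceiling_mono divide_right_mono) auto
  have lo_mono0: "lo 0 \<le> lo i" for i by (induction i) (use lo_mono order.trans in auto)
  have lo_ge: "(r i - u) \<le> of_int (lo i) * \<tau>" for i
    using lo[of i "lo i"] by simp
  have lo_le: "of_int (lo i) * \<tau> \<le> (r i - u) + \<tau>" for i
  proof -
    have "of_int (lo i) - 1 < (r i - u) / \<tau>" unfolding lo_def by linarith
    then have "(of_int (lo i) - 1) * \<tau> < r i - u" using \<tau>(1) by (simp only: pos_less_divide_eq)
    then show ?thesis by (simp add: algebra_simps)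
  qed
  define hit where "hit = (\<lambda>j::int. (of_bool (fst (suspension_flow s (of_int j * \<tau>) (x, u)) 0 = a) :: complex))"
  have hit: "hit j = of_bool (x (int i) = a)" if "lo i \<le> j" "j < lo (Suc i)" for i j
  proof -
    have "r i \<le> u + of_int j * \<tau>" "u + of_int j * \<tau> < r (Suc i)"
      using that lo[of i j] lo[of "Suc i" j] by auto
    then have "suspension_flow s (of_int j * \<tau>) (x, u) =
       (\<lambda>k. x (k + int i), u + of_int j * \<tau> - roof_sum s x (int i))"
      by (intro suspension_flow_eq) (simp_all add: r_def add.commute)
    then show ?thesis by (simp add: hit_def)
  qed
  define q where "q = e (- \<omega> * \<tau>)"
  define E where "E = (\<lambda>j::int. e (- \<omega> * (of_int j * \<tau>)))"
  have E_step: "E (j + 1) = q * E j" for j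
    unfolding E_def q_def e_add[symmetric] by (simp add: algebra_simps)
  have geo: "(1 - q) * (\<Sum>j\<in>{i..<i + int k}. E j) = E i - E (i + int k)" for i k
  proof (induction k)
    case (Suc k)
    have "{i..<i + int (Suc k)} = insert (i + int k) {i..<i + int k}" by auto
    then have "(1 - q) * (\<Sum>j\<in>{i..<i + int (Suc k)}. E j) = (1 - q) * E (i + int k) + (E i - E (i + int k))"
      by (simp add: distrib_left Suc.IH)
    also have "\<dots> = E i - q * E (i + int k)" by (simp add: algebra_simps)
    also have "q * E (i + int k) = E (i + int (Suc k))" using E_step[of "i + int k"] by (simp add: algebra_simps)
    finally show ?case .
  qed simp
  have main: "(1 - q) * (\<Sum>j\<in>{lo 0..<lo k}. E j * hit j) =
      (\<Sum>i<k. of_bool (x (int i) = a) * (E (lo i) - E (lo (Suc i))))" for k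
  proof (induction k)
    case (Suc k)
    obtain d where d: "lo (Suc k) = lo k + int d" using lo_mono[of k] zle_iff_zadd by blast
    have "{lo 0..<lo (Suc k)} = {lo 0..<lo k} \<union> {lo k..<lo k + int d}"
      using lo_mono0[of k] lo_mono[of k] d by auto
    then have "(\<Sum>j\<in>{lo 0..<lo (Suc k)}. E j * hit j) =
       (\<Sum>j\<in>{lo 0..<lo k}. E j * hit j) + (\<Sum>j\<in>{lo k..<lo k + int d}. E j * hit j)"
      by (simp add: sum.union_disjoint)
    also have "(\<Sum>j\<in>{lo k..<lo k + int d}. E j * hit j) = of_bool (x (int k) = a) * (\<Sum>j\<in>{lo k..<lo k + int d}. E j)"
      unfolding sum_distrib_left by (intro sum.cong refl) (use hit[of k] d in auto)
    finally have "(1 - q) * (\<Sum>j\<in>{lo 0..<lo (Suc k)}. E j * hit j) =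
       (1 - q) * (\<Sum>j\<in>{lo 0..<lo k}. E j * hit j) +
       of_bool (x (int k) = a) * ((1 - q) * (\<Sum>j\<in>{lo k..<lo k + int d}. E j))"
      by (simp add: algebra_simps)
    then show ?case unfolding geo Suc.IH by (simp add: d)
  qed simp
  define A where "A = (\<Sum>j\<in>{lo 0..<lo n}. E j * hit j)"
  define tw where "tw = twisted_sum (($) s) \<omega> a (map (\<lambda>j. x (int j)) [0..<n])"
  \<comment> \<open>The phase at the exact passage time \<open>r i - u\<close>, which the sampling
    misses by at most \<open>\<tau>\<close>. With exact times all visits to \<open>a\<close> share
    the factor \<open>1 - e (- \<omega> * s $ a)\<close>, and what remains is the twisted sum of the
    word.\<close>
  define G where "G = (\<lambda>i. e (- \<omega> * (r i - u)))"
  have EG: "cmod (E (lo i) - G i) \<le> 2 * pi * (\<bar>\<omega>\<bar> * \<tau>)" for i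
  proof -
    have "cmod (E (lo i) - G i) \<le> 2 * pi * \<bar>- \<omega> * (of_int (lo i) * \<tau>) - - \<omega> * (r i - u)\<bar>"
      unfolding E_def G_def by (rule cmod_e_diff_le)
    also have "- \<omega> * (of_int (lo i) * \<tau>) - - \<omega> * (r i - u) = - \<omega> * (of_int (lo i) * \<tau> - (r i - u))"
      by (simp add: algebra_simps)
    also have "\<bar>\<dots>\<bar> = \<bar>\<omega>\<bar> * \<bar>of_int (lo i) * \<tau> - (r i - u)\<bar>" by (simp add: abs_mult)
    also have "2 * pi * \<dots> \<le> 2 * pi * (\<bar>\<omega>\<bar> * \<tau>)"
      using lo_ge[of i] lo_le[of i] by (intro mult_left_mono) auto
    finally show ?thesis .
  qed
  have Gsum: "(\<Sum>i<n. of_bool (x (int i) = a) * (G i - G (Suc i))) = e (\<omega> * u) * (1 - e (- \<omega> * s $ a)) * tw"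
  proof -
    have st: "of_bool (x (int i) = a) * (G i - G (Suc i)) = e (\<omega> * u) * (1 - e (- \<omega> * s $ a)) *
        (if x (int i) = a then e (- \<omega> * roof_sum s x (int i)) else 0)" for i
    proof (cases "x (int i) = a")
      case True
      have "G i = e (\<omega> * u) * e (- \<omega> * r i)"
        unfolding G_def e_add[symmetric] by (simp add: algebra_simps)
      moreover have "G (Suc i) = e (\<omega> * u) * e (- \<omega> * s $ a) * e (- \<omega> * r i)"
        using True unfolding G_def r_Suc e_add[symmetric] by (simp add: algebra_simps)
      ultimately show ?thesis using True by (simp add: r_def algebra_simps)
    qed simp
    show ?thesis unfolding tw_def twisted_sum_word sum_distrib_left by (rule sum.cong[OF refl st])
  qed
  have "(1 - q) * A = e (\<omega> * u) * (1 - e (- \<omega> * s $ a)) * tw +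
     (\<Sum>i<n. of_bool (x (int i) = a) * ((E (lo i) - G i) - (E (lo (Suc i)) - G (Suc i))))"
    unfolding A_def main Gsum[symmetric] sum.distrib[symmetric]
    by (intro sum.cong refl) (simp add: algebra_simps)
  also have "cmod \<dots> \<le> 2 * cmod tw + real n * (4 * pi * (\<bar>\<omega>\<bar> * \<tau>))"
  proof (rule order.trans[OF norm_triangle_ineq], rule add_mono)
    have "cmod (1 - e (- \<omega> * s $ a)) \<le> 2"
      using norm_triangle_ineq4[of 1 "e (- \<omega> * s $ a)"] by simp
    then show "cmod (e (\<omega> * u) * (1 - e (- \<omega> * s $ a)) * tw) \<le> 2 * cmod tw"
      by (simp add: norm_mult mult_right_mono)
    have "cmod (\<Sum>i<n. of_bool (x (int i) = a) * ((E (lo i) - G i) - (E (lo (Suc i)) - G (Suc i))))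
      \<le> (\<Sum>i<n. 4 * pi * (\<bar>\<omega>\<bar> * \<tau>))"
    proof (rule sum_norm_le)
      fix i
      have "cmod (of_bool (x (int i) = a) * ((E (lo i) - G i) - (E (lo (Suc i)) - G (Suc i))))
        \<le> cmod ((E (lo i) - G i) - (E (lo (Suc i)) - G (Suc i)))"
        by (cases "x (int i) = a") simp_all
      also have "\<dots> \<le> 4 * pi * (\<bar>\<omega>\<bar> * \<tau>)"
        using norm_triangle_ineq4[of "E (lo i) - G i" "E (lo (Suc i)) - G (Suc i)"] EG[of i] EG[of "Suc i"] by linarith
      finally show "cmod (of_bool (x (int i) = a) * ((E (lo i) - G i) - (E (lo (Suc i)) - G (Suc i)))) \<le> 4 * pi * (\<bar>\<omega>\<bar> * \<tau>)" .
    qed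
    then show "cmod (\<Sum>i<n. of_bool (x (int i) = a) * ((E (lo i) - G i) - (E (lo (Suc i)) - G (Suc i))))
      \<le> real n * (4 * pi * (\<bar>\<omega>\<bar> * \<tau>))" by simp
  qed
  finally have qA: "cmod (1 - q) * cmod A \<le> 2 * cmod tw + real n * (4 * pi * (\<bar>\<omega>\<bar> * \<tau>))"
    by (simp add: norm_mult)
  \<comment> \<open>Here \<open>\<bar>\<omega>\<bar> * \<tau> \<le> 1 / 3\<close> bounds the
    geometric denominator from below; dividing by it produces the factor
    \<open>1 / \<bar>\<omega>\<bar>\<close>.\<close>
  have "2 * (\<bar>\<omega>\<bar> * \<tau>) \<le> cmod (1 - q)"
    using cmod_one_minus_e_ge[of "- \<omega> * \<tau>"] \<tau> by (simp add: q_def abs_mult)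
  then have "2 * (\<bar>\<omega>\<bar> * \<tau>) * cmod A \<le> cmod (1 - q) * cmod A" by (rule mult_right_mono) simp
  with qA have "2 * \<bar>\<omega>\<bar> * (\<tau> * cmod A) \<le> 2 * cmod tw + real n * (4 * pi * (\<bar>\<omega>\<bar> * \<tau>))" by (simp add: mult_ac)
  then have bA: "\<tau> * cmod A \<le> cmod tw / \<bar>\<omega>\<bar> + 2 * pi * \<tau> * real n"
    using \<omega> by (simp add: field_simps)
  define S where "S = (\<Sum>j\<in>{0..<int N}. E j * hit j)"
  have S: "(\<Sum>j<N. e (- \<omega> * (real j * \<tau>)) * of_bool (fst (suspension_flow s (real j * \<tau>) (x, u)) 0 = a)) = S"
  proof -
    have "S = (\<Sum>j\<in>int ` {0..<N}. E j * hit j)" unfolding S_def by (simp add: image_int_atLeastLessThan)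
    also have "\<dots> = (\<Sum>j<N. E (int j) * hit (int j))" by (subst sum.reindex) (auto simp: atLeast0LessThan)
    finally show ?thesis by (simp add: E_def hit_def)
  qed
  have unit: "cmod (E j * hit j) \<le> 1" for j by (simp add: E_def hit_def norm_mult)
  \<comment> \<open>The sampled indices and those of the first \<open>n\<close> letters differ at
    the start by at most \<open>u / \<tau>\<close> indices, at the end by at most one roof height
    over \<open>\<tau>\<close>.\<close>
  let ?P = "{0..<int N}" and ?Q = "{lo 0..<lo n}"
  define S1 where "S1 = (\<Sum>j\<in>?P - ?Q. E j * hit j)"
  define S2 where "S2 = (\<Sum>j\<in>?Q - ?P. E j * hit j)"
  have "S = (\<Sum>j\<in>?P \<inter> ?Q. E j * hit j) + S1"
    unfolding S_def S1_def by (subst sum.Int_Diff[of _ _ ?Q]) auto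
  moreover have "A = (\<Sum>j\<in>?P \<inter> ?Q. E j * hit j) + S2"
    unfolding A_def S2_def by (subst sum.Int_Diff[of _ _ ?P]) (auto simp: Int_commute)
  ultimately have cS: "cmod S \<le> cmod A + cmod S1 + cmod S2"
    using norm_triangle_ineq4[of "A + S1" S2] norm_triangle_ineq[of A S1] by (simp add: algebra_simps)
  have lo_0: "lo 0 \<le> 0" using lo[of 0 0] u r0 by simp
  have lo_n: "lo n \<le> int N" using lo[of n "int N"] rn(1) by simp
  have norm_sum_le: "\<tau> * cmod (\<Sum>j\<in>J. E j * hit j) \<le> \<tau> * real (card J)" for J
    using sum_norm_le[of J "\<lambda>j. E j * hit j" "\<lambda>_. 1"] unit \<tau>(1) by simp
  have bP: "\<tau> * cmod S1 \<le> ?smax"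
  proof -
    have "card (?P - ?Q) \<le> card {lo n..<int N}" using lo_0 by (intro card_mono) auto
    then have "real (card (?P - ?Q)) \<le> real N - of_int (lo n)" using lo_n by simp
    then have "\<tau> * cmod S1 \<le> \<tau> * (real N - of_int (lo n))"
      unfolding S1_def using \<tau>(1) by (intro order.trans[OF norm_sum_le] mult_left_mono) auto
    also have "\<dots> \<le> real N * \<tau> - (r n - u)" using lo_ge[of n] by (simp add: algebra_simps)
    also have "\<dots> \<le> s $ x (int n)" using rn(2) r_Suc[of n] by simp
    finally show ?thesis using smax[of "x (int n)"] by linarith
  qed
  have bQ: "\<tau> * cmod S2 \<le> ?smax"
  proof -
    have "card (?Q - ?P) \<le> card {lo 0..<0}" using lo_n by (intro card_mono) auto
    then have "real (card (?Q - ?P)) \<le> - of_int (lo 0)" using lo_0 by simp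
    then have "\<tau> * cmod S2 \<le> \<tau> * (- of_int (lo 0))"
      unfolding S2_def using \<tau>(1) by (intro order.trans[OF norm_sum_le] mult_left_mono) auto
    also have "\<dots> \<le> u" using lo_ge[of 0] r0 by (simp add: algebra_simps)
    finally show ?thesis using u smax[of "x 0"] by linarith
  qed
  have "\<tau> * cmod S \<le> \<tau> * cmod A + ?smax + ?smax"
    using mult_left_mono[OF cS, of \<tau>] \<tau>(1) bP bQ unfolding distrib_left by linarith
  then show ?thesis using bA rn(1) S by (intro exI[of _ n]) (simp add: r_def tw_def)
qed

end

section \<open>Mean squares and spectral measures of intervals\<close>

lemma integral_double_sum:
  fixes f :: "nat \<Rightarrow> nat \<Rightarrow> 'c \<Rightarrow> complex"
  assumes "\<And>j l. integrable M (f j l)"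
  shows "(\<integral>x. (\<Sum>j<N. \<Sum>l<N. k j l * f j l x) \<partial>M) = (\<Sum>j<N. \<Sum>l<N. k j l * (\<integral>x. f j l x \<partial>M))"
proof -
  have int: "integrable M (\<lambda>x. k j l * f j l x)" for j l by (intro integrable_mult_right assms)
  have "(\<integral>x. (\<Sum>j<N. \<Sum>l<N. k j l * f j l x) \<partial>M) = (\<Sum>j<N. \<integral>x. (\<Sum>l<N. k j l * f j l x) \<partial>M)"
    by (rule Bochner_Integration.integral_sum) (intro Bochner_Integration.integrable_sum int)
  also have "\<dots> = (\<Sum>j<N. \<Sum>l<N. \<integral>x. k j l * f j l x \<partial>M)"
    by (intro sum.cong refl Bochner_Integration.integral_sum int)
  finally show ?thesis by (simp only: integral_mult_right_zero)
qed

text \<open>The mean square of the twisted sums is the integral of \<open>\<bar>\<Sum>\<^sub>j e((\<omega>' - \<omega>) j \<tau>)\<bar>\<^sup>2\<close> against the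
  spectral measure, and this kernel is at least \<open>N\<^sup>2 / 4\<close> on the interval.\<close>

lemma spectral_measure_interval_le:
  fixes F :: "nat \<Rightarrow> 'c \<Rightarrow> real" and \<sigma> :: "real measure"
  assumes \<sigma>: "finite_measure \<sigma>" "sets \<sigma> = sets borel" and m: "prob_space m"
    and F: "\<And>j. F j \<in> borel_measurable m" "\<And>j p. p \<in> space m \<Longrightarrow> \<bar>F j p\<bar> \<le> 1"
    and corr: "\<And>j l. (\<integral>w. e (w * ((real j - real l) * \<tau>)) \<partial>\<sigma>) = of_real (\<integral>p. F j p * F l p \<partial>m)"
    and bound: "\<And>p. p \<in> space m \<Longrightarrow> cmod (\<Sum>j<N. e (- \<omega> * (real j * \<tau>)) * of_real (F j p)) \<le> M"
    and par: "0 \<le> \<tau>" "0 \<le> r" "r * (real N * \<tau>) \<le> 1 / 6" "1 \<le> N"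
  shows "measure \<sigma> {\<omega> - r..\<omega> + r} \<le> 4 * M\<^sup>2 / (real N)\<^sup>2"
proof -
  interpret \<sigma>: finite_measure \<sigma> by (rule \<sigma>)
  interpret m: prob_space m by (rule m)
  have e_meas[measurable]: "e \<in> borel_measurable borel"
    unfolding e_def by (intro borel_measurable_continuous_onI continuous_intros)
  have [measurable]: "F j \<in> borel_measurable m" for j by (rule F)
  have [measurable_cong]: "sets \<sigma> = sets borel" by (rule \<sigma>)
  define c where "c = (\<lambda>j. e (- \<omega> * (real j * \<tau>)))"
  define k where "k = (\<lambda>w. \<Sum>j<N. e ((w - \<omega>) * (real j * \<tau>)))"
  have sq: "of_real ((cmod (\<Sum>j<N. f j))\<^sup>2) = (\<Sum>j<N. \<Sum>l<N. f j * cnj (f l))" for f :: "nat \<Rightarrow> complex"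
    unfolding complex_norm_square by (simp add: sum_product cnj_sum)
  have intF: "integrable m (\<lambda>p. F j p * F l p)" for j l
  proof (rule m.integrable_const_bound[of _ 1])
    show "AE p in m. norm (F j p * F l p) \<le> 1"
      using F(2) by (intro AE_I2) (auto simp: abs_mult intro: mult_le_one)
  qed simp
  have inte: "integrable \<sigma> (\<lambda>w. e (w * t))" for t
    by (rule \<sigma>.integrable_const_bound[of _ 1]) auto
  have "complex_of_real (\<integral>p. (cmod (\<Sum>j<N. c j * of_real (F j p)))\<^sup>2 \<partial>m) =
      (\<integral>p. (\<Sum>j<N. \<Sum>l<N. c j * cnj (c l) * of_real (F j p * F l p)) \<partial>m)"
    unfolding integral_complex_of_real[symmetric] sq by (simp add: mult_ac)
  also have "\<dots> = (\<Sum>j<N. \<Sum>l<N. c j * cnj (c l) * of_real (\<integral>p. F j p * F l p \<partial>m))"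
    by (subst integral_double_sum) (auto intro: integrable_of_real intF simp del: of_real_mult)
  also have "\<dots> = (\<Sum>j<N. \<Sum>l<N. c j * cnj (c l) * (\<integral>w. e (w * ((real j - real l) * \<tau>)) \<partial>\<sigma>))"
    by (simp only: corr)
  also have "\<dots> = (\<integral>w. (\<Sum>j<N. \<Sum>l<N. c j * cnj (c l) * e (w * ((real j - real l) * \<tau>))) \<partial>\<sigma>)"
    by (rule integral_double_sum[symmetric]) (rule inte)
  also have "\<dots> = (\<integral>w. of_real ((cmod (k w))\<^sup>2) \<partial>\<sigma>)"
  proof (intro arg_cong[where f = "lebesgue_integral \<sigma>"] ext)
    fix w
    show "(\<Sum>j<N. \<Sum>l<N. c j * cnj (c l) * e (w * ((real j - real l) * \<tau>))) = of_real ((cmod (k w))\<^sup>2)"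
      unfolding k_def sq
      unfolding c_def cnj_e e_add[symmetric]
      by (intro sum.cong refl) (simp add: algebra_simps)
  qed
  also have "\<dots> = of_real (\<integral>w. (cmod (k w))\<^sup>2 \<partial>\<sigma>)" by (rule integral_complex_of_real)
  finally have eq: "(\<integral>p. (cmod (\<Sum>j<N. c j * of_real (F j p)))\<^sup>2 \<partial>m) = (\<integral>w. (cmod (k w))\<^sup>2 \<partial>\<sigma>)"
    using of_real_eq_iff by blast
  have kle: "cmod (k w) \<le> real N" for w
    unfolding k_def using sum_norm_le[of "{..<N}" "\<lambda>j. e ((w - \<omega>) * (real j * \<tau>))" "\<lambda>_. 1"] by simp
  have kmeas[measurable]: "k \<in> borel_measurable borel" unfolding k_def by measurable
  have intk: "integrable \<sigma> (\<lambda>w. (cmod (k w))\<^sup>2)"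
  proof (rule \<sigma>.integrable_const_bound[of _ "(real N)\<^sup>2"])
    show "AE w in \<sigma>. norm ((cmod (k w))\<^sup>2) \<le> (real N)\<^sup>2"
      using kle by (intro AE_I2) (simp add: power_mono)
  qed simp
  \<comment> \<open>Phases up to \<open>2 * pi / 6\<close> have cosine at least
    \<open>1 / 2\<close>; this is the origin of the bound \<open>1 / 6\<close> on
    \<open>r * (N * \<tau>)\<close>.\<close>
  have kge: "real N / 2 \<le> cmod (k w)" if w: "w \<in> {\<omega> - r..\<omega> + r}" for w
  proof -
    have "(\<Sum>j<N. 1 / 2) \<le> (\<Sum>j<N. Re (e ((w - \<omega>) * (real j * \<tau>))))"
    proof (rule sum_mono)
      fix j assume "j \<in> {..<N}"
      then have jt: "real j * \<tau> \<le> real N * \<tau>" using par by (intro mult_right_mono) auto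
      have "\<bar>w - \<omega>\<bar> * (real j * \<tau>) \<le> r * (real N * \<tau>)"
        by (rule mult_mono[OF _ jt]) (use w par in auto)
      then have a: "\<bar>(w - \<omega>) * (real j * \<tau>)\<bar> \<le> 1 / 6" using par by (simp add: abs_mult)
      have "cos (pi / 3) \<le> cos (2 * pi * \<bar>(w - \<omega>) * (real j * \<tau>)\<bar>)"
      proof (rule cos_monotone_0_pi_le)
        show "2 * pi * \<bar>(w - \<omega>) * (real j * \<tau>)\<bar> \<le> pi / 3"
          using mult_left_mono[OF a, of "2 * pi"] by simp
      qed auto
      also have "\<dots> = cos (2 * pi * ((w - \<omega>) * (real j * \<tau>)))"
        by (cases "0 \<le> (w - \<omega>) * (real j * \<tau>)") (auto simp: abs_if)
      finally show "1 / 2 \<le> Re (e ((w - \<omega>) * (real j * \<tau>)))" by (simp add: e_def cos_60)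
    qed
    also have "\<dots> = Re (k w)" by (simp add: k_def)
    also have "\<dots> \<le> cmod (k w)" by (rule complex_Re_le_cmod)
    finally show ?thesis by simp
  qed
  have "(real N / 2)\<^sup>2 * measure \<sigma> {\<omega> - r..\<omega> + r} = (\<integral>w. (real N / 2)\<^sup>2 * indicator {\<omega> - r..\<omega> + r} w \<partial>\<sigma>)"
    by simp
  also have "\<dots> \<le> (\<integral>w. (cmod (k w))\<^sup>2 \<partial>\<sigma>)"
  proof (rule integral_mono)
    show "integrable \<sigma> (\<lambda>w. (real N / 2)\<^sup>2 * indicator {\<omega> - r..\<omega> + r} w)"
      by (intro integrable_mult_right) (simp add: integrable_indicator_iff \<sigma>.emeasure_finite less_top[symmetric])
    show "(real N / 2)\<^sup>2 * indicator {\<omega> - r..\<omega> + r} w \<le> (cmod (k w))\<^sup>2" for w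
    proof (cases "w \<in> {\<omega> - r..\<omega> + r}")
      case True
      then show ?thesis using kge[OF True] by (simp add: power_mono)
    qed simp
  qed (rule intk)
  also have "\<dots> = (\<integral>p. (cmod (\<Sum>j<N. c j * of_real (F j p)))\<^sup>2 \<partial>m)" by (rule eq[symmetric])
  also have "\<dots> \<le> (\<integral>p. M\<^sup>2 \<partial>m)"
  proof (rule integral_mono_AE')
    show "integrable m (\<lambda>p. M\<^sup>2)" by simp
    show "AE p in m. (cmod (\<Sum>j<N. c j * of_real (F j p)))\<^sup>2 \<le> M\<^sup>2"
      using bound by (intro AE_I2 power_mono) (auto simp: c_def)
  qed (auto intro: AE_I2)
  also have "\<dots> = M\<^sup>2" by (simp add: m.prob_space)
  finally show ?thesis using par(4) by (simp add: field_simps power2_eq_square)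
qed

section \<open>Correlations in the symbolic coding\<close>

lemma space_suspension_invariant_prob:
  assumes "suspension_invariant_prob \<zeta> s m"
  shows "space m = suspension_space \<zeta> s"
proof -
  have "sets m = sets (restrict_space ((\<Pi>\<^sub>M i\<in>UNIV. count_space UNIV) \<Otimes>\<^sub>M borel) (suspension_space \<zeta> s))"
    using assms unfolding suspension_invariant_prob_def by blast
  then have "space m = space (restrict_space ((\<Pi>\<^sub>M i\<in>UNIV. count_space UNIV) \<Otimes>\<^sub>M borel) (suspension_space \<zeta> s))"
    by (rule sets_eq_imp_space_eq)
  then show ?thesis by (simp add: space_restrict_space space_pair_measure space_PiM)
qed

lemma suspension_cell_sets:
  fixes s :: "real ^ 'b::finite"
  assumes "suspension_invariant_prob \<zeta> s m"
  shows "suspension_cell \<zeta> s a \<in> sets m"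
proof -
  let ?P = "(\<Pi>\<^sub>M i\<in>(UNIV::int set). count_space (UNIV::'b set)) \<Otimes>\<^sub>M (borel :: real measure)"
  have m: "sets m = sets (restrict_space ?P (suspension_space \<zeta> s))"
    using assms unfolding suspension_invariant_prob_def by blast
  have f: "(\<lambda>p. fst p 0) \<in> measurable ?P (count_space UNIV)" by measurable
  then have "(\<lambda>p. fst p 0) \<in> measurable (restrict_space ?P (suspension_space \<zeta> s)) (count_space UNIV)"
    by (rule measurable_restrict_space1)
  then have "(\<lambda>p. fst p 0) \<in> measurable m (count_space UNIV)"
    by (subst measurable_cong_sets[OF m refl])
  then have "(\<lambda>p. fst p 0) -` {a} \<inter> space m \<in> sets m" by (rule measurable_sets) simp
  moreover have "(\<lambda>p. fst p 0) -` {a} \<inter> space m = suspension_cell \<zeta> s a"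
    unfolding space_suspension_invariant_prob[OF assms] suspension_cell_def by auto
  ultimately show ?thesis by simp
qed

text \<open>Cells correspond under \<open>\<Psi>\<close> only on \<open>D\<close>, and the conjugacy
  holds almost everywhere; since \<open>m\<close> is invariant, the flow also maps almost every
  point into \<open>D\<close>. Restricting to \<open>D\<close> and its image transports the integral
  from \<open>\<nu>\<close> to \<open>m\<close>.\<close>

lemma spectral_measure_coding_cell:
  fixes s :: "real ^ 'b::finite"
  assumes m: "suspension_invariant_prob \<zeta> s m" and iso: "mod0_isomorphism m \<nu> D \<Psi>"
    and conj: "AE p in m. \<Psi> (suspension_flow s t p) = \<phi> t (\<Psi> p)"
    and \<phi>: "\<phi> t \<in> measurable \<nu> \<nu>"
    and \<sigma>: "spectral_measure \<nu> \<phi> (indicator (coding_cell \<zeta> s D \<Psi> a)) \<sigma>"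
  shows "(\<integral>w. e (w * t) \<partial>\<sigma>) = of_real
    (\<integral>p. indicator (suspension_cell \<zeta> s a) (suspension_flow s t p) * indicator (suspension_cell \<zeta> s a) p \<partial>m)"
proof -
  let ?A = "suspension_cell \<zeta> s a"
  define h where "h = suspension_flow s t"
  have h[measurable]: "h \<in> measurable m m" and hm: "distr m m h = m"
    using m unfolding suspension_invariant_prob_def h_def by blast+
  have A[measurable]: "?A \<in> sets m" by (rule suspension_cell_sets[OF m])
  define E where "E = \<Psi> ` D"
  have D[measurable]: "D \<in> sets m" and D0: "emeasure m (space m - D) = 0"
    and E: "E \<in> sets \<nu>" and E0: "emeasure \<nu> (space \<nu> - E) = 0" and inj: "inj_on \<Psi> D"
    and \<Psi>: "\<Psi> \<in> measurable (restrict_space m D) (restrict_space \<nu> E)"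
    and \<Psi>i: "the_inv_into D \<Psi> \<in> measurable (restrict_space \<nu> E) (restrict_space m D)"
    and \<Psi>d: "distr (restrict_space m D) (restrict_space \<nu> E) \<Psi> = restrict_space \<nu> E"
    using iso unfolding mod0_isomorphism_def E_def by blast+
  have Dsp: "D \<inter> space m = D" and Esp: "E \<inter> space \<nu> = E"
    using sets.sets_into_space[OF D] sets.sets_into_space[OF E] by blast+
  have aeD: "AE p in m. p \<in> D"
    by (rule AE_I[of _ _ "space m - D"]) (use D0 in auto)
  have aeE: "AE p in \<nu>. p \<in> E"
    by (rule AE_I[of _ _ "space \<nu> - E"]) (use E0 E in auto)
  define Q where "Q = coding_cell \<zeta> s D \<Psi> a"
  have Q: "Q = \<Psi> ` (?A \<inter> D)" by (simp add: Q_def coding_cell_def)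
  have inQ: "\<Psi> p \<in> Q \<longleftrightarrow> p \<in> ?A" if "p \<in> D" for p
    using that inj unfolding Q by (auto dest: inj_onD)
  have Q_sets: "Q \<in> sets \<nu>"
  proof -
    have "the_inv_into D \<Psi> -` (?A \<inter> D) \<inter> space (restrict_space \<nu> E) \<in> sets (restrict_space \<nu> E)"
      by (rule measurable_sets[OF \<Psi>i]) (use A D in \<open>auto simp: sets_restrict_space_iff Dsp\<close>)
    moreover have "the_inv_into D \<Psi> -` (?A \<inter> D) \<inter> space (restrict_space \<nu> E) = Q"
      using Esp inj unfolding Q E_def by (auto simp: space_restrict_space the_inv_into_f_f)
    ultimately show ?thesis using E by (simp add: sets_restrict_space_iff Esp)
  qed
  define G :: "'a \<Rightarrow> complex" where "G = (\<lambda>p. indicator Q (\<phi> t p) * cnj (indicator Q p))"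
  have G: "G \<in> borel_measurable \<nu>"
  proof -
    have q: "indicator Q \<in> borel_measurable \<nu>" using Q_sets by (rule borel_measurable_indicator)
    have "(\<lambda>p. indicator Q (\<phi> t p) :: complex) \<in> borel_measurable \<nu>"
      using measurable_compose[OF \<phi> q] .
    moreover have "(\<lambda>p. cnj (indicator Q p)) \<in> borel_measurable \<nu>"
      using q by (intro borel_measurable_continuous_on[OF _ q]) (intro continuous_intros)
    ultimately show ?thesis unfolding G_def by (rule borel_measurable_times)
  qed
  have "(\<integral>w. e (w * t) \<partial>\<sigma>) = (\<integral>w. exp (2 * of_real pi * \<i> * of_real w * of_real t) \<partial>\<sigma>)"
    by (simp add: e_def cis_conv_exp mult_ac)
  also have "\<dots> = (\<integral>p. G p \<partial>\<nu>)"
    using \<sigma> unfolding spectral_measure_def G_def Q_def by blast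
  also have "\<dots> = (\<integral>p. indicator E p *\<^sub>R G p \<partial>\<nu>)"
  proof (rule integral_cong_AE)
    show "AE p in \<nu>. G p = indicator E p *\<^sub>R G p" using aeE by eventually_elim simp
    show "(\<lambda>p. indicator E p *\<^sub>R G p) \<in> borel_measurable \<nu>"
      by (intro borel_measurable_scaleR borel_measurable_indicator E G)
  qed (rule G)
  also have "\<dots> = integral\<^sup>L (restrict_space \<nu> E) G"
    by (rule integral_restrict_space[symmetric]) (simp add: Esp E)
  also have "\<dots> = integral\<^sup>L (distr (restrict_space m D) (restrict_space \<nu> E) \<Psi>) G" by (simp only: \<Psi>d)
  also have "\<dots> = (\<integral>p. G (\<Psi> p) \<partial>restrict_space m D)"
    by (rule integral_distr[OF \<Psi>]) (rule measurable_restrict_space1[OF G])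
  also have "\<dots> = (\<integral>p. indicator D p *\<^sub>R G (\<Psi> p) \<partial>m)"
    by (rule integral_restrict_space) (simp add: Dsp D)
  also have "\<dots> = (\<integral>p. of_real (indicator ?A (h p) * indicator ?A p) \<partial>m)"
  proof (rule integral_cong_AE)
    have "(\<lambda>p. G (\<Psi> p)) \<in> borel_measurable (restrict_space m D)"
      by (rule measurable_compose[OF \<Psi>]) (rule measurable_restrict_space1[OF G])
    then show "(\<lambda>p. indicator D p *\<^sub>R G (\<Psi> p)) \<in> borel_measurable m"
      using borel_measurable_restrict_space_iff[of D m "\<lambda>p. G (\<Psi> p)"] D Dsp by simp
    have "AE p in distr m m h. p \<in> D" unfolding hm by (rule aeD)
    then have "AE p in m. h p \<in> D" by (rule AE_distrD[OF h])
    then show "AE p in m. indicator D p *\<^sub>R G (\<Psi> p) = of_real (indicator ?A (h p) * indicator ?A p)"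
      using aeD conj
    proof eventually_elim
      case (elim p)
      then have "\<phi> t (\<Psi> p) = \<Psi> (h p)" by (simp add: h_def)
      then show ?case using inQ[of p] inQ[of "h p"] elim by (auto simp: G_def indicator_def)
    qed
  qed measurable
  also have "\<dots> = of_real (\<integral>p. indicator ?A (h p) * indicator ?A p \<partial>m)"
    by (rule integral_complex_of_real)
  finally show ?thesis by (simp add: h_def)
qed

text \<open>Invariance under the map of time \<open>t'\<close>, combined with the group property,
  which holds at every point.\<close>

lemma suspension_correlation:
  fixes s :: "real ^ 'b::finite"
  assumes s: "\<And>b. 0 < s $ b" and m: "suspension_invariant_prob \<zeta> s m" and A: "A \<in> sets m"
  shows "(\<integral>p. indicator A (suspension_flow s t p) * indicator A (suspension_flow s t' p) \<partial>m) =
    (\<integral>p. (indicator A (suspension_flow s (t - t') p) * indicator A p :: real) \<partial>m)"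
proof -
  have h: "suspension_flow s t \<in> measurable m m" "distr m m (suspension_flow s t) = m" for t
    using m unfolding suspension_invariant_prob_def by blast+
  have "(\<integral>p. (indicator A (suspension_flow s (t - t') p) * indicator A p :: real) \<partial>m) =
    (\<integral>p. indicator A (suspension_flow s (t - t') p) * indicator A p \<partial>distr m m (suspension_flow s t'))"
    by (simp only: h(2))
  also have "\<dots> = (\<integral>p. indicator A (suspension_flow s (t - t') (suspension_flow s t' p)) *
      indicator A (suspension_flow s t' p) \<partial>m)"
  proof (rule integral_distr[OF h(1)])
    have "(\<lambda>p. indicator A (suspension_flow s (t - t') p) :: real) \<in> borel_measurable m"
      using A by (intro measurable_compose[OF h(1)] borel_measurable_indicator)
    then show "(\<lambda>p. indicator A (suspension_flow s (t - t') p) * indicator A p :: real) \<in> borel_measurable m"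
      using A by (intro borel_measurable_times borel_measurable_indicator)
  qed
  finally show ?thesis by (simp add: suspension_flow_add[OF s])
qed

text \<open>The ends of the orbit piece and the sampling contribute bounded errors, absorbed because
  \<open>R * ln R powr - \<gamma> \<ge> 1\<close>. What remains is the twisted sum of a word of
  length at most \<open>smax + R\<close>, which has about \<open>log R\<close> levels.\<close>

lemma normalized_twisted_sum_le:
  fixes s :: "real ^ 'b::finite" and \<theta> \<gamma> B C0 :: real
  assumes es: "expanding_substitution \<zeta> (($) s) \<theta>" and \<gamma>: "0 < \<gamma>" "\<gamma> \<le> 1" and B: "B > 1"
    and tw: "C0 > 0" "\<And>\<omega> a w n b T. 1 / B \<le> \<bar>\<omega>\<bar> \<Longrightarrow> \<bar>\<omega>\<bar> \<le> B \<Longrightarrow> 1 \<le> T \<Longrightarrow>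
      sublist w ((subst_word \<zeta> ^^ n) [b]) \<Longrightarrow> expanding_substitution.len (($) s) w < expanding_substitution.smin (($) s) * \<theta> ^ T \<Longrightarrow>
      cmod (twisted_sum (($) s) \<omega> a w) \<le> C0 * \<theta> ^ T * real T powr - \<gamma>"
  shows "\<exists>C>0. \<exists>R0\<ge>6. \<forall>R\<ge>R0. \<exists>N \<tau>. 1 \<le> N \<and> 0 < \<tau> \<and> real N * \<tau> = R \<and>
    (\<forall>\<omega> a p. 1 / B \<le> \<bar>\<omega>\<bar> \<longrightarrow> \<bar>\<omega>\<bar> \<le> B \<longrightarrow> p \<in> suspension_space \<zeta> s \<longrightarrow>
      cmod (\<Sum>j<N. e (- \<omega> * (real j * \<tau>)) * of_bool (fst (suspension_flow s (real j * \<tau>) p) 0 = a))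
        \<le> C * real N * ln R powr - \<gamma>)"
proof -
  interpret expanding_substitution \<zeta> "($) s" \<theta> by (rule es)
  have spos: "0 < s $ b" for b by (rule s_pos)
  have ln\<theta>: "0 < ln \<theta>" using theta_gt_1 by simp
  define K1 where "K1 = B * C0 * (\<theta>\<^sup>2 * (smax + 1) / smin) * (2 * ln \<theta>) powr \<gamma>"
  define K2 where "K2 = 2 * pi * ((smax + 1) / smin) + 2 * smax"
  define C where "C = K1 + K2"
  have K1: "K1 > 0" unfolding K1_def using B tw(1) theta_gt_1 smax_pos smin_pos ln\<theta> by simp
  have K2: "K2 > 0" unfolding K2_def using smax_pos smin_pos by (simp add: add_pos_pos)
  \<comment> \<open>\<open>smin\<^sup>2 \<le> R\<close> gives \<open>sqrt R \<le> X\<close> below,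
    so that the number \<open>T\<close> of levels is at least
    \<open>ln R / (2 * ln \<theta>)\<close>. The 6 makes \<open>ln R\<close> positive and is used
    again when \<open>R\<close> is compared with \<open>1 / r\<close>.\<close>
  define R0 where "R0 = max 6 (smin\<^sup>2)"
  show ?thesis
  proof (rule exI[of _ C], intro conjI, goal_cases)
    case 2
    show ?case
    proof (rule exI[of _ R0], intro conjI allI impI, goal_cases)
      case (2 R)
      then have R: "6 \<le> R" "smin\<^sup>2 \<le> R" by (auto simp: R0_def)
      \<comment> \<open>\<open>3 * B * R\<close> ensures \<open>B * \<tau> \<le> 1 / 3\<close>, and
        \<open>R\<^sup>2\<close> ensures \<open>\<tau> \<le> 1 / R\<close>, so that the error
        \<open>2 * pi * \<tau> * real n\<close> stays bounded although \<open>n\<close> is of order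
        \<open>R\<close>.\<close>
      define N where "N = nat \<lceil>3 * B * R + R\<^sup>2\<rceil>"
      have N: "3 * B * R + R\<^sup>2 \<le> real N" unfolding N_def by linarith
      have BR: "0 < 3 * B * R" "1 \<le> R\<^sup>2" using B R by (simp_all add: one_le_power)
      have N1: "1 \<le> real N" using N BR by linarith
      define \<tau> where "\<tau> = R / real N"
      have \<tau>: "0 < \<tau>" using R N1 by (simp add: \<tau>_def)
      have N\<tau>: "real N * \<tau> = R" using N1 by (simp add: \<tau>_def)
      have \<tau>R: "\<tau> \<le> 1 / R"
      proof -
        have "R * R \<le> real N" using N BR by (simp add: power2_eq_square)
        then show ?thesis using R N1 by (simp add: \<tau>_def field_simps)
      qed
      have \<tau>B: "B * \<tau> \<le> 1 / 3"
      proof -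
        have "3 * (B * R) \<le> real N" using N BR by simp
        then show ?thesis using N1 by (simp add: \<tau>_def field_simps)
      qed
      have lnR: "0 < ln R" using R by simp
      define L where "L = ln R powr - \<gamma>"
      have L: "0 < L" using lnR by (simp add: L_def)
      have RL: "1 \<le> R * L"
      proof -
        have "ln R \<le> R" using ln_bound[of R] R by linarith
        then have "ln R powr \<gamma> \<le> R powr \<gamma>" using lnR \<gamma> R by (intro powr_mono2) auto
        also have "\<dots> \<le> R powr 1" using R \<gamma> by (intro powr_mono) auto
        finally have "ln R powr \<gamma> \<le> R" using R by simp
        then show ?thesis using lnR by (simp add: L_def powr_minus field_simps)
      qed
      define X where "X = (smax + R) / smin"
      have X1: "1 \<le> X"
      proof -
        have "smin \<le> smax" using smin_le smax_ge order.trans by blast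
        then show ?thesis using smin_pos R by (simp add: X_def)
      qed
      \<comment> \<open>One more than the ceiling gives the strict inequality
        \<open>X < \<theta> ^ T\<close>; the excess costs at most a factor
        \<open>\<theta>\<^sup>2\<close>.\<close>
      define T where "T = nat \<lceil>log \<theta> X\<rceil> + 1"
      have l0: "0 \<le> log \<theta> X" using X1 theta_gt_1 by (simp add: zero_le_log_cancel_iff)
      have T: "log \<theta> X < real T" "real T \<le> log \<theta> X + 2" "1 \<le> T"
        using l0 unfolding T_def by linarith+
      have XT: "X < \<theta> ^ T"
      proof -
        have "X = \<theta> powr log \<theta> X" using X1 theta_gt_1 by (intro powr_log_cancel[symmetric]) auto
        also have "\<dots> < \<theta> powr real T" using T theta_gt_1 by (intro powr_less_mono) auto
        finally show ?thesis using theta_gt_1 by (simp add: powr_realpow)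
      qed
      have TX: "\<theta> ^ T \<le> \<theta>\<^sup>2 * X"
      proof -
        have "\<theta> ^ T = \<theta> powr real T" using theta_gt_1 by (simp add: powr_realpow)
        also have "\<dots> \<le> \<theta> powr (log \<theta> X + 2)" using T theta_gt_1 by (intro powr_mono) auto
        also have "\<dots> = X * \<theta>\<^sup>2" using theta_gt_1 X1 by (simp add: powr_add powr_numeral)
        finally show ?thesis by (simp add: mult.commute)
      qed
      have XR: "X \<le> (smax + 1) / smin * R"
      proof -
        have "smax * 1 \<le> smax * R" using R smax_pos by (intro mult_left_mono) auto
        then show ?thesis using smin_pos by (simp add: X_def field_simps)
      qed
      have TL: "real T powr - \<gamma> \<le> (2 * ln \<theta>) powr \<gamma> * L"
      proof -
        have "sqrt R \<le> X"
        proof -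
          have "smin \<le> sqrt R" using R(2) by (simp add: real_le_rsqrt)
          then have "smin * sqrt R \<le> sqrt R * sqrt R" using R by (intro mult_right_mono) auto
          also have "\<dots> = R" using R by simp
          also have "\<dots> \<le> smax + R" using smax_pos by simp
          finally show ?thesis using smin_pos by (simp add: X_def field_simps)
        qed
        then have "ln (sqrt R) \<le> ln X" using R X1 by (subst ln_le_cancel_iff) auto
        then have "ln R / 2 \<le> ln X" using R by (simp add: ln_sqrt)
        then have "ln R / 2 / ln \<theta> \<le> ln X / ln \<theta>" using ln\<theta> by (intro divide_right_mono) auto
        then have "ln R / (2 * ln \<theta>) \<le> log \<theta> X"
          by (simp add: log_def)
        then have "ln R / (2 * ln \<theta>) \<le> real T" using T by linarith
        then have "real T powr - \<gamma> \<le> (ln R / (2 * ln \<theta>)) powr - \<gamma>"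
          using lnR ln\<theta> \<gamma> by (intro powr_mono2') auto
        also have "\<dots> = (2 * ln \<theta>) powr \<gamma> * L"
          using lnR ln\<theta> by (simp add: L_def powr_divide powr_minus field_simps)
        finally show ?thesis .
      qed
      show ?case
      proof (rule exI[of _ N], rule exI[of _ \<tau>], intro conjI allI impI)
        fix \<omega> a p
        assume \<omega>: "1 / B \<le> \<bar>\<omega>\<bar>" "\<bar>\<omega>\<bar> \<le> B" and p: "p \<in> suspension_space \<zeta> s"
        obtain x u where xu: "p = (x, u)" by (cases p)
        have x: "x \<in> subst_shift_space \<zeta>" "0 \<le> u" "u < s $ x 0"
          using p by (auto simp: xu suspension_space_def)
        have \<omega>0: "0 < \<bar>\<omega>\<bar>" using \<omega>(1) B by (intro less_le_trans[OF _ \<omega>(1)]) simp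
        have "\<bar>\<omega>\<bar> * \<tau> \<le> B * \<tau>" using \<omega> \<tau> by (intro mult_right_mono) auto
        with \<tau>B have \<omega>\<tau>: "\<bar>\<omega>\<bar> * \<tau> \<le> 1 / 3" by linarith
        have "\<omega> \<noteq> 0" using \<omega>0 by simp
        then obtain n where n: "roof_sum s x (int n) \<le> u + real N * \<tau>"
          "\<tau> * cmod (\<Sum>j<N. e (- \<omega> * (real j * \<tau>)) * of_bool (fst (suspension_flow s (real j * \<tau>) (x, u)) 0 = a))
            \<le> cmod (twisted_sum (($) s) \<omega> a (map (\<lambda>j. x (int j)) [0..<n])) / \<bar>\<omega>\<bar>
              + 2 * pi * \<tau> * real n + 2 * Max (range (($) s))"
          using discrete_twisted_sum_le[where s = s and x = x and u = u and \<tau> = \<tau> and \<omega> = \<omega> and N = N and a = a,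
              OF spos x(2,3) \<tau> \<omega>\<tau>] by blast
        define w where "w = map (\<lambda>j. x (int j)) [0..<n]"
        have lenw: "len w \<le> smax + R"
          using n(1) x(3) smax_ge[of "x 0"] unfolding len_def w_def roof_sum_word[symmetric] N\<tau> by linarith
        have "\<exists>k b. sublist (map (\<lambda>j. x (0 + int j)) [0..<n]) ((subst_word \<zeta> ^^ k) [b])"
          using x(1) unfolding subst_shift_space_def by blast
        then obtain k b where "sublist w ((subst_word \<zeta> ^^ k) [b])" by (auto simp: w_def)
        moreover have "len w < smin * \<theta> ^ T"
        proof -
          have "smax + R = smin * X" using smin_pos by (simp add: X_def)
          also have "\<dots> < smin * \<theta> ^ T" using XT smin_pos by simp
          finally show ?thesis using lenw by linarith
        qed
        ultimately have "cmod (twisted_sum (($) s) \<omega> a w) \<le> C0 * \<theta> ^ T * real T powr - \<gamma>"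
          by (rule tw(2)[OF \<omega> T(3)])
        also have "\<dots> \<le> C0 * (\<theta>\<^sup>2 * ((smax + 1) / smin * R)) * ((2 * ln \<theta>) powr \<gamma> * L)"
        proof (intro mult_mono TL)
          have "\<theta>\<^sup>2 * X \<le> \<theta>\<^sup>2 * ((smax + 1) / smin * R)" using XR by (intro mult_left_mono) auto
          with TX show "\<theta> ^ T \<le> \<theta>\<^sup>2 * ((smax + 1) / smin * R)" by linarith
        qed (use tw(1) theta_gt_1 smax_pos smin_pos R in auto)
        finally have t1: "cmod (twisted_sum (($) s) \<omega> a w) \<le> C0 * (\<theta>\<^sup>2 * ((smax + 1) / smin * R)) * ((2 * ln \<theta>) powr \<gamma> * L)" .
        have "cmod (twisted_sum (($) s) \<omega> a w) / \<bar>\<omega>\<bar> \<le> cmod (twisted_sum (($) s) \<omega> a w) * B"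
        proof -
          have "1 / \<bar>\<omega>\<bar> \<le> B" using \<omega>(1) \<omega>0 B by (simp add: field_simps)
          then show ?thesis using mult_left_mono[of "1 / \<bar>\<omega>\<bar>" B "cmod (twisted_sum (($) s) \<omega> a w)"] by simp
        qed
        also have "\<dots> \<le> C0 * (\<theta>\<^sup>2 * ((smax + 1) / smin * R)) * ((2 * ln \<theta>) powr \<gamma> * L) * B"
          using t1 B by (intro mult_right_mono) auto
        also have "\<dots> = K1 * (R * L)" by (simp add: K1_def)
        finally have b1: "cmod (twisted_sum (($) s) \<omega> a w) / \<bar>\<omega>\<bar> \<le> K1 * (R * L)" .
        have b2: "2 * pi * \<tau> * real n \<le> 2 * pi * ((smax + 1) / smin)"
        proof -
          have "smin * real n \<le> len w" using len_ge_length[of w] by (simp add: w_def)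
          then have "real n \<le> X" using lenw smin_pos by (simp add: X_def field_simps)
          then have "\<tau> * real n \<le> 1 / R * ((smax + 1) / smin * R)"
            using XR \<tau>R R \<tau> by (intro mult_mono) auto
          also have "\<dots> = (smax + 1) / smin" using R by simp
          finally have "2 * pi * (\<tau> * real n) \<le> 2 * pi * ((smax + 1) / smin)"
            by (intro mult_left_mono) auto
          then show ?thesis by (simp only: mult.assoc)
        qed
        have "\<tau> * cmod (\<Sum>j<N. e (- \<omega> * (real j * \<tau>)) * of_bool (fst (suspension_flow s (real j * \<tau>) (x, u)) 0 = a))
           \<le> K1 * (R * L) + K2"
          using n(2) b1 b2 unfolding w_def[symmetric] K2_def smax_def by linarith
        also have "\<dots> \<le> K1 * (R * L) + K2 * (R * L)" using mult_left_mono[OF RL, of K2] K2 by simp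
        also have "\<dots> = \<tau> * (C * real N * L)" by (simp add: C_def N\<tau>[symmetric] algebra_simps)
        finally show "cmod (\<Sum>j<N. e (- \<omega> * (real j * \<tau>)) * of_bool (fst (suspension_flow s (real j * \<tau>) p) 0 = a))
          \<le> C * real N * ln R powr - \<gamma>"
          using \<tau> by (simp add: xu L_def)
      qed (use N1 \<tau> N\<tau> in auto)
    qed (simp add: R0_def)
  qed (use K1 K2 in \<open>simp add: C_def\<close>)
qed

theorem corollary5p4:
  fixes X :: "'a topology"
    and Sing :: "'a set"
    and At :: "('a set \<times> ('a \<Rightarrow> complex)) set"
    and g :: "'a \<Rightarrow> 'a"
    and lam :: real
    and \<mu> \<mu>' v :: complex
    and \<nu> :: "'a measure"
    and \<zeta> :: "'b::finite \<Rightarrow> 'b list"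
    and s :: "real ^ 'b"
    and m :: "((int \<Rightarrow> 'b) \<times> real) measure"
    and D :: "((int \<Rightarrow> 'b) \<times> real) set"
    and \<Psi> :: "(int \<Rightarrow> 'b) \<times> real \<Rightarrow> 'a"
    and \<sigma> :: "'b \<Rightarrow> real measure"
  assumes "closed_foliated_surface X Sing At"
    and "pseudo_anosov X Sing At g lam"
    and "H1_dominant_eigenvalue X g \<mu>"
    and "lam = cmod \<mu>"
    and "galois_conjugate \<mu> \<mu>'" and "\<mu>' \<noteq> \<mu>" and "cmod \<mu>' > 1"
    and "normalized_area X Sing At \<nu>"
    and "v \<in> {1, \<i>}"
    and "symbolic_coding \<zeta> s lam m \<nu> (translation_flow At v) D \<Psi>"
    and "\<And>a. spectral_measure \<nu> (translation_flow At v) (indicator (coding_cell \<zeta> s D \<Psi> a)) (\<sigma> a)"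
  shows "\<exists>\<gamma>>0. \<forall>B>1. \<exists>C>0. \<exists>r0>0. \<forall>r a \<omega>.
           0 < r \<and> r \<le> r0 \<and> 1 / B \<le> \<bar>\<omega>\<bar> \<and> \<bar>\<omega>\<bar> \<le> B \<longrightarrow>
           measure (\<sigma> a) {\<omega> - r .. \<omega> + r} \<le> C * (ln (1 / r)) powr (- \<gamma>)"
proof -
  have lam: "lam > 1" using assms(2) unfolding pseudo_anosov_def by blast
  obtain k where k: "k \<ge> 1" "perron_frobenius (transpose (subst_matrix \<zeta>)) (lam ^ k) s"
    and prim: "primitive_subst \<zeta>" and m: "suspension_invariant_prob \<zeta> s m"
    and iso: "mod0_isomorphism m \<nu> D \<Psi>"
    and conj: "\<And>t. AE p in m. \<Psi> (suspension_flow s t p) = translation_flow At v t (\<Psi> p)"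
    using assms(10) unfolding symbolic_coding_def by blast
  define \<theta> where "\<theta> = lam ^ k"
  have spos: "0 < s $ b" for b using k(2) by (simp add: perron_frobenius_def)
  have es: "expanding_substitution \<zeta> (($) s) \<theta>"
  proof
    show "1 < \<theta>" unfolding \<theta>_def using lam k(1) by (simp add: one_less_power)
    show "sum_list (map (($) s) (\<zeta> b)) = \<theta> * s $ b" for b
    proof -
      have "(transpose (subst_matrix \<zeta>) *v s) $ b = (\<theta> *s s) $ b"
        using k(2) by (simp add: perron_frobenius_def \<theta>_def)
      then show ?thesis
        by (simp add: matrix_vector_mult_def transpose_def subst_matrix_def sum_list_count_list)
    qed
  qed (rule spos)
  interpret expanding_substitution \<zeta> "($) s" \<theta> by (rule es)
  obtain n0 where "\<forall>a b. (((**) (subst_matrix \<zeta>)) ^^ n0) (mat 1) $ a $ b > 0"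
    using prim unfolding primitive_subst_def by blast
  then have n0: "a \<in> set ((subst_word \<zeta> ^^ n0) [b])" for a b
    unfolding subst_matrix_power by (metis count_notin less_irrefl of_nat_0)
  have dom: "cmod \<mu>' < cmod \<mu>"
    using assms(3,5,6) H1_eigenvalue_galois_conjugate unfolding H1_dominant_eigenvalue_def by blast
  obtain y where y: "\<mu> = of_real y" using H1_dominant_eigenvalue_real[OF assms(3)] by (elim Reals_cases)
  \<comment> \<open>An even \<open>K\<close> makes \<open>\<mu> ^ K\<close> a power of
    \<open>lam\<close> whatever the sign of the real number \<open>\<mu>\<close>. That the powers of
    the conjugates remain distinct follows from their moduli; \<open>\<mu>' \<noteq> \<mu>\<close>
    alone would not give it.\<close>
  have window: "escapes_integers (\<theta> ^ j)"
    if j: "even j" "1 \<le> j" for j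
  proof -
    define K where "K = k * j"
    have K: "even K" "1 \<le> K" using j k(1) by (auto simp: K_def)
    have lamK: "\<mu> ^ K = of_real (lam ^ K)"
      using K(1) unfolding assms(4) y by (simp add: power_even_abs)
    have \<theta>K: "\<theta> ^ j = lam ^ K" by (simp add: \<theta>_def K_def power_mult)
    obtain P where P: "irreducible P" "poly (rpoly P) (of_real (lam ^ K)) = 0" "poly (rpoly P) (\<mu>' ^ K) = 0"
      using galois_conjugate_power[OF assms(5), of K] unfolding galois_conjugate_def lamK by blast
    show ?thesis unfolding \<theta>K
    proof (rule escapes_integers_if_conjugate_outside_unit_disc[OF P])
      show "1 < lam ^ K" using lam K by (simp add: one_less_power)
      show "1 < cmod (\<mu>' ^ K)" using assms(7) K by (simp add: norm_power one_less_power)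
      show "\<mu>' ^ K \<noteq> of_real (lam ^ K)"
      proof
        assume "\<mu>' ^ K = of_real (lam ^ K)"
        then have "cmod \<mu>' ^ K = cmod \<mu> ^ K" using lamK by (metis norm_power)
        then show False using dom K power_strict_mono[of "cmod \<mu>'" "cmod \<mu>" K] by simp
      qed
    qed
  qed
  obtain \<gamma> where \<gamma>: "0 < \<gamma>" "\<gamma> \<le> 1" and tw: "\<And>B. B > 1 \<Longrightarrow> \<exists>C>0. \<forall>\<omega> a w n b T. 1 / B \<le> \<bar>\<omega>\<bar> \<and> \<bar>\<omega>\<bar> \<le> B \<and> 1 \<le> T \<and>
     sublist w ((subst_word \<zeta> ^^ n) [b]) \<and> len w < smin * \<theta> ^ T \<longrightarrow>
     cmod (twisted_sum (($) s) \<omega> a w) \<le> C * \<theta> ^ T * real T powr - \<gamma>"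
    using twisted_sum_log_saving[OF n0 window] by blast
  interpret foliated_space X Sing At
    by unfold_locales (use assms(1) in \<open>auto simp: closed_foliated_surface_def\<close>)
  have \<nu>: "sets \<nu> = sets borel_of_X" using assms(8) unfolding normalized_area_def by blast
  have flow: "translation_flow At v t \<in> measurable \<nu> \<nu>" for t
  proof -
    have "cmod v = 1" using assms(9) by auto
    from measurable_translation_flow[OF this] show ?thesis
      by (subst measurable_cong_sets[OF \<nu> \<nu>])
  qed
  have m1: "prob_space m" using m unfolding suspension_invariant_prob_def by blast
  have corr: "(\<integral>w. e (w * t) \<partial>\<sigma> a) = of_real (\<integral>p. indicator (suspension_cell \<zeta> s a) (suspension_flow s t p) *
      indicator (suspension_cell \<zeta> s a) p \<partial>m)" for t a
    by (rule spectral_measure_coding_cell[OF m iso conj flow assms(11)])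
  \<comment> \<open>The exponent of the twisted sums doubles, as their square enters the spectral
    estimate.\<close>
  show ?thesis
  proof (rule exI[of _ "2 * \<gamma>"], intro conjI allI impI)
    show "0 < 2 * \<gamma>" using \<gamma> by simp
    fix B :: real assume B: "B > 1"
    obtain C0 where C0: "C0 > 0" and tw0: "\<And>\<omega> a w n b T. 1 / B \<le> \<bar>\<omega>\<bar> \<Longrightarrow> \<bar>\<omega>\<bar> \<le> B \<Longrightarrow> 1 \<le> T \<Longrightarrow>
      sublist w ((subst_word \<zeta> ^^ n) [b]) \<Longrightarrow> len w < smin * \<theta> ^ T \<Longrightarrow>
      cmod (twisted_sum (($) s) \<omega> a w) \<le> C0 * \<theta> ^ T * real T powr - \<gamma>"
      using tw[OF B] by blast
    have "\<exists>C>0. \<exists>R0\<ge>6. \<forall>R\<ge>R0. \<exists>N \<tau>. 1 \<le> N \<and> 0 < \<tau> \<and> real N * \<tau> = R \<and>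
      (\<forall>\<omega> a p. 1 / B \<le> \<bar>\<omega>\<bar> \<longrightarrow> \<bar>\<omega>\<bar> \<le> B \<longrightarrow> p \<in> suspension_space \<zeta> s \<longrightarrow>
        cmod (\<Sum>j<N. e (- \<omega> * (real j * \<tau>)) * of_bool (fst (suspension_flow s (real j * \<tau>) p) 0 = a))
          \<le> C * real N * ln R powr - \<gamma>)"
      by (rule normalized_twisted_sum_le[OF es \<gamma> B C0]) (rule tw0)
    then obtain C R0 where C: "C > 0" and R0: "R0 \<ge> 6" and bnd: "\<And>R. R \<ge> R0 \<Longrightarrow> \<exists>N \<tau>. 1 \<le> N \<and> 0 < \<tau> \<and> real N * \<tau> = R \<and>
      (\<forall>\<omega> a p. 1 / B \<le> \<bar>\<omega>\<bar> \<longrightarrow> \<bar>\<omega>\<bar> \<le> B \<longrightarrow> p \<in> suspension_space \<zeta> s \<longrightarrow>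
        cmod (\<Sum>j<N. e (- \<omega> * (real j * \<tau>)) * of_bool (fst (suspension_flow s (real j * \<tau>) p) 0 = a))
          \<le> C * real N * ln R powr - \<gamma>)"
      by blast
    \<comment> \<open>The 4 comes from the kernel bound, \<open>2 powr (2 * \<gamma>)\<close> from
      replacing \<open>ln R\<close> by \<open>ln (1 / r) / 2\<close>.\<close>
    define C' where "C' = 4 * C\<^sup>2 * 2 powr (2 * \<gamma>)"
    have C': "C' > 0" using C by (simp add: C'_def)
    define r0 where "r0 = 1 / (6 * R0)"
    have r0: "r0 > 0" using R0 by (simp add: r0_def)
    show "\<exists>C>0. \<exists>r0>0. \<forall>r a \<omega>. 0 < r \<and> r \<le> r0 \<and> 1 / B \<le> \<bar>\<omega>\<bar> \<and> \<bar>\<omega>\<bar> \<le> B \<longrightarrow>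
           measure (\<sigma> a) {\<omega> - r .. \<omega> + r} \<le> C * (ln (1 / r)) powr (- (2 * \<gamma>))"
    proof (rule exI[of _ C'], intro conjI, rule C', rule exI[of _ r0], intro conjI allI impI, rule r0)
      fix r a \<omega>
      assume h: "0 < r \<and> r \<le> r0 \<and> 1 / B \<le> \<bar>\<omega>\<bar> \<and> \<bar>\<omega>\<bar> \<le> B"
      define R where "R = 1 / (6 * r)"
      have "R0 \<le> R" using h R0 by (simp add: R_def r0_def field_simps)
      from bnd[OF this] obtain N \<tau> where N: "1 \<le> N" "0 < \<tau>" "real N * \<tau> = R"
        and sm: "\<And>p. p \<in> suspension_space \<zeta> s \<Longrightarrow>
          cmod (\<Sum>j<N. e (- \<omega> * (real j * \<tau>)) * of_bool (fst (suspension_flow s (real j * \<tau>) p) 0 = a))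
          \<le> C * real N * ln R powr - \<gamma>"
        using h by blast
      define F where "F = (\<lambda>j p. indicator (suspension_cell \<zeta> s a) (suspension_flow s (real j * \<tau>) p) :: real)"
      have A: "suspension_cell \<zeta> s a \<in> sets m" by (rule suspension_cell_sets[OF m])
      have "measure (\<sigma> a) {\<omega> - r .. \<omega> + r} \<le> 4 * (C * real N * ln R powr - \<gamma>)\<^sup>2 / (real N)\<^sup>2"
      proof (rule spectral_measure_interval_le[OF _ _ m1])
        show "finite_measure (\<sigma> a)" "sets (\<sigma> a) = sets borel"
          using assms(11)[of a] unfolding spectral_measure_def by blast+
        show "F j \<in> borel_measurable m" for j
        proof -
          have "suspension_flow s (real j * \<tau>) \<in> measurable m m"
            using m unfolding suspension_invariant_prob_def by blast
          then show ?thesis unfolding F_def by (rule measurable_compose[OF _ borel_measurable_indicator[OF A]])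
        qed
        show "\<bar>F j p\<bar> \<le> 1" for j p by (simp add: F_def indicator_def)
        show "(\<integral>w. e (w * ((real j - real l) * \<tau>)) \<partial>\<sigma> a) = of_real (\<integral>p. F j p * F l p \<partial>m)" for j l
          unfolding corr F_def suspension_correlation[OF spos m A] by (simp only: left_diff_distrib)
        show "cmod (\<Sum>j<N. e (- \<omega> * (real j * \<tau>)) * of_real (F j p)) \<le> C * real N * ln R powr - \<gamma>"
          if p: "p \<in> space m" for p
        proof -
          have ps: "p \<in> suspension_space \<zeta> s" using p space_suspension_invariant_prob[OF m] by simp
          have "of_real (F j p) = (of_bool (fst (suspension_flow s (real j * \<tau>) p) 0 = a) :: complex)" for j
            using suspension_flow_in_space[OF spos ps, of "real j * \<tau>"]
            by (auto simp: F_def indicator_def suspension_cell_def split: prod.splits)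
          then show ?thesis using sm[OF ps] by simp
        qed
        show "0 \<le> \<tau>" "0 \<le> r" "r * (real N * \<tau>) \<le> 1 / 6" "1 \<le> N" using N h by (auto simp: R_def)
      qed
      also have "\<dots> = 4 * C\<^sup>2 * ln R powr - (2 * \<gamma>)"
      proof -
        have "(ln R powr - \<gamma>)\<^sup>2 = ln R powr - (2 * \<gamma>)"
          by (simp add: power2_eq_square flip: powr_add)
        then show ?thesis using N(1) by (simp add: power_mult_distrib)
      qed
      also have "\<dots> \<le> 4 * C\<^sup>2 * (2 powr (2 * \<gamma>) * ln (1 / r) powr - (2 * \<gamma>))"
      proof (intro mult_left_mono)
        \<comment> \<open>\<open>R0 \<ge> 6\<close> forces \<open>r \<le> 1 / 36\<close>, which
          amounts to \<open>1 / r \<le> R ^ 2\<close> for \<open>R = 1 / (6 * r)\<close>.\<close>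
        have r36: "r \<le> 1 / 36"
        proof -
          have "r0 \<le> 1 / (6 * 6)" unfolding r0_def using R0 by (intro divide_left_mono) auto
          then show ?thesis using h by simp
        qed
        have l1: "0 < ln (1 / r)" using h r36 by simp
        have "ln (1 / r) / 2 \<le> ln R"
        proof -
          have "1 / r \<le> R ^ 2"
          proof -
            have "36 * r \<le> 1" using r36 by simp
            then show ?thesis using h by (simp add: R_def field_simps power2_eq_square)
          qed
          then have "ln (1 / r) \<le> ln (R ^ 2)" using h by (subst ln_le_cancel_iff) (auto simp: R_def)
          also have "\<dots> = 2 * ln R" using h by (simp add: R_def ln_realpow)
          finally show ?thesis by simp
        qed
        then have "ln R powr - (2 * \<gamma>) \<le> (ln (1 / r) / 2) powr - (2 * \<gamma>)"
          using l1 \<gamma> by (intro powr_mono2') auto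
        also have "\<dots> = 2 powr (2 * \<gamma>) * ln (1 / r) powr - (2 * \<gamma>)"
          using l1 by (simp add: powr_divide powr_minus field_simps)
        finally show "ln R powr - (2 * \<gamma>) \<le> 2 powr (2 * \<gamma>) * ln (1 / r) powr - (2 * \<gamma>)" .
      qed simp
      finally show "measure (\<sigma> a) {\<omega> - r .. \<omega> + r} \<le> C' * (ln (1 / r)) powr (- (2 * \<gamma>))"
        by (simp add: C'_def mult.assoc)
    qed
  qed
qed

end
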